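(* Let $\kappa>0$, $\gamma\in(0,1/2)$, and let $Y\subset X$ be Sobolev spaces on $\mathbb{T}^3$ embedded in $W^{1,4}(\mathbb{T}^3)$. Then the magneto-geostrophic equations $$\partial_t\Theta+U\cdot\nabla\Theta+\kappa(-\Delta)^\gamma\Theta=S,\qquad \nabla\cdot U=0,\quad U_j=M_j\Theta\ (j=1,2,3)$$ are locally Lipschitz $(X,Y)$ ill-posed; that is, there is a smooth time-independent source term $S$ for which the associated Cauchy problem is not locally Lipschitz $(X,Y)$ well-posed.
   Context: Setting. $\mathbb{T}^3=(\mathbb{R}/2\pi\mathbb{Z})^3$; $\hat f(k)$, $k=(k_1,k_2,k_3)\in\mathbb{Z}^3$, are Fourier coefficients; $\Omega,\beta,\eta,\kappa>0$ are fixed parameters. The operators $M_j$ are Fourier multipliers, $\widehat{M_j\Theta}(k)=\hat M_j(k)\hat\Theta(k)$, where for $k_3\neq0$ $$\hat M_1(k)=\frac{2\Omega k_2k_3|k|^2-(\beta^2/\eta)k_1k_2^2k_3}{4\Omega^2k_3^2|k|^2+(\beta^2/\eta)^2k_2^4},\quad \hat M_2(k)=\frac{-2\Omega k_1k_3|k|^2-(\beta^2/\eta)k_2^3k_3}{4\Omega^2k_3^2|k|^2+(\beta^2/\eta)^2k_2^4},\quad \hat M_3(k)=\frac{(\beta^2/\eta)k_2^2(k_1^2+k_2^2)}{4\Omega^2k_3^2|k|^2+(\beta^2/\eta)^2k_2^4},$$ and $\hat M_j(k)=0$ when $k_3=0$ (so $U$ has zero vertical mean). Definition (Lipschitz local well-posedness).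 Let $Y\subset X\subset W^{1,4}$ be Banach spaces. For a given source $S$, the Cauchy problem is locally Lipschitz $(X,Y)$ well-posed if there exist continuous functions $T,K:[0,\infty)^2\to(0,\infty)$ such that for every pair of initial data $\Theta^{(1)}(0,\cdot),\Theta^{(2)}(0,\cdot)\in Y$ there exist unique solutions $\Theta^{(1)},\Theta^{(2)}\in L^\infty(0,T;X)$ of the corresponding initial value problems, which additionally satisfy $$\|\Theta^{(1)}(t,\cdot)-\Theta^{(2)}(t,\cdot)\|_X\le K\,\|\Theta^{(1)}(0,\cdot)-\Theta^{(2)}(0,\cdot)\|_Y\quad\text{for every }t\in[0,T],$$ where $T=T(\|\Theta^{(1)}(0,\cdot)\|_Y,\|\Theta^{(2)}(0,\cdot)\|_Y)$ and $K=K(\|\Theta^{(1)}(0,\cdot)\|_Y,\|\Theta^{(2)}(0,\cdot)\|_Y)$ (these may also depend on $S$ and $\kappa$). Ill-posed means not well-posed. Typical spaces are $X=H^s$, $Y=H^{s+1}$ with $s>1+3/4$. Solutions are understood in the weak sense: for all smooth $\varphi$ on $\mathbb{T}^3$ and all $t\in(0,T)$, $\int(\Theta(t,\cdot)-\Theta(0,\cdot))\varphi\,dx+\kappa\int_0^t\int\Theta(-\Delta)^\gamma\varphi\,dx\,d\tau-\int_0^t\int\Theta\,U\cdot\nabla\varphi\,dx\,d\tau=\int_0^t\int S\varphi\,dx\,d\tau$. *)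

theory Defs
  imports "HOL-Analysis.Analysis"
begin

section \<open>The torus\<close>

text \<open>Measurable functions on the torus are represented by functions on the fundamental cube
  (values outside the cube are never looked at); smooth functions on the torus are smooth
  functions on the whole space that are periodic with period 2 pi in each variable.\<close>

definition torus :: "(real^3) measure" where
  "torus = lebesgue_on (cbox 0 (\<chi> i. 2 * pi))"

definition partial :: "3 \<Rightarrow> (real^3 \<Rightarrow> real) \<Rightarrow> real^3 \<Rightarrow> real" where
  "partial i f x = frechet_derivative f (at x) (axis i 1)"

definition grad :: "(real^3 \<Rightarrow> real) \<Rightarrow> real^3 \<Rightarrow> real^3" where
  "grad f x = (\<chi> i. partial i f x)"

definition mi_order :: "nat^3 \<Rightarrow> nat" where
  "mi_order \<alpha> = (\<Sum>i\<in>UNIV. \<alpha> $ i)"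

definition mi_partial :: "nat^3 \<Rightarrow> (real^3 \<Rightarrow> real) \<Rightarrow> real^3 \<Rightarrow> real" where
  "mi_partial \<alpha> f = (partial 1 ^^ (\<alpha> $ 1)) ((partial 2 ^^ (\<alpha> $ 2)) ((partial 3 ^^ (\<alpha> $ 3)) f))"

definition smooth_torus :: "(real^3 \<Rightarrow> real) \<Rightarrow> bool" where
  "smooth_torus \<phi> \<longleftrightarrow>
     (\<forall>\<alpha> x. mi_partial \<alpha> \<phi> differentiable (at x)) \<and>
     (\<forall>i x. \<phi> (x + (2 * pi) *\<^sub>R axis i 1) = \<phi> x)"

section \<open>Fourier coefficients, Lebesgue spaces, Fourier multipliers\<close>

definition freq_sq :: "int^3 \<Rightarrow> real" where
  "freq_sq k = (\<Sum>i\<in>UNIV. (of_int (k $ i))\<^sup>2)"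

definition fourier :: "(real^3 \<Rightarrow> real) \<Rightarrow> int^3 \<Rightarrow> complex" where
  "fourier f k = complex_of_real (1 / (2 * pi) ^ 3) *
     (LINT x|torus. complex_of_real (f x) * cis (- (\<Sum>i\<in>UNIV. of_int (k $ i) * x $ i)))"

definition in_Lp :: "ennreal \<Rightarrow> (real^3 \<Rightarrow> real) \<Rightarrow> bool" where
  "in_Lp p f \<longleftrightarrow> f \<in> borel_measurable torus \<and>
     (if p = \<infinity> then \<exists>C. AE x in torus. \<bar>f x\<bar> \<le> C
      else integrable torus (\<lambda>x. \<bar>f x\<bar> powr enn2real p))"

definition Lp_norm :: "ennreal \<Rightarrow> (real^3 \<Rightarrow> real) \<Rightarrow> real" where
  "Lp_norm p f =
     (if p = \<infinity> then Inf {C. 0 \<le> C \<and> (AE x in torus. \<bar>f x\<bar> \<le> C)}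
      else (LINT x|torus. \<bar>f x\<bar> powr enn2real p) powr (1 / enn2real p))"

definition is_multiplier_image ::
    "ennreal \<Rightarrow> (int^3 \<Rightarrow> real) \<Rightarrow> (real^3 \<Rightarrow> real) \<Rightarrow> (real^3 \<Rightarrow> real) \<Rightarrow> bool" where
  "is_multiplier_image p m f g \<longleftrightarrow>
     in_Lp p g \<and> (\<forall>k. fourier g k = complex_of_real (m k) * fourier f k)"

text \<open>Fourier multiplier operators, as used for the velocity and the fractional Laplacian. The
  image is determined up to a null set by its Fourier coefficients. It exists in the
  square-integrable functions whenever f is in the Sobolev space of order 1 and m grows at
  most linearly, which is the case for the velocity symbols below.\<close>

definition multiplier_op :: "(int^3 \<Rightarrow> real) \<Rightarrow> (real^3 \<Rightarrow> real) \<Rightarrow> real^3 \<Rightarrow> real" where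
  "multiplier_op m f = (SOME g. is_multiplier_image 2 m f g)"

definition frac_laplacian :: "real \<Rightarrow> (real^3 \<Rightarrow> real) \<Rightarrow> real^3 \<Rightarrow> real" where
  "frac_laplacian \<gamma> = multiplier_op (\<lambda>k. freq_sq k powr \<gamma>)"

section \<open>Sobolev spaces\<close>

text \<open>A normed space of functions on the torus, modulo equality almost everywhere.\<close>

record torus_space =
  sp_carrier :: "(real^3 \<Rightarrow> real) set"
  sp_norm :: "(real^3 \<Rightarrow> real) \<Rightarrow> real"

definition is_weak_deriv :: "nat^3 \<Rightarrow> (real^3 \<Rightarrow> real) \<Rightarrow> (real^3 \<Rightarrow> real) \<Rightarrow> bool" where
  "is_weak_deriv \<alpha> f g \<longleftrightarrow> in_Lp 1 g \<and>
     (\<forall>\<phi>. smooth_torus \<phi> \<longrightarrow>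
        (LINT x|torus. f x * mi_partial \<alpha> \<phi> x) = (-1) ^ mi_order \<alpha> * (LINT x|torus. g x * \<phi> x))"

definition weak_deriv :: "nat^3 \<Rightarrow> (real^3 \<Rightarrow> real) \<Rightarrow> real^3 \<Rightarrow> real" where
  "weak_deriv \<alpha> f = (SOME g. is_weak_deriv \<alpha> f g)"

definition sobolev_W :: "nat \<Rightarrow> ennreal \<Rightarrow> torus_space" where
  "sobolev_W m p =
     \<lparr> sp_carrier = {f. in_Lp p f \<and>
          (\<forall>\<alpha>. mi_order \<alpha> \<le> m \<longrightarrow> (\<exists>g. in_Lp p g \<and> is_weak_deriv \<alpha> f g))},
       sp_norm = (\<lambda>f. \<Sum>\<alpha> | mi_order \<alpha> \<le> m. Lp_norm p (weak_deriv \<alpha> f)) \<rparr>"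

text \<open>The Bessel potential spaces of real order s; for p = 2 these are the spaces H^s.\<close>

definition sobolev_H :: "real \<Rightarrow> ennreal \<Rightarrow> torus_space" where
  "sobolev_H s p =
     \<lparr> sp_carrier = {f. in_Lp 1 f \<and>
          (\<exists>g. is_multiplier_image p (\<lambda>k. (1 + freq_sq k) powr (s / 2)) f g)},
       sp_norm = (\<lambda>f. Lp_norm p
          (SOME g. is_multiplier_image p (\<lambda>k. (1 + freq_sq k) powr (s / 2)) f g)) \<rparr>"

definition sobolev_space :: "torus_space \<Rightarrow> bool" where
  "sobolev_space X \<longleftrightarrow>
     (\<exists>m p. 1 \<le> p \<and> X = sobolev_W m p) \<or>
     (\<exists>s p. 0 \<le> s \<and> 1 < p \<and> p < \<infinity> \<and> X = sobolev_H s p)"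

definition embedded :: "torus_space \<Rightarrow> torus_space \<Rightarrow> bool" where
  "embedded Y X \<longleftrightarrow> sp_carrier Y \<subseteq> sp_carrier X \<and>
     (\<exists>C. \<forall>f\<in>sp_carrier Y. sp_norm X f \<le> C * sp_norm Y f)"

text \<open>Membership in the Bochner space of essentially bounded functions from (0,T) to X:
  essential boundedness and strong measurability.\<close>

definition in_Linf_time :: "real \<Rightarrow> torus_space \<Rightarrow> (real \<Rightarrow> real^3 \<Rightarrow> real) \<Rightarrow> bool" where
  "in_Linf_time T X \<Theta> \<longleftrightarrow>
     (\<exists>C. AE t in lebesgue_on {0<..<T}. \<Theta> t \<in> sp_carrier X \<and> sp_norm X (\<Theta> t) \<le> C) \<and>
     (\<exists>s. (\<forall>n::nat. simple_function (lebesgue_on {0<..<T}) (s n) \<and>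
                   s n ` {0<..<T} \<subseteq> sp_carrier X) \<and>
          (AE t in lebesgue_on {0<..<T}.
             (\<lambda>n. sp_norm X (\<lambda>x. s n t x - \<Theta> t x)) \<longlonglongrightarrow> 0))"

section \<open>The magneto-geostrophic equations\<close>

definition MG_denom :: "real \<Rightarrow> real \<Rightarrow> real \<Rightarrow> int^3 \<Rightarrow> real" where
  "MG_denom \<Omega> \<beta> \<eta> k =
     4 * \<Omega>\<^sup>2 * (of_int (k $ 3))\<^sup>2 * freq_sq k + (\<beta>\<^sup>2 / \<eta>)\<^sup>2 * (of_int (k $ 2)) ^ 4"

definition MG_symbol1 :: "real \<Rightarrow> real \<Rightarrow> real \<Rightarrow> int^3 \<Rightarrow> real" where
  "MG_symbol1 \<Omega> \<beta> \<eta> k = (if k $ 3 = 0 then 0 else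
     (2 * \<Omega> * of_int (k $ 2) * of_int (k $ 3) * freq_sq k
        - (\<beta>\<^sup>2 / \<eta>) * of_int (k $ 1) * (of_int (k $ 2))\<^sup>2 * of_int (k $ 3)) / MG_denom \<Omega> \<beta> \<eta> k)"

definition MG_symbol2 :: "real \<Rightarrow> real \<Rightarrow> real \<Rightarrow> int^3 \<Rightarrow> real" where
  "MG_symbol2 \<Omega> \<beta> \<eta> k = (if k $ 3 = 0 then 0 else
     (- 2 * \<Omega> * of_int (k $ 1) * of_int (k $ 3) * freq_sq k
        - (\<beta>\<^sup>2 / \<eta>) * (of_int (k $ 2)) ^ 3 * of_int (k $ 3)) / MG_denom \<Omega> \<beta> \<eta> k)"

definition MG_symbol3 :: "real \<Rightarrow> real \<Rightarrow> real \<Rightarrow> int^3 \<Rightarrow> real" where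
  "MG_symbol3 \<Omega> \<beta> \<eta> k = (if k $ 3 = 0 then 0 else
     ((\<beta>\<^sup>2 / \<eta>) * (of_int (k $ 2))\<^sup>2 * ((of_int (k $ 1))\<^sup>2 + (of_int (k $ 2))\<^sup>2))
       / MG_denom \<Omega> \<beta> \<eta> k)"

definition MG_velocity ::
    "real \<Rightarrow> real \<Rightarrow> real \<Rightarrow> (real^3 \<Rightarrow> real) \<Rightarrow> real^3 \<Rightarrow> real^3" where
  "MG_velocity \<Omega> \<beta> \<eta> \<theta> x = vector
     [multiplier_op (MG_symbol1 \<Omega> \<beta> \<eta>) \<theta> x,
      multiplier_op (MG_symbol2 \<Omega> \<beta> \<eta>) \<theta> x,
      multiplier_op (MG_symbol3 \<Omega> \<beta> \<eta>) \<theta> x]"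

text \<open>The weak formulation fixes the value of the solution at every time in [0,T), not just at
  almost every time, so each such value is required to be an integrable function. The explicit
  integrability in time rules out that a Bochner integral takes its default value 0.\<close>

definition MG_weak_solution ::
    "real \<Rightarrow> real \<Rightarrow> real \<Rightarrow> real \<Rightarrow> real \<Rightarrow> (real^3 \<Rightarrow> real) \<Rightarrow> torus_space \<Rightarrow>
     real \<Rightarrow> (real^3 \<Rightarrow> real) \<Rightarrow> (real \<Rightarrow> real^3 \<Rightarrow> real) \<Rightarrow> bool" where
  "MG_weak_solution \<Omega> \<beta> \<eta> \<kappa> \<gamma> S X T \<theta>0 \<Theta> \<longleftrightarrow>
     in_Linf_time T X \<Theta> \<and>
     (\<forall>t\<in>{0..<T}. in_Lp 1 (\<Theta> t)) \<and>
     (AE x in torus. \<Theta> 0 x = \<theta>0 x) \<and>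
     (AE \<tau> in lebesgue_on {0<..<T}. \<forall>\<phi>. smooth_torus \<phi> \<longrightarrow>
        (LINT x|torus. MG_velocity \<Omega> \<beta> \<eta> (\<Theta> \<tau>) x \<bullet> grad \<phi> x) = 0) \<and>
     (\<forall>\<phi>. smooth_torus \<phi> \<longrightarrow> (\<forall>t\<in>{0<..<T}.
        integrable (lebesgue_on {0<..<t})
          (\<lambda>\<tau>. LINT x|torus. \<Theta> \<tau> x * frac_laplacian \<gamma> \<phi> x) \<and>
        integrable (lebesgue_on {0<..<t})
          (\<lambda>\<tau>. LINT x|torus. \<Theta> \<tau> x * (MG_velocity \<Omega> \<beta> \<eta> (\<Theta> \<tau>) x \<bullet> grad \<phi> x)) \<and>
        (LINT x|torus. (\<Theta> t x - \<Theta> 0 x) * \<phi> x)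
          + \<kappa> * (LINT \<tau>|lebesgue_on {0<..<t}. LINT x|torus. \<Theta> \<tau> x * frac_laplacian \<gamma> \<phi> x)
          - (LINT \<tau>|lebesgue_on {0<..<t}. LINT x|torus.
               \<Theta> \<tau> x * (MG_velocity \<Omega> \<beta> \<eta> (\<Theta> \<tau>) x \<bullet> grad \<phi> x))
        = (LINT \<tau>|lebesgue_on {0<..<t}. LINT x|torus. S x * \<phi> x)))"

text \<open>Uniqueness is equality in the Bochner space, i.e. almost everywhere.\<close>

definition MG_unique_solution ::
    "real \<Rightarrow> real \<Rightarrow> real \<Rightarrow> real \<Rightarrow> real \<Rightarrow> (real^3 \<Rightarrow> real) \<Rightarrow> torus_space \<Rightarrow>
     real \<Rightarrow> (real^3 \<Rightarrow> real) \<Rightarrow> (real \<Rightarrow> real^3 \<Rightarrow> real) \<Rightarrow> bool" where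
  "MG_unique_solution \<Omega> \<beta> \<eta> \<kappa> \<gamma> S X T \<theta>0 \<Theta> \<longleftrightarrow>
     MG_weak_solution \<Omega> \<beta> \<eta> \<kappa> \<gamma> S X T \<theta>0 \<Theta> \<and>
     (\<forall>\<Theta>'. MG_weak_solution \<Omega> \<beta> \<eta> \<kappa> \<gamma> S X T \<theta>0 \<Theta>' \<longrightarrow>
        (AE t in lebesgue_on {0<..<T}. AE x in torus. \<Theta>' t x = \<Theta> t x))"

definition MG_Lipschitz_well_posed ::
    "real \<Rightarrow> real \<Rightarrow> real \<Rightarrow> real \<Rightarrow> real \<Rightarrow> (real^3 \<Rightarrow> real) \<Rightarrow>
     torus_space \<Rightarrow> torus_space \<Rightarrow> bool" where
  "MG_Lipschitz_well_posed \<Omega> \<beta> \<eta> \<kappa> \<gamma> S X Y \<longleftrightarrow>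
     (\<exists>T K :: real \<times> real \<Rightarrow> real.
        continuous_on ({0..} \<times> {0..}) T \<and> continuous_on ({0..} \<times> {0..}) K \<and>
        (\<forall>z \<in> {0..} \<times> {0..}. 0 < T z \<and> 0 < K z) \<and>
        (\<forall>\<theta>1 \<in> sp_carrier Y. \<forall>\<theta>2 \<in> sp_carrier Y.
           let z = (sp_norm Y \<theta>1, sp_norm Y \<theta>2) in
           \<exists>\<Theta>1 \<Theta>2.
             MG_unique_solution \<Omega> \<beta> \<eta> \<kappa> \<gamma> S X (T z) \<theta>1 \<Theta>1 \<and>
             MG_unique_solution \<Omega> \<beta> \<eta> \<kappa> \<gamma> S X (T z) \<theta>2 \<Theta>2 \<and>
             (\<forall>t \<in> {0..T z}.
                (\<lambda>x. \<Theta>1 t x - \<Theta>2 t x) \<in> sp_carrier X \<and>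
                sp_norm X (\<lambda>x. \<Theta>1 t x - \<Theta>2 t x)
                  \<le> K z * sp_norm Y (\<lambda>x. \<theta>1 x - \<theta>2 x))))"

end

theory Submission
  imports Defs
begin

text \<open>The function - 2 sin x3 is a steady state with zero velocity for the source kappa times itself.
  Testing the weak equation of a nearby solution against cos (k x) for k = (j^2, j, n), n = 1, 2, ...,
  gives a tridiagonal system a(n)' = - d(n) a(n) + m(n - 1) a(n - 1) + m(n + 1) a(n + 1), with m(n)
  the third velocity symbol and d(n) the dissipation, up to an error quadratic in the distance to the
  steady state. For small n the coupling m(n) is of order j^2, which beats d(n) of order j^(4 gamma)
  because gamma < 1/2. A positive decaying solution psi of the adjoint recursion turns the sum of
  psi(n) a(n) into a functional that grows at least like exp (c j^2 t). The Lipschitz estimate allows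
  only a factor polynomial in j, a contradiction for large j. The quadratic error and the truncation
  of the sum are made negligible by choosing, for fixed j, first the cutoff and then the size of the
  perturbation. Since the estimates apply to the weak formulation itself, no linearised equation has
  to be solved.\<close>

section \<open>Integration over the torus\<close>

text \<open>The choice k_1 = k_2^2 balances the two terms in the denominator of the symbols. The
  third symbol then has size |k|, the largest order the symbols allow, against |k|^(2 gamma) for the
  dissipation. The modes n >= 1 decouple from the rest because the symbol is zero by convention at n
  = 0.

  The Lipschitz estimate, assumed for contradiction, is itself the a priori bound: a perturbation of
  size \<epsilon> stays within a constant times \<epsilon> of the steady state in W(1,4). The flux
  is bilinear and the steady velocity vanishes, so the remainder is of order \<epsilon>^2, while
  every other term is linear in \<epsilon>; hence \<epsilon> cancels at the end. W(1,4) supplies a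
  square-integrable gradient, which makes a velocity of order one square integrable.

  Since \<open>multiplier_op\<close>, \<open>weak_deriv\<close> and the norms built on them are
  choices, nothing can be said about the velocity before a square-integrable image is shown to exist
  and to be determined by its Fourier coefficients; hence Bessel, Riesz-Fischer and the uniqueness
  of Fourier coefficients.\<close>

lemma integrable_torus_continuous:
  fixes f :: "real^3 \<Rightarrow> 'b::euclidean_space"
  shows "continuous_on UNIV f \<Longrightarrow> integrable torus f"
  unfolding torus_def by (rule continuous_imp_integrable) (rule continuous_on_subset, auto)

lemma space_torus: "space torus = cbox 0 (\<chi> i. 2 * pi)"
  by (simp add: torus_def)

lemma measurable_torus_continuous:
  fixes f :: "real^3 \<Rightarrow> 'b::euclidean_space"
  shows "continuous_on UNIV f \<Longrightarrow> f \<in> borel_measurable torus"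
  using integrable_torus_continuous borel_measurable_integrable by blast

lemma LINT_torus_eq_integral:
  fixes f :: "real^3 \<Rightarrow> 'b::euclidean_space"
  shows "continuous_on UNIV f \<Longrightarrow> (LINT x|torus. f x) = integral (cbox 0 (\<chi> i. 2 * pi)) f"
  using integrable_torus_continuous unfolding torus_def
  by (intro lebesgue_integral_eq_integral) auto

text \<open>The box extended by s in direction i is cut in two ways: into the cube and a slab, and
  into the translated cube and a slab; the two slabs differ by one period.\<close>

lemma torus_integral_shift:
  fixes f :: "real^3 \<Rightarrow> real"
  assumes f: "continuous_on UNIV f" and s: "0 \<le> s" "s \<le> 2 * pi"
    and per: "\<And>x. f (x + (2 * pi) *\<^sub>R axis i 1) = f x"
  shows "(LINT x|torus. f (x + s *\<^sub>R axis i 1)) = (LINT x|torus. f x)"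
proof -
  define P :: "real^3" where "P = (\<chi> i. 2 * pi)"
  define e :: "real^3" where "e = axis i 1"
  define u :: "real \<Rightarrow> real^3" where "u t = (\<chi> j. if j = i then t else 2 * pi)" for t :: real
  let ?L = "cbox 0 (u s)" and ?C = "cbox 0 P" and ?M = "cbox (s *\<^sub>R e) (P + s *\<^sub>R e)"
    and ?R = "cbox ((2*pi) *\<^sub>R e) (u s + (2*pi) *\<^sub>R e)"
  have int: "f integrable_on cbox a b" for a b
    by (rule integrable_continuous) (rule continuous_on_subset[OF f], auto)
  have neg: "negligible {x::real^3. x $ i = t}" for t
    using negligible_standard_hyperplane[of "axis i 1 :: real^3" t] by (simp add: inner_axis axis_in_Basis_iff)
  have "?L \<inter> ?M \<subseteq> {x. x $ i = s}"
    by (auto simp: mem_box_cart u_def e_def P_def dest!: spec[of _ i])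
  then have n1: "negligible (?L \<inter> ?M)" using neg negligible_subset by blast
  have "?C \<inter> ?R \<subseteq> {x. x $ i = 2 * pi}"
    by (auto simp: mem_box_cart u_def e_def P_def dest!: spec[of _ i])
  then have n2: "negligible (?C \<inter> ?R)" using neg negligible_subset by blast
  have ej: "e $ j = (if j = i then 1 else 0)" for j by (simp add: e_def axis_def)
  have mem: "x \<in> cbox a b \<longleftrightarrow> (\<forall>j. a $ j \<le> x $ j \<and> x $ j \<le> b $ j)" for x a b :: "real^3"
    by (simp add: mem_box_cart)
  \<comment> \<open>Used for the pairs (\<open>s\<close>, 2 pi) and (2 pi, \<open>s\<close>). Both
    times the right-hand side is the box of length \<open>s\<close> + 2 pi, which yields the two
    ways of cutting it.\<close>
  have cover: "cbox 0 (u t) \<union> cbox (t *\<^sub>R e) (u t' + t *\<^sub>R e) = cbox 0 (u (t + t'))"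
    if t: "0 \<le> t" "0 \<le> t'" for t t'
  proof (intro equalityI subsetI)
    fix x assume x: "x \<in> cbox 0 (u t) \<union> cbox (t *\<^sub>R e) (u t' + t *\<^sub>R e)"
    have "0 \<le> x $ j \<and> x $ j \<le> u (t + t') $ j" for j
      using x t unfolding Un_iff mem by (auto simp: ej u_def dest!: spec[of _ j] split: if_splits)
    then show "x \<in> cbox 0 (u (t + t'))" by (simp add: mem)
  next
    fix x assume x: "x \<in> cbox 0 (u (t + t'))"
    then have x': "0 \<le> x $ j \<and> x $ j \<le> u (t + t') $ j" for j by (simp add: mem)
    show "x \<in> cbox 0 (u t) \<union> cbox (t *\<^sub>R e) (u t' + t *\<^sub>R e)"
    proof (cases "x $ i \<le> t")
      case True
      have "0 \<le> x $ j \<and> x $ j \<le> u t $ j" for j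
        using x'[of j] True by (auto simp: u_def split: if_splits)
      then show ?thesis by (simp add: mem)
    next
      case False
      have "(t *\<^sub>R e) $ j \<le> x $ j \<and> x $ j \<le> (u t' + t *\<^sub>R e) $ j" for j
        using x'[of j] False by (auto simp: u_def ej split: if_splits)
      then show ?thesis by (simp add: mem)
    qed
  qed
  have P: "P = u (2 * pi)" by (simp add: P_def u_def vec_eq_iff)
  have "?L \<union> ?M = ?C \<union> ?R"
    using cover[of s "2 * pi"] cover[of "2 * pi" s] s by (simp add: P add.commute)
  then have "integral ?L f + integral ?M f = integral ?C f + integral ?R f"
    using integral_Un[OF int int n1] integral_Un[OF int int n2] by simp
  moreover have "integral ?R f = integral ?L f"
    using integral_shift_cbox_plus[of 0 "u s" f "(2*pi) *\<^sub>R e"] per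
    by (simp add: o_def add.commute e_def)
  moreover have "integral ?M f = integral ?C (\<lambda>x. f (x + s *\<^sub>R e))"
    using integral_shift_cbox_plus[of 0 P f "s *\<^sub>R e"] by (simp add: o_def add.commute)
  moreover have "continuous_on UNIV (\<lambda>x. f (x + s *\<^sub>R e))"
    by (intro continuous_on_compose2[OF f]) (auto intro!: continuous_intros)
  ultimately show ?thesis
    using LINT_torus_eq_integral[OF f] LINT_torus_eq_integral[of "\<lambda>x. f (x + s *\<^sub>R e)"]
    by (simp add: P_def e_def)
qed

text \<open>By translation invariance every difference quotient in direction \<open>i\<close> has
  integral zero. The quotients converge to \<open>f'\<close>, and the mean value theorem bounds them
  by a constant, so dominated convergence applies.\<close>

lemma torus_integral_deriv_zero:
  fixes f f' :: "real^3 \<Rightarrow> real"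
  assumes f: "continuous_on UNIV f" and f': "continuous_on UNIV f'"
    and der: "\<And>x. ((\<lambda>s. f (x + s *\<^sub>R axis i 1)) has_real_derivative f' x) (at 0)"
    and per: "\<And>x. f (x + (2 * pi) *\<^sub>R axis i 1) = f x"
  shows "(LINT x|torus. f' x) = 0"
proof -
  define e :: "real^3" where "e = axis i 1"
  define D where "D n x = real (Suc n) * (f (x + (1 / real (Suc n)) *\<^sub>R e) - f x)" for n x
  have der': "((\<lambda>s. f (x + s *\<^sub>R e)) has_real_derivative f' (x + t *\<^sub>R e)) (at t)" for x t
  proof -
    have "((\<lambda>s. f ((x + t *\<^sub>R e) + s *\<^sub>R e)) has_real_derivative f' (x + t *\<^sub>R e)) (at 0)"
      using der[of "x + t *\<^sub>R e"] by (simp add: e_def)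
    then have "((\<lambda>s. f (x + (s + t) *\<^sub>R e)) has_real_derivative f' (x + t *\<^sub>R e)) (at 0)"
      by (simp add: algebra_simps)
    then show ?thesis using DERIV_shift[of "\<lambda>s. f (x + s *\<^sub>R e)" _ 0 t] by simp
  qed
  have sh: "continuous_on UNIV (\<lambda>x. f (x + s *\<^sub>R e))" for s
    by (intro continuous_on_compose2[OF f]) (auto intro!: continuous_intros)
  have zero: "(LINT x|torus. D n x) = 0" for n
  proof -
    have *: "0 \<le> 1 / real (Suc n)" "1 / real (Suc n) \<le> 2 * pi"
      using pi_gt3 by (auto simp: divide_simps) (smt (verit) mult_less_cancel_left2 of_nat_0_le_iff)
    have "(LINT x|torus. D n x) = real (Suc n) * ((LINT x|torus. f (x + (1 / real (Suc n)) *\<^sub>R e)) - (LINT x|torus. f x))"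
      unfolding D_def
      by (subst integral_mult_right_zero, subst Bochner_Integration.integral_diff)
        (auto intro: integrable_torus_continuous sh f)
    also have "\<dots> = 0" unfolding e_def torus_integral_shift[OF f * per] by simp
    finally show ?thesis .
  qed
  \<comment> \<open>The cube is enlarged by 1 because the intermediate point of the mean value
    theorem may lie up to one unit outside it.\<close>
  let ?B = "cbox 0 (\<chi> i. 2 * pi + 1) :: (real^3) set"
  have "bounded (f' ` ?B)"
    by (intro compact_imp_bounded compact_continuous_image continuous_on_subset[OF f']) auto
  then obtain B where B: "\<And>x. x \<in> ?B \<Longrightarrow> \<bar>f' x\<bar> \<le> B" by (auto simp: bounded_iff)
  have bd: "\<bar>D n x\<bar> \<le> B" if x: "x \<in> space torus" for n x
  proof -
    let ?h = "1 / real (Suc n)"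
    obtain z where z: "0 < z" "z < ?h" "f (x + ?h *\<^sub>R e) - f (x + 0 *\<^sub>R e) = (?h - 0) * f' (x + z *\<^sub>R e)"
      using MVT2[of 0 ?h "\<lambda>s. f (x + s *\<^sub>R e)" "\<lambda>s. f' (x + s *\<^sub>R e)"] der' by auto
    have "?h \<le> 1" by simp
    then have z1: "z \<le> 1" using z by linarith
    have "x + z *\<^sub>R e \<in> ?B"
      using x z(1) z1 by (auto simp: space_torus mem_box_cart e_def axis_def intro: add_mono add_increasing2)
    moreover have "D n x = f' (x + z *\<^sub>R e)" using z(3) by (simp add: D_def field_simps)
    ultimately show ?thesis using B by simp
  qed
  have lim: "(\<lambda>n. D n x) \<longlonglongrightarrow> f' x" for x
  proof -
    have "((\<lambda>s. f (x + s *\<^sub>R e)) has_real_derivative f' x) (at 0)" using der e_def by simp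
    then have "((\<lambda>h. (f (x + h *\<^sub>R e) - f x) / h) \<longlongrightarrow> f' x) (at 0)"
      by (simp add: DERIV_def)
    moreover have "filterlim (\<lambda>n. 1 / real (Suc n)) (at 0) sequentially"
      by (rule filterlim_atI) (use LIMSEQ_Suc[OF lim_1_over_n] in auto)
    ultimately have "(\<lambda>n. (f (x + (1 / real (Suc n)) *\<^sub>R e) - f x) / (1 / real (Suc n))) \<longlonglongrightarrow> f' x"
      by (rule filterlim_compose)
    then show ?thesis by (simp add: D_def field_simps)
  qed
  have "(\<lambda>n. LINT x|torus. D n x) \<longlonglongrightarrow> (LINT x|torus. f' x)"
  proof (rule integral_dominated_convergence[where w="\<lambda>_. B"])
    show "f' \<in> borel_measurable torus" using f' by (rule measurable_torus_continuous)
    show "D n \<in> borel_measurable torus" for n unfolding D_def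
      by (rule measurable_torus_continuous) (intro continuous_intros sh f)
    show "integrable torus (\<lambda>_. B)" by (rule integrable_torus_continuous) auto
    show "AE x in torus. (\<lambda>n. D n x) \<longlonglongrightarrow> f' x" using lim by simp
    show "AE x in torus. norm (D n x) \<le> B" for n using bd by auto
  qed
  then show ?thesis using zero by (simp add: LIMSEQ_const_iff)
qed

lemma has_derivative_axis:
  assumes "f differentiable (at x)"
  shows "((\<lambda>s. f (x + s *\<^sub>R axis i 1)) has_real_derivative partial i f x) (at 0)"
proof -
  have D: "(f has_derivative frechet_derivative f (at x)) (at (x + 0 *\<^sub>R axis i 1))"
    using assms by (simp add: frechet_derivative_works)
  have "((\<lambda>s::real. x + s *\<^sub>R axis i 1) has_derivative (\<lambda>s. s *\<^sub>R axis i 1)) (at 0)"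
    by (auto intro!: derivative_eq_intros)
  from diff_chain_at[OF this D]
  have "((\<lambda>s. f (x + s *\<^sub>R axis i 1)) has_derivative (\<lambda>s. frechet_derivative f (at x) (s *\<^sub>R axis i 1))) (at 0)"
    by (simp add: o_def)
  moreover have "frechet_derivative f (at x) (s *\<^sub>R axis i 1) = partial i f x * s" for s
    using linear_frechet_derivative[OF assms] by (simp add: linear_cmul partial_def)
  ultimately show ?thesis by (simp add: has_field_derivative_def)
qed

lemma torus_integral_partial_zero:
  assumes "\<And>x. f differentiable (at x)" "continuous_on UNIV (partial i f)"
    and "\<And>x. f (x + (2 * pi) *\<^sub>R axis i 1) = f x"
  shows "(LINT x|torus. partial i f x) = 0"
proof (rule torus_integral_deriv_zero[OF _ assms(2) has_derivative_axis[OF assms(1)] assms(3)])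
  show "continuous_on UNIV f"
    using assms(1) by (simp add: continuous_at_imp_continuous_on differentiable_imp_continuous_within)
qed

lemma partial_periodic:
  assumes "\<And>x. f differentiable (at x)" "\<And>x. f (x + p) = f x"
  shows "partial i f (x + p) = partial i f x"
proof -
  have D: "(f has_derivative frechet_derivative f (at (x + p))) (at (x + p))"
    using assms(1) by (simp add: frechet_derivative_works)
  have "((\<lambda>y. y + p) has_derivative (\<lambda>y. y)) (at x)" by (auto intro!: derivative_eq_intros)
  from diff_chain_at[OF this D]
  have "(f has_derivative frechet_derivative f (at (x + p))) (at x)"
    using assms(2) by (simp add: o_def)
  then have "frechet_derivative f (at (x + p)) = frechet_derivative f (at x)"
    by (rule frechet_derivative_at)
  then show ?thesis by (simp add: partial_def)
qed

lemma partial_mult: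
  assumes "f differentiable (at x)" "g differentiable (at x)"
  shows "partial i (\<lambda>x. f x * g x) x = f x * partial i g x + partial i f x * g x"
proof -
  have "((\<lambda>x. f x * g x) has_derivative
      (\<lambda>h. f x * frechet_derivative g (at x) h + frechet_derivative f (at x) h * g x)) (at x)"
    using has_derivative_mult assms frechet_derivative_works by blast
  from frechet_derivative_at[OF this, symmetric] show ?thesis by (simp add: partial_def)
qed

lemma torus_integral_by_parts:
  assumes f: "\<And>x. f differentiable (at x)" "continuous_on UNIV (partial i f)"
      "\<And>x. f (x + (2 * pi) *\<^sub>R axis i 1) = f x"
    and g: "\<And>x. g differentiable (at x)" "continuous_on UNIV (partial i g)"
      "\<And>x. g (x + (2 * pi) *\<^sub>R axis i 1) = g x"
  shows "(LINT x|torus. f x * partial i g x) = - (LINT x|torus. partial i f x * g x)"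
proof -
  have c: "continuous_on UNIV f" "continuous_on UNIV g"
    using f g by (simp_all add: continuous_at_imp_continuous_on differentiable_imp_continuous_within)
  have eq: "partial i (\<lambda>x. f x * g x) = (\<lambda>x. f x * partial i g x + partial i f x * g x)"
    using partial_mult f g by blast
  have "(LINT x|torus. partial i (\<lambda>x. f x * g x) x) = 0"
    by (rule torus_integral_partial_zero)
      (use f g in \<open>auto simp: eq intro!: continuous_intros c derivative_intros\<close>)
  then show ?thesis unfolding eq
    by (subst (asm) Bochner_Integration.integral_add)
      (auto intro!: integrable_torus_continuous continuous_intros c f g)
qed

section \<open>Waves\<close>

definition kdot :: "int^3 \<Rightarrow> real^3 \<Rightarrow> real" where
  "kdot k x = (\<Sum>i\<in>UNIV. of_int (k $ i) * x $ i)"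

text \<open>The phase puts cosine and sine into one family. A derivative multiplies by a component
  of \<open>k\<close> and adds pi / 2 to the phase, so iterated derivatives and integrations by
  parts never leave the family.\<close>

definition wave :: "int^3 \<Rightarrow> real \<Rightarrow> real^3 \<Rightarrow> real" where
  "wave k \<theta> x = cos (kdot k x + \<theta>)"

lemma kdot_add: "kdot (k + l) x = kdot k x + kdot l x"
  and kdot_diff: "kdot (k - l) x = kdot k x - kdot l x"
  and kdot_minus: "kdot (- k) x = - kdot k x"
  and kdot_zero: "kdot 0 x = 0"
  and kdot_add_right: "kdot k (x + y) = kdot k x + kdot k y"
  and kdot_scale_right: "kdot k (a *\<^sub>R x) = a * kdot k x"
  and kdot_axis: "kdot k (axis i 1) = of_int (k $ i)"
  by (simp_all add: kdot_def sum.distrib sum_subtractf sum_negf ring_distribs sum_distrib_left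
      mult.left_commute axis_def if_distrib sum.delta' cong: if_cong)

lemma wave_has_derivative:
  "((\<lambda>x. a * wave k \<theta> x) has_derivative (\<lambda>h. a * wave k (\<theta> + pi / 2) x * kdot k h)) (at x)"
proof -
  have l: "((\<lambda>x. kdot k x) has_derivative (\<lambda>h. kdot k h)) (at x)"
    unfolding kdot_def by (auto intro!: derivative_eq_intros simp: bounded_linear_imp_has_derivative bounded_linear_vec_nth)
  have "wave k (\<theta> + pi / 2) x = - sin (kdot k x + \<theta>)"
    by (simp add: wave_def add.assoc[symmetric] cos_add)
  then show ?thesis unfolding wave_def[of k \<theta>]
    by (auto intro!: derivative_eq_intros l)
qed

lemma wave_differentiable: "(\<lambda>x. a * wave k \<theta> x) differentiable (at x)"
  using wave_has_derivative differentiable_def by blast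

lemma continuous_wave [continuous_intros]: "continuous_on S (wave k \<theta>)"
  unfolding wave_def kdot_def by (intro continuous_intros)

lemma abs_wave_le: "\<bar>wave k \<theta> x\<bar> \<le> 1"
  by (simp add: wave_def)

lemma wave_periodic: "wave k \<theta> (x + (2 * pi) *\<^sub>R axis i 1) = wave k \<theta> x"
proof -
  have "kdot k (x + (2 * pi) *\<^sub>R axis i 1) + \<theta> = (kdot k x + \<theta>) + 2 * pi * of_int (k $ i)"
    by (simp add: kdot_add_right kdot_scale_right kdot_axis)
  then show ?thesis by (simp only: wave_def cos_add[of "kdot k x + \<theta>"] cos_int_2pin sin_int_2pin mult_1_right mult_zero_right diff_zero)
qed

lemma partial_wave:
  "partial i (\<lambda>x. a * wave k \<theta> x) = (\<lambda>x. (a * of_int (k $ i)) * wave k (\<theta> + pi / 2) x)"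
  by (rule ext) (simp add: partial_def frechet_derivative_at[OF wave_has_derivative, symmetric] kdot_axis)

lemma partial_wave_funpow:
  "(partial i ^^ n) (\<lambda>x. a * wave k \<theta> x) = (\<lambda>x. (a * of_int (k $ i) ^ n) * wave k (\<theta> + n * (pi / 2)) x)"
proof (induction n)
  case (Suc n)
  have "\<theta> + n * (pi / 2) + pi / 2 = \<theta> + Suc n * (pi / 2)" by (simp add: field_simps)
  moreover have "a * of_int (k $ i) ^ n * of_int (k $ i) = a * of_int (k $ i) ^ Suc n"
    by simp
  ultimately show ?case
    by (simp only: funpow.simps o_apply Suc.IH partial_wave)
qed simp

text \<open>The Fourier symbol of the derivative of multi-index \<alpha>, without its power of the
  imaginary unit; that power reappears as a shift of the phase by multiples of pi / 2.\<close>

definition mono_symbol :: "nat^3 \<Rightarrow> int^3 \<Rightarrow> real" where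
  "mono_symbol \<alpha> k = of_int (k $ 1) ^ (\<alpha> $ 1) * of_int (k $ 2) ^ (\<alpha> $ 2) * of_int (k $ 3) ^ (\<alpha> $ 3)"

lemma mi_partial_wave:
  "mi_partial \<alpha> (\<lambda>x. a * wave k \<theta> x) =
    (\<lambda>x. (a * mono_symbol \<alpha> k) * wave k (\<theta> + mi_order \<alpha> * (pi / 2)) x)"
  unfolding mi_partial_def partial_wave_funpow
  by (simp add: mono_symbol_def mi_order_def sum_3 distrib_right distrib_left add_divide_distrib mult_ac add_ac)

lemma smooth_torus_wave: "smooth_torus (\<lambda>x. a * wave k \<theta> x)"
  by (simp only: smooth_torus_def mi_partial_wave wave_differentiable wave_periodic simp_thms)

lemma smooth_torus_wave1: "smooth_torus (wave k \<theta>)"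
  using smooth_torus_wave[of 1] by simp

lemma smooth_torus_funpow:
  assumes "smooth_torus \<phi>"
  shows "(partial 1 ^^ a) ((partial 2 ^^ b) ((partial 3 ^^ c) \<phi>)) differentiable (at x)"
  using assms unfolding smooth_torus_def mi_partial_def
  by (metis vector_3)

lemma partial_funpow_periodic:
  assumes "\<And>n x. (partial i ^^ n) f differentiable (at x)" "\<And>x. f (x + p) = f x"
  shows "(partial i ^^ n) f (x + p) = (partial i ^^ n) f x"
  by (induction n arbitrary: x) (simp_all add: assms partial_periodic)

lemma differentiable_imp_continuous_UNIV:
  fixes f :: "real^3 \<Rightarrow> real"
  assumes "\<And>x. f differentiable (at x)"
  shows "continuous_on UNIV f"
  using assms by (simp add: continuous_at_imp_continuous_on differentiable_imp_continuous_within)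

lemma wave_parts_funpow:
  assumes d: "\<And>n x. (partial i ^^ n) g differentiable (at x)"
    and per: "\<And>x. g (x + (2 * pi) *\<^sub>R axis i 1) = g x"
  shows "(LINT x|torus. (a * wave k \<theta> x) * (partial i ^^ n) g x) =
    (-1) ^ n * (LINT x|torus. (a * of_int (k $ i) ^ n * wave k (\<theta> + n * (pi / 2)) x) * g x)"
proof (induction n arbitrary: a \<theta>)
  case (Suc n)
  have "(LINT x|torus. (a * wave k \<theta> x) * partial i ((partial i ^^ n) g) x) =
    - (LINT x|torus. partial i (\<lambda>x. a * wave k \<theta> x) x * (partial i ^^ n) g x)"
  proof (rule torus_integral_by_parts)
    show "continuous_on UNIV (partial i ((partial i ^^ n) g))"
      using differentiable_imp_continuous_UNIV[OF d[of "Suc n"]] by simp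
  qed (rule wave_differentiable, auto simp: partial_wave wave_periodic d per partial_funpow_periodic
      intro!: continuous_intros)
  also have "\<dots> = - ((-1) ^ n * (LINT x|torus. (a * of_int (k $ i) * of_int (k $ i) ^ n
      * wave k (\<theta> + pi / 2 + n * (pi / 2)) x) * g x))"
    unfolding partial_wave Suc.IH ..
  finally show ?case by (simp add: algebra_simps add_divide_distrib)
qed simp

lemma wave_parts:
  assumes "smooth_torus \<phi>"
  shows "(LINT x|torus. wave k \<theta> x * mi_partial \<alpha> \<phi> x) =
    (-1) ^ mi_order \<alpha> * (LINT x|torus. (mono_symbol \<alpha> k * wave k (\<theta> + mi_order \<alpha> * (pi / 2)) x) * \<phi> x)"
proof -
  have d: "(partial 1 ^^ a) ((partial 2 ^^ b) ((partial 3 ^^ c) \<phi>)) differentiable (at x)" for a b c x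
    by (rule smooth_torus_funpow[OF assms])
  have d2: "(partial 2 ^^ b) ((partial 3 ^^ c) \<phi>) differentiable (at x)" for b c x
    using d[of 0] by simp
  have d3: "(partial 3 ^^ c) \<phi> differentiable (at x)" for c x
    using d[of 0 0] by simp
  have p: "\<phi> (x + (2 * pi) *\<^sub>R axis i 1) = \<phi> x" for x i
    using assms by (simp add: smooth_torus_def)
  have p3: "(partial 3 ^^ c) \<phi> (x + (2 * pi) *\<^sub>R axis i 1) = (partial 3 ^^ c) \<phi> x" for c x i
    by (rule partial_funpow_periodic[OF d3 p])
  have p2: "(partial 2 ^^ b) ((partial 3 ^^ c) \<phi>) (x + (2 * pi) *\<^sub>R axis i 1) = (partial 2 ^^ b) ((partial 3 ^^ c) \<phi>) x" for b c x i
    by (rule partial_funpow_periodic[OF d2 p3])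
  have "(LINT x|torus. (1 * wave k \<theta> x) * mi_partial \<alpha> \<phi> x) =
    (-1) ^ mi_order \<alpha> * (LINT x|torus. (1 * mono_symbol \<alpha> k * wave k (\<theta> + mi_order \<alpha> * (pi / 2)) x) * \<phi> x)"
    unfolding mi_partial_def
    by (subst wave_parts_funpow[OF d p2], subst wave_parts_funpow[OF d2 p3],
        subst wave_parts_funpow[OF d3 p])
      (simp add: mono_symbol_def mi_order_def sum_3 algebra_simps power_add)
  then show ?thesis by simp
qed

lemma partial_parts:
  assumes "smooth_torus \<phi>"
  shows "(LINT x|torus. partial i \<phi> x * wave k \<theta> x) = - of_int (k $ i) * (LINT x|torus. \<phi> x * wave k (\<theta> + pi / 2) x)"
    and "continuous_on UNIV (partial i \<phi>)" and "continuous_on UNIV \<phi>"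
proof -
  have ex: "\<exists>\<alpha>. mi_partial \<alpha> \<phi> = partial i \<phi> \<and> mi_order \<alpha> = 1 \<and> mono_symbol \<alpha> k = of_int (k $ i)"
    using exhaust_3[of i]
    by (intro exI[of _ "\<chi> j. if j = i then 1 else 0"])
      (auto simp: mi_partial_def mi_order_def sum_3 mono_symbol_def)
  then obtain \<alpha> where \<alpha>: "mi_partial \<alpha> \<phi> = partial i \<phi>" "mi_order \<alpha> = 1" "mono_symbol \<alpha> k = of_int (k $ i)"
    by blast
  have "(LINT x|torus. partial i \<phi> x * wave k \<theta> x) =
      - (LINT x|torus. of_int (k $ i) * (\<phi> x * wave k (\<theta> + pi / 2) x))"
    using wave_parts[OF assms, of k \<theta> \<alpha>] \<alpha> by (simp add: mult_ac)
  then show "(LINT x|torus. partial i \<phi> x * wave k \<theta> x) = - of_int (k $ i) * (LINT x|torus. \<phi> x * wave k (\<theta> + pi / 2) x)"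
    by simp
  show "continuous_on UNIV (partial i \<phi>)"
    using assms unfolding smooth_torus_def \<alpha>(1)[symmetric]
    by (intro differentiable_imp_continuous_UNIV) blast
  show "continuous_on UNIV \<phi>"
    using smooth_torus_funpow[OF assms, of 0 0 0] by (intro differentiable_imp_continuous_UNIV) simp
qed

lemma wave_mult: "wave k a x * wave l b x = (wave (k + l) (a + b) x + wave (k - l) (a - b) x) / 2"
  by (simp add: wave_def kdot_add kdot_diff cos_times_cos add_divide_distrib algebra_simps)

lemma measure_torus: "measure torus (space torus) = (2 * pi) ^ 3"
proof -
  have "measure torus (space torus) = measure lborel (cbox 0 (\<chi> i. 2 * pi) :: (real^3) set)"
    unfolding torus_def by (simp add: measure_restrict_space)
  also have "\<dots> = (\<Prod>i\<in>(UNIV :: 3 set). (\<chi> i. 2 * pi) $ i - 0 $ i)"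
    by (rule content_cbox_cart) (auto simp: interval_ne_empty_cart)
  finally show ?thesis by (simp add: power3_eq_cube)
qed

lemma torus_integral_wave:
  "(LINT x|torus. wave k \<theta> x) = (if k = 0 then (2 * pi) ^ 3 * cos \<theta> else 0)"
proof (cases "k = 0")
  case True
  then show ?thesis using measure_torus
    by (simp add: wave_def kdot_zero)
next
  case False
  then obtain i where i: "k $ i \<noteq> 0" by (metis vec_eq_iff zero_index)
  have "(LINT x|torus. partial i (\<lambda>x. inverse (of_int (k $ i)) * wave k (\<theta> - pi / 2) x) x) = 0"
    by (rule torus_integral_partial_zero, rule wave_differentiable)
      (auto simp: partial_wave wave_periodic intro!: continuous_intros)
  then show ?thesis using i False by (simp add: partial_wave)
qed

text \<open>Two cases occur because \<open>k\<close> and \<open>- k\<close> carry the same waves up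
  to the sign of the phase; at frequency zero both contribute.\<close>

lemma torus_integral_wave_mult:
  "(LINT x|torus. wave k a x * wave l b x) =
    ((if k + l = 0 then (2 * pi) ^ 3 * cos (a + b) else 0) + (if k = l then (2 * pi) ^ 3 * cos (a - b) else 0)) / 2"
  unfolding wave_mult
  by (subst integral_divide_zero, subst Bochner_Integration.integral_add)
    (auto intro!: integrable_torus_continuous continuous_intros simp: torus_integral_wave)

section \<open>Fourier coefficients\<close>

lemma integrable_torus_mult_bounded:
  fixes f g :: "real^3 \<Rightarrow> real"
  assumes "integrable torus f" "g \<in> borel_measurable torus" "\<And>x. x \<in> space torus \<Longrightarrow> \<bar>g x\<bar> \<le> C"
  shows "integrable torus (\<lambda>x. f x * g x)"
proof (rule Bochner_Integration.integrable_bound)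
  show "integrable torus (\<lambda>x. C * f x)" using assms by simp
  show "AE x in torus. norm (f x * g x) \<le> norm (C * f x)"
  proof (rule AE_I2)
    fix x assume "x \<in> space torus"
    then have "\<bar>g x\<bar> \<le> \<bar>C\<bar>" using assms(3) by force
    then show "norm (f x * g x) \<le> norm (C * f x)"
      using mult_right_mono[of "\<bar>g x\<bar>" "\<bar>C\<bar>" "\<bar>f x\<bar>"] by (simp add: abs_mult mult.commute)
  qed
qed (use assms in auto)

lemma integrable_mult_wave:
  "integrable torus f \<Longrightarrow> integrable torus (\<lambda>x. f x * wave k \<theta> x)"
  by (rule integrable_torus_mult_bounded[OF _ measurable_torus_continuous abs_wave_le])
    (auto intro: continuous_intros)

text \<open>Dictionary between the complex coefficients and the real test functions of the weak
  formulation: phase 0 gives the real part, and phase pi / 2, which is minus the sine, the imaginary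
  part.\<close>

lemma fourier_eq_waves:
  assumes "integrable torus f"
  shows "fourier f k = Complex (LINT x|torus. f x * wave k 0 x) (LINT x|torus. f x * wave k (pi / 2) x) / (2 * pi) ^ 3"
proof -
  have "(LINT x|torus. complex_of_real (f x) * cis (- kdot k x)) =
      (LINT x|torus. complex_of_real (f x * wave k 0 x) + \<i> * complex_of_real (f x * wave k (pi / 2) x))"
    by (rule Bochner_Integration.integral_cong) (auto simp: complex_eq_iff wave_def cos_add)
  also have "\<dots> = complex_of_real (LINT x|torus. f x * wave k 0 x) + \<i> * complex_of_real (LINT x|torus. f x * wave k (pi / 2) x)"
    using integrable_mult_wave[OF assms]
    by (subst Bochner_Integration.integral_add)
      (simp_all only: integrable_of_real integrable_mult_right integral_complex_of_real integral_mult_right_zero)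
  finally show ?thesis by (simp add: fourier_def kdot_def Complex_eq)
qed

lemma wave_coeff:
  assumes "integrable torus f"
  shows "(LINT x|torus. f x * wave k \<theta> x) = (2 * pi) ^ 3 * Re (cis \<theta> * cnj (fourier f k))"
proof -
  have "f x * wave k \<theta> x = cos \<theta> * (f x * wave k 0 x) + sin \<theta> * (f x * wave k (pi / 2) x)" for x
    by (simp add: wave_def cos_add algebra_simps)
  then have "(LINT x|torus. f x * wave k \<theta> x) = cos \<theta> * (LINT x|torus. f x * wave k 0 x) + sin \<theta> * (LINT x|torus. f x * wave k (pi / 2) x)"
    by (simp add: integrable_mult_wave assms)
  also have "\<dots> = (2 * pi) ^ 3 * Re (cis \<theta> * cnj (fourier f k))"
  proof -
    have "fourier f k * of_real ((2 * pi) ^ 3) = Complex (LINT x|torus. f x * wave k 0 x) (LINT x|torus. f x * wave k (pi / 2) x)"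
      by (simp add: fourier_eq_waves[OF assms])
    then have "(LINT x|torus. f x * wave k 0 x) = Re (fourier f k) * (2 * pi) ^ 3"
      "(LINT x|torus. f x * wave k (pi / 2) x) = Im (fourier f k) * (2 * pi) ^ 3"
      by (simp_all add: complex_eq_iff)
    then show ?thesis by (simp add: algebra_simps)
  qed
  finally show ?thesis .
qed

lemma fourier_cong_AE:
  assumes "AE x in torus. f x = g x" "f \<in> borel_measurable torus" "g \<in> borel_measurable torus"
  shows "fourier f k = fourier g k"
proof -
  have c: "(\<lambda>x. cis (- (\<Sum>i\<in>UNIV. of_int (k $ i) * x $ i))) \<in> borel_measurable torus"
    by (intro measurable_torus_continuous continuous_intros)
  show ?thesis
    unfolding fourier_def
    by (intro arg_cong2[where f="(*)"] refl integral_cong_AE borel_measurable_times c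
        measurable_compose[OF assms(2) borel_measurable_of_real]
        measurable_compose[OF assms(3) borel_measurable_of_real]) (use assms(1) in auto)
qed

lemma fourier_linear:
  assumes "integrable torus f" "integrable torus g"
  shows "fourier (\<lambda>x. a * f x + b * g x) k = a * fourier f k + b * fourier g k"
proof -
  have *: "(LINT x|torus. (a * f x + b * g x) * wave k \<theta> x) =
      a * (LINT x|torus. f x * wave k \<theta> x) + b * (LINT x|torus. g x * wave k \<theta> x)" for \<theta>
    by (subst integral_mult_right_zero[symmetric], subst integral_mult_right_zero[symmetric],
        subst Bochner_Integration.integral_add[symmetric])
      (auto intro!: integrable_mult_wave assms integrable_mult_right simp: algebra_simps)
  show ?thesis
    using assms by (simp add: fourier_eq_waves * complex_eq_iff add_divide_distrib)
qed

section \<open>Uniqueness of Fourier coefficients\<close>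

inductive trig_poly :: "(real^3 \<Rightarrow> real) \<Rightarrow> bool" where
  trig_poly_wave: "trig_poly (wave k \<theta>)"
| trig_poly_add: "trig_poly p \<Longrightarrow> trig_poly q \<Longrightarrow> trig_poly (\<lambda>x. p x + q x)"
| trig_poly_scale: "trig_poly p \<Longrightarrow> trig_poly (\<lambda>x. c * p x)"

lemma trig_poly_mult:
  assumes "trig_poly p" "trig_poly q"
  shows "trig_poly (\<lambda>x. p x * q x)"
  using assms
proof (induction p arbitrary: q)
  case (trig_poly_wave k a)
  from trig_poly_wave.prems show ?case
  proof induction
    case (trig_poly_wave l b)
    have "trig_poly (\<lambda>x. (1 / 2) * (wave (k + l) (a + b) x + wave (k - l) (a - b) x))"
      by (intro trig_poly.intros)
    moreover have "(\<lambda>x. (1 / 2) * (wave (k + l) (a + b) x + wave (k - l) (a - b) x)) = (\<lambda>x. wave k a x * wave l b x)"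
      by (simp add: wave_mult)
    ultimately show ?case by simp
  next
    case (trig_poly_add p q)
    then have "trig_poly (\<lambda>x. wave k a x * p x + wave k a x * q x)" by (intro trig_poly.intros)
    then show ?case by (simp add: distrib_left)
  next
    case (trig_poly_scale p c)
    then have "trig_poly (\<lambda>x. c * (wave k a x * p x))" by (intro trig_poly.intros)
    then show ?case by (simp add: mult.left_commute)
  qed
next
  case (trig_poly_add p p')
  then have "trig_poly (\<lambda>x. p x * q x + p' x * q x)" by (intro trig_poly.intros) auto
  then show ?case by (simp add: distrib_right)
next
  case (trig_poly_scale p c)
  then have "trig_poly (\<lambda>x. c * (p x * q x))" by (intro trig_poly.intros) auto
  then show ?case by (simp add: mult.assoc)
qed

lemma integral_trig_poly_zero:
  assumes f: "integrable torus f" and z: "\<And>k. fourier f k = 0" and p: "trig_poly p"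
  shows "integrable torus (\<lambda>x. f x * p x) \<and> (LINT x|torus. f x * p x) = 0"
  using p
proof induction
  case (trig_poly_wave k \<theta>)
  then show ?case using z by (simp add: wave_coeff[OF f] integrable_mult_wave[OF f])
next
  case (trig_poly_add p q)
  then show ?case by (simp add: distrib_left)
next
  case (trig_poly_scale p c)
  then show ?case by (simp add: mult.left_commute[of _ c])
qed

lemma cis_eq_cases:
  assumes "cis x = cis y" "x \<in> {0..2 * pi}" "y \<in> {0..2 * pi}"
  shows "x = y \<or> (x \<in> {0, 2 * pi} \<and> y \<in> {0, 2 * pi})"
proof -
  have "cos x = cos y" "sin x = sin y" using assms(1) by (auto simp: complex_eq_iff)
  then have "cos (x - y) = 1" by (simp add: cos_diff flip: power2_eq_square)
  then obtain n :: int where n: "x - y = n * 2 * pi" by (auto simp: cos_one_2pi_int)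
  then have "\<bar>real_of_int n\<bar> * (2 * pi) = \<bar>x - y\<bar>" by (simp add: abs_mult)
  moreover have "\<bar>x - y\<bar> \<le> 1 * (2 * pi)" using assms(2,3) by auto
  ultimately have "\<bar>real_of_int n\<bar> * (2 * pi) \<le> 1 * (2 * pi)" by linarith
  then have "\<bar>real_of_int n\<bar> \<le> 1" by (subst (asm) mult_le_cancel_right) auto
  then have "n = -1 \<or> n = 0 \<or> n = 1" by linarith
  then show ?thesis using n assms(2,3) by auto
qed

text \<open>Stone-Weierstrass on the image of the cube in the product of three unit circles; a
  function vanishing on the boundary of the cube factors through that image.\<close>

lemma trig_poly_dense:
  fixes g :: "real^3 \<Rightarrow> real"
  assumes g: "continuous_on UNIV g" and g0: "\<And>x. x \<notin> box 0 (\<chi> i. 2 * pi) \<Longrightarrow> g x = 0" and "0 < e"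
  shows "\<exists>p. trig_poly p \<and> (\<forall>x\<in>space torus. \<bar>g x - p x\<bar> < e)"
proof -
  define Q where "Q = space torus"
  have Q: "compact Q" by (simp add: Q_def space_torus)
  define \<Phi> :: "real^3 \<Rightarrow> complex^3" where "\<Phi> x = (\<chi> i. cis (x $ i))" for x
  have \<Phi>: "continuous_on S \<Phi>" for S
    unfolding \<Phi>_def by (intro continuous_intros)
  have inj: "g x = g y" if "x \<in> Q" "y \<in> Q" "\<Phi> x = \<Phi> y" for x y
  proof (cases "x = y")
    case False
    then obtain i where i: "x $ i \<noteq> y $ i" by (auto simp: vec_eq_iff)
    have "cis (x $ i) = cis (y $ i)" using that(3) by (simp add: \<Phi>_def vec_eq_iff)
    moreover have "x $ i \<in> {0..2 * pi}" "y $ i \<in> {0..2 * pi}"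
      using that(1,2) by (auto simp: Q_def space_torus mem_box_cart)
    ultimately have "x $ i \<in> {0, 2 * pi}" "y $ i \<in> {0, 2 * pi}"
      using cis_eq_cases i by blast+
    then have "x \<notin> box 0 (\<chi> i. 2 * pi)" "y \<notin> box 0 (\<chi> i. 2 * pi)"
      by (auto simp: mem_box_cart intro!: exI[of _ i])
    then show ?thesis using g0 by simp
  qed simp
  define G where "G z = g (SOME x. x \<in> Q \<and> \<Phi> x = z)" for z
  have G: "G (\<Phi> x) = g x" if "x \<in> Q" for x
  proof -
    have "(SOME y. y \<in> Q \<and> \<Phi> y = \<Phi> x) \<in> Q \<and> \<Phi> (SOME y. y \<in> Q \<and> \<Phi> y = \<Phi> x) = \<Phi> x"
      by (rule someI[of _ x]) (use that in simp)
    then show ?thesis unfolding G_def using inj that by blast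
  qed
  have K: "compact (\<Phi> ` Q)" using Q \<Phi> by (rule compact_continuous_image[rotated])
  \<comment> \<open>The preimage under \<open>G\<close> of a closed set is the image under \<Phi> of
    a compact subset of the cube, hence closed. No continuous choice of preimages is needed, because
    \<open>inj\<close> makes \<open>G\<close> independent of the choice.\<close>
  have Gc: "continuous_on (\<Phi> ` Q) G"
    unfolding continuous_on_closed_vimage[OF compact_imp_closed[OF K]]
  proof (intro allI impI)
    fix B :: "real set" assume "closed B"
    then have "closed (g -` B)" using g continuous_closed_vimage[of B g]
      by (metis continuous_on_eq_continuous_at iso_tuple_UNIV_I open_UNIV)
    then have "compact (Q \<inter> g -` B)" using Q by (rule compact_Int_closed[rotated])
    then have "compact (\<Phi> ` (Q \<inter> g -` B))" using \<Phi> by (rule compact_continuous_image[rotated])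
    moreover have "\<Phi> ` (Q \<inter> g -` B) = G -` B \<inter> \<Phi> ` Q" using G by (auto simp: image_iff)
    ultimately show "closed (G -` B \<inter> \<Phi> ` Q)" using compact_imp_closed by metis
  qed
  let ?P = "\<lambda>f. continuous_on (\<Phi> ` Q) f \<and> trig_poly (\<lambda>x. f (\<Phi> x))"
  have kdot_ax: "kdot (axis i 1) x = x $ i" for i x
  proof -
    have "kdot (axis i 1) x = (\<Sum>j\<in>UNIV. if j = i then x $ j else 0)"
      unfolding kdot_def by (intro sum.cong) (auto simp: axis_def)
    then show ?thesis by simp
  qed
  have cosw: "(\<lambda>x. Re (\<Phi> x $ i)) = wave (axis i 1) 0" and sinw: "(\<lambda>x. Im (\<Phi> x $ i)) = wave (axis i 1) (- pi / 2)" for i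
    by (auto simp: fun_eq_iff \<Phi>_def wave_def cos_diff kdot_ax)
  have "\<exists>p. ?P p \<and> (\<forall>z\<in>\<Phi> ` Q. \<bar>G z - p z\<bar> < e)"
  proof (rule Stone_Weierstrass_HOL[OF K _ _ _ _ _ Gc \<open>0 < e\<close>])
    have "trig_poly (\<lambda>x. c * wave 0 0 x)" for c by (intro trig_poly.intros)
    then show "?P (\<lambda>x. c)" for c by (simp add: wave_def kdot_zero)
    show "\<exists>f. ?P f \<and> f z \<noteq> f w" if zw: "z \<in> \<Phi> ` Q \<and> w \<in> \<Phi> ` Q \<and> z \<noteq> w" for z w
    proof -
      obtain i where "z $ i \<noteq> w $ i" using zw by (auto simp: vec_eq_iff)
      then consider "Re (z $ i) \<noteq> Re (w $ i)" | "Im (z $ i) \<noteq> Im (w $ i)" by (auto simp: complex_eq_iff)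
      then show ?thesis
      proof cases
        case 1
        then show ?thesis by (intro exI[of _ "\<lambda>z. Re (z $ i)"]) (auto simp: cosw intro!: trig_poly.intros continuous_intros)
      next
        case 2
        then show ?thesis by (intro exI[of _ "\<lambda>z. Im (z $ i)"]) (auto simp: sinw intro!: trig_poly.intros continuous_intros)
      qed
    qed
  qed (auto intro: continuous_intros trig_poly.intros trig_poly_mult)
  then obtain p where "trig_poly (\<lambda>x. p (\<Phi> x))" "\<And>z. z \<in> \<Phi> ` Q \<Longrightarrow> \<bar>G z - p z\<bar> < e" by auto
  then show ?thesis using G by (intro exI[of _ "\<lambda>x. p (\<Phi> x)"]) (metis Q_def imageI)
qed

text \<open>\<open>f\<close> annihilates trigonometric polynomials. Replacing \<open>g\<close> by
  one that is uniformly within \<open>e\<close> of it costs at most \<open>e\<close> times the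
  integral of |f|.\<close>

lemma fourier_zero_test:
  fixes f g :: "real^3 \<Rightarrow> real"
  assumes f: "integrable torus f" and z: "\<And>k. fourier f k = 0"
    and g: "continuous_on UNIV g" and g0: "\<And>x. x \<notin> box 0 (\<chi> i. 2 * pi) \<Longrightarrow> g x = 0"
  shows "(LINT x|torus. f x * g x) = 0"
proof -
  have gi: "integrable torus (\<lambda>x. f x * g x)"
  proof -
    have "compact (g ` space torus)" unfolding space_torus
      by (intro compact_continuous_image continuous_on_subset[OF g]) auto
    then obtain C where "\<And>x. x \<in> space torus \<Longrightarrow> \<bar>g x\<bar> \<le> C"
      by (force dest!: compact_imp_bounded simp: bounded_iff)
    then show ?thesis by (intro integrable_torus_mult_bounded[OF f measurable_torus_continuous[OF g]])
  qed
  have "\<bar>LINT x|torus. f x * g x\<bar> \<le> e * (LINT x|torus. \<bar>f x\<bar>)" if e: "0 < e" for e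
  proof -
    obtain p where p: "trig_poly p" "\<And>x. x \<in> space torus \<Longrightarrow> \<bar>g x - p x\<bar> < e"
      using trig_poly_dense[OF g g0 e] by auto
    note pi = integral_trig_poly_zero[OF f z p(1)]
    have "\<bar>LINT x|torus. f x * g x\<bar> = \<bar>LINT x|torus. f x * g x - f x * p x\<bar>"
      using pi gi by simp
    also have "\<dots> \<le> (LINT x|torus. \<bar>f x * g x - f x * p x\<bar>)" by (rule integral_abs_bound)
    also have "\<dots> \<le> (LINT x|torus. e * \<bar>f x\<bar>)"
    proof (rule integral_mono)
      show "integrable torus (\<lambda>x. \<bar>f x * g x - f x * p x\<bar>)" using pi gi by simp
      show "integrable torus (\<lambda>x. e * \<bar>f x\<bar>)" using f by simp
      fix x assume x: "x \<in> space torus"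
      have "\<bar>f x * g x - f x * p x\<bar> = \<bar>f x\<bar> * \<bar>g x - p x\<bar>" by (simp add: abs_mult flip: right_diff_distrib)
      also have "\<dots> \<le> \<bar>f x\<bar> * e" using p(2)[OF x] by (intro mult_left_mono) auto
      finally show "\<bar>f x * g x - f x * p x\<bar> \<le> e * \<bar>f x\<bar>" by (simp add: mult.commute)
    qed
    finally show ?thesis by simp
  qed
  note * = this
  show ?thesis
  proof (rule ccontr)
    assume n: "(LINT x|torus. f x * g x) \<noteq> 0"
    let ?A = "\<bar>LINT x|torus. f x * g x\<bar>" and ?I = "LINT x|torus. \<bar>f x\<bar>"
    have I: "0 \<le> ?I" by simp
    then have p: "0 < ?I + 1" by (rule add_nonneg_pos) simp
    \<comment> \<open>This \<open>e\<close> makes the bound at most half of \<open>?A\<close>; the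
      summand 1 guards against a vanishing integral of |f|.\<close>
    have "?A \<le> ?A / (2 * (?I + 1)) * ?I" using n p by (intro * divide_pos_pos mult_pos_pos) auto
    also have "\<dots> \<le> ?A / 2"
    proof -
      have "A / (2 * (J + 1)) * J \<le> A / 2" if "0 \<le> J" "0 \<le> A" for A J :: real
        using that by (simp add: divide_simps) (simp add: algebra_simps)
      then show ?thesis using I by simp
    qed
    finally show False using n by simp
  qed
qed

text \<open>Testing against the sign of \<open>f\<close> would give the integral of |f|. The sign is
  a limit almost everywhere of continuous functions, which are cut off to be admissible in
  \<open>fourier_zero_test\<close>.\<close>

lemma fourier_zero_imp_zero:
  assumes f: "integrable torus f" and z: "\<And>k. fourier f k = 0"
  shows "AE x in torus. f x = 0"
proof -
  let ?B = "box 0 (\<chi> i. 2 * pi) :: (real^3) set" and ?Q = "cbox 0 (\<chi> i. 2 * pi) :: (real^3) set"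
  have fm: "f \<in> borel_measurable torus" using f by simp
  define s where "s x = (if x \<in> ?Q then sgn (f x) else 0)" for x
  have "(\<lambda>x. sgn (f x)) \<in> borel_measurable torus" using fm by simp
  then have "s \<in> borel_measurable lebesgue"
    unfolding s_def torus_def by (subst borel_measurable_if) auto
  then have "s measurable_on UNIV" by (intro lebesgue_measurable_imp_measurable_on_real) auto
  then obtain N g where N: "negligible N" and g: "\<And>n. continuous_on UNIV (g n)"
    and lim: "\<And>x. x \<notin> N \<Longrightarrow> (\<lambda>n. g n x) \<longlonglongrightarrow> s x" by (auto simp: measurable_on_def)
  \<comment> \<open>Clipping to [-1, 1] lets |f| dominate the products. The distance factor forces
    \<open>h n\<close> to vanish outside the open cube, yet at each interior point it equals 1 for
    all large \<open>n\<close>.\<close>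
  define h where "h n x = max (-1) (min 1 (g n x)) * min 1 (real n * infdist x (- ?B))" for n :: nat and x
  have hc: "continuous_on UNIV (h n)" for n unfolding h_def by (intro continuous_intros g)
  have neB: "- ?B \<noteq> {}" by (metis bounded_box not_bounded_UNIV Compl_empty_eq double_compl)
  have h0: "h n x = 0" if "x \<notin> ?B" for n x using that by (simp add: h_def)
  have hb: "\<bar>h n x\<bar> \<le> 1" for n x
  proof -
    have "\<bar>max (-1) (min 1 (g n x))\<bar> * \<bar>min 1 (real n * infdist x (- ?B))\<bar> \<le> 1 * 1"
      by (rule mult_mono) (auto simp: infdist_nonneg)
    then show ?thesis by (simp add: h_def abs_mult)
  qed
  have hl: "(\<lambda>n. h n x) \<longlonglongrightarrow> s x" if x: "x \<notin> N" "x \<in> ?B" for x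
  proof -
    have pos: "0 < infdist x (- ?B)"
    proof -
      have "closed (- ?B)" by (simp add: closed_def open_box)
      then show ?thesis using in_closed_iff_infdist_zero[OF _ neB, of x] x(2) infdist_nonneg[of x "- ?B"] by fastforce
    qed
    have "eventually (\<lambda>n. min 1 (real n * infdist x (- ?B)) = 1) sequentially"
    proof -
      obtain m where m: "1 / infdist x (- ?B) \<le> real m" using real_arch_simple by blast
      show ?thesis unfolding eventually_sequentially
      proof (intro exI[of _ m] allI impI)
        fix n assume "m \<le> n"
        then have "1 / infdist x (- ?B) \<le> real n" using m by linarith
        then show "min 1 (real n * infdist x (- ?B)) = 1" using pos by (simp add: field_simps)
      qed
    qed
    then have "(\<lambda>n. min 1 (real n * infdist x (- ?B))) \<longlonglongrightarrow> 1" by (rule tendsto_eventually)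
    then have "(\<lambda>n. h n x) \<longlonglongrightarrow> max (-1) (min 1 (s x)) * 1"
      unfolding h_def by (intro tendsto_intros lim x)
    moreover have "max (-1) (min 1 (s x)) = s x" by (auto simp: s_def sgn_if)
    ultimately show ?thesis by simp
  qed
  have ae: "AE x in torus. x \<notin> N \<and> x \<in> ?B"
  proof -
    have "negligible (N \<union> (?Q - ?B))" using N negligible_frontier_interval by simp
    then have "N \<union> (?Q - ?B) \<in> null_sets lebesgue" by (simp add: negligible_iff_null_sets)
    then have "AE x in lebesgue. x \<notin> N \<union> (?Q - ?B)" by (rule AE_not_in)
    then show ?thesis unfolding torus_def by (subst AE_restrict_space_iff) auto
  qed
  have "(\<lambda>n. LINT x|torus. f x * h n x) \<longlonglongrightarrow> (LINT x|torus. \<bar>f x\<bar>)"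
  proof (rule integral_dominated_convergence[where w="\<lambda>x. \<bar>f x\<bar>"])
    show "AE x in torus. (\<lambda>n. f x * h n x) \<longlonglongrightarrow> \<bar>f x\<bar>"
      using ae
    proof (eventually_elim)
      case (elim x)
      then have "(\<lambda>n. f x * h n x) \<longlonglongrightarrow> f x * s x" using hl by (intro tendsto_intros) auto
      moreover have "x \<in> ?Q" using elim box_subset_cbox by blast
      then have "f x * s x = \<bar>f x\<bar>" by (simp add: s_def abs_sgn mult.commute)
      ultimately show ?case by simp
    qed
    show "AE x in torus. norm (f x * h n x) \<le> \<bar>f x\<bar>" for n
      using hb by (simp add: abs_mult mult_left_le)
  qed (use f measurable_torus_continuous[OF hc] in \<open>auto\<close>)
  moreover have "(LINT x|torus. f x * h n x) = 0" for n
    by (rule fourier_zero_test[OF f z hc h0])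
  ultimately have "(LINT x|torus. \<bar>f x\<bar>) = 0" by (simp add: LIMSEQ_const_iff)
  then have "AE x in torus. \<bar>f x\<bar> = 0"
    by (subst (asm) integral_nonneg_eq_0_iff_AE) (use f in auto)
  then show ?thesis by simp
qed

lemma fourier_unique:
  assumes "integrable torus f" "integrable torus g" "\<And>k. fourier f k = fourier g k"
  shows "AE x in torus. f x = g x"
proof -
  have "AE x in torus. 1 * f x + (-1) * g x = 0"
    by (rule fourier_zero_imp_zero) (use assms in \<open>auto simp: fourier_linear[of f g 1 "-1", simplified]\<close>)
  then show ?thesis by simp
qed

section \<open>Square-integrable functions\<close>

text \<open>States membership in \<open>in_Lp 2\<close> with squares instead of \<open>powr\<close>,
  so that expansions of squares are plain algebra; \<open>in_Lp_2_iff\<close> gives the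
  agreement.\<close>

definition sq_integrable :: "(real^3 \<Rightarrow> real) \<Rightarrow> bool" where
  "sq_integrable f \<longleftrightarrow> f \<in> borel_measurable torus \<and> integrable torus (\<lambda>x. (f x)\<^sup>2)"

definition sq_int :: "(real^3 \<Rightarrow> real) \<Rightarrow> real" where
  "sq_int f = (LINT x|torus. (f x)\<^sup>2)"

lemma sq_int_nonneg: "0 \<le> sq_int f"
  by (simp add: sq_int_def)

lemma sq_integrable_measurable: "sq_integrable f \<Longrightarrow> f \<in> borel_measurable torus"
  by (simp add: sq_integrable_def)

lemma sq_integrable_mult:
  assumes "sq_integrable f" "sq_integrable g"
  shows "integrable torus (\<lambda>x. f x * g x)"
proof (rule Bochner_Integration.integrable_bound)
  show "integrable torus (\<lambda>x. (f x)\<^sup>2 + (g x)\<^sup>2)" using assms by (simp add: sq_integrable_def)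
  show "AE x in torus. norm (f x * g x) \<le> norm ((f x)\<^sup>2 + (g x)\<^sup>2)"
  proof (rule AE_I2)
    fix x
    have "\<bar>f x\<bar> * \<bar>g x\<bar> \<le> (f x)\<^sup>2 + (g x)\<^sup>2"
      using sum_squares_bound[of "\<bar>f x\<bar>" "\<bar>g x\<bar>"] mult_nonneg_nonneg[OF abs_ge_zero[of "f x"] abs_ge_zero[of "g x"]]
      unfolding power2_abs by linarith
    then show "norm (f x * g x) \<le> norm ((f x)\<^sup>2 + (g x)\<^sup>2)" by (simp add: abs_mult)
  qed
qed (use assms in \<open>auto simp: sq_integrable_def\<close>)

lemma sq_integrable_lincomb:
  assumes "sq_integrable f" "sq_integrable g"
  shows "sq_integrable (\<lambda>x. a * f x + b * g x)"
proof -
  have "(\<lambda>x. (a * f x + b * g x)\<^sup>2) = (\<lambda>x. a\<^sup>2 * (f x)\<^sup>2 + (2 * a * b) * (f x * g x) + b\<^sup>2 * (g x)\<^sup>2)"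
    by (simp add: power2_eq_square algebra_simps)
  then have "integrable torus (\<lambda>x. (a * f x + b * g x)\<^sup>2)"
    using assms sq_integrable_mult[OF assms] unfolding sq_integrable_def by simp
  moreover have "(\<lambda>x. a * f x + b * g x) \<in> borel_measurable torus"
    using assms unfolding sq_integrable_def
    by (intro borel_measurable_add borel_measurable_times borel_measurable_const) auto
  ultimately show ?thesis unfolding sq_integrable_def by simp
qed

lemma sq_int_lincomb:
  assumes "sq_integrable f" "sq_integrable g"
  shows "sq_int (\<lambda>x. a * f x + b * g x) = a\<^sup>2 * sq_int f + 2 * a * b * (LINT x|torus. f x * g x) + b\<^sup>2 * sq_int g"
proof -
  have "(\<lambda>x. (a * f x + b * g x)\<^sup>2) = (\<lambda>x. a\<^sup>2 * (f x)\<^sup>2 + (2 * a * b) * (f x * g x) + b\<^sup>2 * (g x)\<^sup>2)"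
    by (simp add: power2_eq_square algebra_simps)
  then show ?thesis using assms sq_integrable_mult[OF assms] unfolding sq_integrable_def sq_int_def by simp
qed

lemma sq_integrable_continuous:
  assumes "continuous_on UNIV f"
  shows "sq_integrable f"
  unfolding sq_integrable_def using assms
  by (auto intro!: measurable_torus_continuous integrable_torus_continuous continuous_intros)

lemma sq_integrable_imp_integrable: "sq_integrable f \<Longrightarrow> integrable torus f"
  using sq_integrable_mult[of f "\<lambda>_. 1"] sq_integrable_continuous[of "\<lambda>_. 1"] by simp

lemma Cauchy_Schwarz_torus:
  assumes "sq_integrable f" "sq_integrable g"
  shows "\<bar>LINT x|torus. f x * g x\<bar> \<le> sqrt (sq_int f) * sqrt (sq_int g)"
proof -
  let ?I = "LINT x|torus. f x * g x"
  have q: "0 \<le> t\<^sup>2 * sq_int f + 2 * t * ?I + sq_int g" for t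
    using sq_int_lincomb[OF assms, of t 1] sq_int_nonneg[of "\<lambda>x. t * f x + 1 * g x"] by simp
  have "?I\<^sup>2 \<le> sq_int f * sq_int g"
  proof (cases "sq_int f = 0")
    case True
    have "?I = 0"
    proof (rule ccontr)
      assume n: "?I \<noteq> 0"
      \<comment> \<open>With \<open>sq_int f = 0\<close> the nonnegative quadratic in
        \<open>t\<close> is affine; this \<open>t\<close> gives it the value -1.\<close>
      have "0 \<le> 2 * (- (sq_int g + 1) / (2 * ?I)) * ?I + sq_int g"
        using q[of "- (sq_int g + 1) / (2 * ?I)"] True by simp
      also have "2 * (- (sq_int g + 1) / (2 * ?I)) * ?I = - (sq_int g + 1)" using n by simp
      finally show False by simp
    qed
    then show ?thesis using True by simp
  next
    case False
    then have p: "0 < sq_int f" using sq_int_nonneg[of f] by simp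
    have "0 \<le> (- ?I / sq_int f)\<^sup>2 * sq_int f + 2 * (- ?I / sq_int f) * ?I + sq_int g" by (rule q)
    then show ?thesis using p by (simp add: power2_eq_square field_simps)
  qed
  then have "\<bar>?I\<bar> \<le> sqrt (sq_int f * sq_int g)" by (simp add: real_le_rsqrt)
  then show ?thesis by (simp add: real_sqrt_mult)
qed

lemma sq_int_cong_AE:
  assumes "AE x in torus. f x = g x" "f \<in> borel_measurable torus" "g \<in> borel_measurable torus"
  shows "sq_int f = sq_int g"
  unfolding sq_int_def by (rule integral_cong_AE) (use assms in auto)

text \<open>The classical completeness proof: a rapidly converging subsequence converges almost
  everywhere, and Fatou's lemma turns its limit into the limit in square mean of the whole
  sequence.\<close>

lemma sq_integrable_complete:
  assumes r: "\<And>n::nat. sq_integrable (r n)"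
    and C: "\<And>e. 0 < e \<Longrightarrow> \<exists>N. \<forall>m\<ge>N. \<forall>n\<ge>N. sq_int (\<lambda>x. r m x - r n x) < e"
  shows "\<exists>g. sq_integrable g \<and> (\<lambda>n. sq_int (\<lambda>x. r n x - g x)) \<longlonglongrightarrow> 0"
proof -
  have rm [measurable]: "r n \<in> borel_measurable torus" for n using r sq_integrable_measurable by blast
  have d: "sq_integrable (\<lambda>x. r m x - r n x)" for m n
    using sq_integrable_lincomb[OF r r, of 1 m "-1" n] by simp
  have "\<exists>N. \<forall>m\<ge>N. \<forall>n\<ge>N. sq_int (\<lambda>x. r m x - r n x) < (1 / 4) ^ i" for i
    by (rule C) simp
  then obtain N where N: "\<And>i m n. N i \<le> m \<Longrightarrow> N i \<le> n \<Longrightarrow> sq_int (\<lambda>x. r m x - r n x) < (1 / 4) ^ i" by metis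
  \<comment> \<open>Summing the thresholds gives a monotone index sequence that dominates each of
    them.\<close>
  define \<phi> where "\<phi> i = (\<Sum>j\<le>i. N j)" for i :: nat
  have \<phi>N: "N i \<le> \<phi> i" for i unfolding \<phi>_def by (intro member_le_sum) auto
  have \<phi>m: "mono \<phi>" unfolding \<phi>_def by (intro monoI sum_mono2) auto
  \<comment> \<open>The squared increments have integral at most 4^-i. Weighted by 2^i they still
    sum to a finite integral, so at almost every point the increment is at most a constant times
    2^(-i/2) and the telescoping series converges absolutely.\<close>
  define D where "D i x = r (\<phi> (Suc i)) x - r (\<phi> i) x" for i x
  have Dm [measurable]: "D i \<in> borel_measurable torus" for i unfolding D_def by simp
  have Di: "integrable torus (\<lambda>x. (D i x)\<^sup>2)" for i using d unfolding D_def sq_integrable_def by blast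
  have D: "(LINT x|torus. (D i x)\<^sup>2) \<le> (1 / 4) ^ i" for i
    using N[of i "\<phi> (Suc i)" "\<phi> i"] \<phi>N[of i] monoD[OF \<phi>m, of i "Suc i"] unfolding D_def sq_int_def by simp
  have "(\<integral>\<^sup>+x. (\<Sum>i. ennreal (2 ^ i * (D i x)\<^sup>2)) \<partial>torus) = (\<Sum>i. \<integral>\<^sup>+x. ennreal (2 ^ i * (D i x)\<^sup>2) \<partial>torus)"
    by (rule nn_integral_suminf) simp
  also have "\<dots> = (\<Sum>i. ennreal (2 ^ i * (LINT x|torus. (D i x)\<^sup>2)))"
    using Di by (subst nn_integral_eq_integral) auto
  also have "\<dots> \<le> (\<Sum>i. ennreal ((1 / 2) ^ i))"
  proof (intro suminf_le ennreal_leI)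
    fix i
    have "2 ^ i * (LINT x|torus. (D i x)\<^sup>2) \<le> 2 ^ i * (1 / 4) ^ i" using D by (intro mult_left_mono) auto
    also have "\<dots> = (1 / 2 :: real) ^ i" by (simp add: power_mult_distrib[symmetric])
    finally show "2 ^ i * (LINT x|torus. (D i x)\<^sup>2) \<le> (1 / 2) ^ i" .
  qed auto
  also have "\<dots> < \<infinity>"
    by (simp add: suminf_ennreal2 summable_geometric)
  finally have "(\<integral>\<^sup>+x. (\<Sum>i. ennreal (2 ^ i * (D i x)\<^sup>2)) \<partial>torus) \<noteq> \<infinity>" by simp
  then have ae: "AE x in torus. (\<Sum>i. ennreal (2 ^ i * (D i x)\<^sup>2)) \<noteq> \<infinity>"
    by (intro nn_integral_PInf_AE) auto
  define g where "g x = lim (\<lambda>i. r (\<phi> i) x)" for x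
  have gm [measurable]: "g \<in> borel_measurable torus" unfolding g_def by simp
  have lim: "AE x in torus. (\<lambda>i. r (\<phi> i) x) \<longlonglongrightarrow> g x"
    using ae
  proof eventually_elim
    case (elim x)
    then obtain B where B: "(\<Sum>i. ennreal (2 ^ i * (D i x)\<^sup>2)) = ennreal B" "0 \<le> B"
      by (metis ennreal_cases infinity_ennreal_def)
    have b: "2 ^ i * (D i x)\<^sup>2 \<le> B" for i
    proof -
      have "(\<Sum>i\<in>{i}. ennreal (2 ^ i * (D i x)\<^sup>2)) \<le> ennreal B"
        unfolding B(1)[symmetric] by (rule sum_le_suminf) auto
      then show ?thesis using B(2) by simp
    qed
    have b': "\<bar>D i x\<bar> \<le> sqrt B * (1 / sqrt 2) ^ i" for i
    proof -
      have "(D i x)\<^sup>2 \<le> B / 2 ^ i" using b[of i] by (simp add: field_simps)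
      then have "\<bar>D i x\<bar> \<le> sqrt (B / 2 ^ i)" by (rule real_le_rsqrt[of "\<bar>D i x\<bar>", simplified])
      also have "\<dots> = sqrt B * (1 / sqrt 2) ^ i"
        by (simp add: real_sqrt_divide real_sqrt_power power_one_over)
      finally show ?thesis .
    qed
    have "summable (\<lambda>i. D i x)"
    proof (rule summable_comparison_test')
      show "summable (\<lambda>i. sqrt B * (1 / sqrt 2) ^ i)" by (intro summable_mult summable_geometric) simp
      show "norm (D i x) \<le> sqrt B * (1 / sqrt 2) ^ i" if "0 \<le> i" for i using b' by simp
    qed
    then have "(\<lambda>n. \<Sum>i<n. D i x) \<longlonglongrightarrow> (\<Sum>i. D i x)" by (rule summable_LIMSEQ)
    moreover have "(\<Sum>i<n. D i x) = r (\<phi> n) x - r (\<phi> 0) x" for n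
      unfolding D_def by (rule sum_lessThan_telescope)
    ultimately have "(\<lambda>n. r (\<phi> n) x - r (\<phi> 0) x + r (\<phi> 0) x) \<longlonglongrightarrow> (\<Sum>i. D i x) + r (\<phi> 0) x"
      by (intro tendsto_intros) simp
    then have "convergent (\<lambda>n. r (\<phi> n) x)" by (auto simp: convergent_def)
    then show ?case by (simp add: g_def convergent_LIMSEQ_iff)
  qed
  \<comment> \<open>Fatou is applied to the subsequence index with \<open>n\<close> fixed. One
    estimate yields both the integrability of the square and the rate.\<close>
  have fatou: "integrable torus (\<lambda>x. (r n x - g x)\<^sup>2) \<and> sq_int (\<lambda>x. r n x - g x) \<le> (1 / 4) ^ j"
    if "N j \<le> n" for n j
  proof -
    have "(\<integral>\<^sup>+x. ennreal ((r n x - g x)\<^sup>2) \<partial>torus) = (\<integral>\<^sup>+x. liminf (\<lambda>i. ennreal ((r n x - r (\<phi> i) x)\<^sup>2)) \<partial>torus)"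
    proof (rule nn_integral_cong_AE)
      show "AE x in torus. ennreal ((r n x - g x)\<^sup>2) = liminf (\<lambda>i. ennreal ((r n x - r (\<phi> i) x)\<^sup>2))"
        using lim
      proof eventually_elim
        case (elim x)
        then have "(\<lambda>i. ennreal ((r n x - r (\<phi> i) x)\<^sup>2)) \<longlonglongrightarrow> ennreal ((r n x - g x)\<^sup>2)"
          by (intro tendsto_ennrealI tendsto_intros)
        from lim_imp_Liminf[OF _ this] show ?case by simp
      qed
    qed
    also have "\<dots> \<le> liminf (\<lambda>i. \<integral>\<^sup>+x. ennreal ((r n x - r (\<phi> i) x)\<^sup>2) \<partial>torus)"
      by (rule nn_integral_liminf) simp
    also have "\<dots> \<le> ennreal ((1 / 4) ^ j)"
    proof -
      have "eventually (\<lambda>i. (\<integral>\<^sup>+x. ennreal ((r n x - r (\<phi> i) x)\<^sup>2) \<partial>torus) \<le> ennreal ((1 / 4) ^ j)) sequentially"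
        unfolding eventually_sequentially
      proof (intro exI[of _ j] allI impI)
        fix i assume "j \<le> i"
        then have "N j \<le> \<phi> i" using \<phi>N[of j] monoD[OF \<phi>m, of j i] by linarith
        then have "sq_int (\<lambda>x. r n x - r (\<phi> i) x) \<le> (1 / 4) ^ j" using N[of j n "\<phi> i"] that by simp
        then show "(\<integral>\<^sup>+x. ennreal ((r n x - r (\<phi> i) x)\<^sup>2) \<partial>torus) \<le> ennreal ((1 / 4) ^ j)"
          using d unfolding sq_integrable_def sq_int_def
          by (subst nn_integral_eq_integral) (auto intro: ennreal_leI)
      qed
      then have "liminf (\<lambda>i. \<integral>\<^sup>+x. ennreal ((r n x - r (\<phi> i) x)\<^sup>2) \<partial>torus) \<le> liminf (\<lambda>i. ennreal ((1 / 4) ^ j))"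
        by (rule Liminf_mono)
      then show ?thesis by (simp add: Liminf_const)
    qed
    finally have *: "(\<integral>\<^sup>+x. ennreal ((r n x - g x)\<^sup>2) \<partial>torus) \<le> ennreal ((1 / 4) ^ j)" .
    have i: "integrable torus (\<lambda>x. (r n x - g x)\<^sup>2)"
      by (rule integrableI_bounded) (use * in \<open>auto simp: le_less_trans\<close>)
    moreover have "sq_int (\<lambda>x. r n x - g x) \<le> (1 / 4) ^ j"
      using * unfolding sq_int_def by (subst (asm) nn_integral_eq_integral[OF i]) auto
    ultimately show ?thesis by simp
  qed
  have "sq_integrable (\<lambda>x. r (N 0) x - g x)" using fatou[of 0 "N 0"] by (simp add: sq_integrable_def)
  from sq_integrable_lincomb[OF r[of "N 0"] this, of 1 "-1"] have "sq_integrable g" by simp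
  moreover have "(\<lambda>n. sq_int (\<lambda>x. r n x - g x)) \<longlonglongrightarrow> 0"
  proof (rule LIMSEQ_I)
    fix e :: real assume "0 < e"
    then obtain j where j: "(1 / 4) ^ j < e" using real_arch_pow_inv[of e "1/4"] by auto
    show "\<exists>no. \<forall>n\<ge>no. norm (sq_int (\<lambda>x. r n x - g x) - 0) < e"
      using fatou j sq_int_nonneg by (intro exI[of _ "N j"]) (force simp: abs_of_nonneg intro: le_less_trans)
  qed
  ultimately show ?thesis by blast
qed

section \<open>Bessel's inequality and the Riesz-Fischer theorem\<close>

lemma continuous_cis_kdot [continuous_intros]: "continuous_on S (\<lambda>x. cis (kdot k x))"
  unfolding kdot_def by (intro continuous_intros)

lemma torus_integral_cis: "(CLINT x|torus. cis (kdot k x)) = (if k = 0 then (2 * pi) ^ 3 else 0)"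
proof -
  have eq: "cis (kdot k x) = of_real (wave k 0 x) + \<i> * of_real (wave k (- pi / 2) x)" for x
    by (simp add: complex_eq_iff wave_def cos_diff)
  have i: "integrable torus (wave k \<theta>)" for \<theta> by (intro integrable_torus_continuous continuous_intros)
  have "(CLINT x|torus. cis (kdot k x)) = of_real (LINT x|torus. wave k 0 x) + \<i> * of_real (LINT x|torus. wave k (- pi / 2) x)"
    unfolding eq using i
    by (subst Bochner_Integration.integral_add)
      (simp_all only: integrable_of_real integrable_mult_right integral_complex_of_real integral_mult_right_zero)
  then show ?thesis by (simp add: torus_integral_wave)
qed

definition trig_sum :: "(int^3 \<Rightarrow> complex) \<Rightarrow> (int^3) set \<Rightarrow> real^3 \<Rightarrow> complex" where
  "trig_sum c A x = (\<Sum>k\<in>A. c k * cis (kdot k x))"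

lemma continuous_trig_sum [continuous_intros]: "continuous_on S (trig_sum c A)"
  unfolding trig_sum_def by (intro continuous_intros)

lemma trig_sum_norm:
  assumes "finite A"
  shows "(LINT x|torus. (cmod (trig_sum c A x))\<^sup>2) = (2 * pi) ^ 3 * (\<Sum>k\<in>A. (cmod (c k))\<^sup>2)"
proof -
  have "complex_of_real (LINT x|torus. (cmod (trig_sum c A x))\<^sup>2) = (CLINT x|torus. trig_sum c A x * cnj (trig_sum c A x))"
    by (simp only: integral_complex_of_real[symmetric] complex_norm_square)
  also have "\<dots> = (CLINT x|torus. (\<Sum>k\<in>A. \<Sum>l\<in>A. (c k * cnj (c l)) * cis (kdot (k - l) x)))"
  proof -
    have "cis a * cnj (cis b) = cis (a - b)" for a b by (simp add: cis_cnj cis_mult)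
    then have "(c k * cis (kdot k x)) * cnj (c l * cis (kdot l x)) = (c k * cnj (c l)) * cis (kdot (k - l) x)" for k l x
      by (simp add: kdot_diff mult_ac)
    then show ?thesis by (simp only: trig_sum_def sum_product cnj_sum)
  qed
  also have "\<dots> = (\<Sum>k\<in>A. \<Sum>l\<in>A. (c k * cnj (c l)) * (CLINT x|torus. cis (kdot (k - l) x)))"
    by (simp add: integrable_torus_continuous continuous_intros)
  also have "\<dots> = (\<Sum>k\<in>A. \<Sum>l\<in>A. if k = l then (c k * cnj (c k)) * (2 * pi) ^ 3 else 0)"
    by (intro sum.cong refl) (auto simp: torus_integral_cis)
  also have "\<dots> = (\<Sum>k\<in>A. (c k * cnj (c k)) * (2 * pi) ^ 3)"
    using assms by simp
  also have "\<dots> = complex_of_real ((2 * pi) ^ 3 * (\<Sum>k\<in>A. (cmod (c k))\<^sup>2))"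
    by (simp only: complex_norm_square[symmetric] of_real_mult of_real_sum of_real_power of_real_numeral sum_distrib_left mult.commute)
  finally show ?thesis by (simp only: of_real_eq_iff)
qed

lemma wave_coeff_Re_Im:
  assumes "integrable torus f"
  shows "(LINT x|torus. f x * wave k 0 x) = (2 * pi) ^ 3 * Re (fourier f k)"
    and "(LINT x|torus. f x * wave k (pi / 2) x) = (2 * pi) ^ 3 * Im (fourier f k)"
  by (simp_all add: wave_coeff[OF assms])

lemma Re_trig_sum:
  "Re (trig_sum c A x) = (\<Sum>k\<in>A. Re (c k) * wave k 0 x + Im (c k) * wave k (pi / 2) x)"
  by (simp add: trig_sum_def wave_def cos_add)

lemma integral_mult_trig_sum:
  assumes "integrable torus f"
  shows "(LINT x|torus. f x * Re (trig_sum c A x)) =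
    (2 * pi) ^ 3 * (\<Sum>k\<in>A. Re (c k) * Re (fourier f k) + Im (c k) * Im (fourier f k))"
proof -
  have "(LINT x|torus. f x * Re (trig_sum c A x)) =
    (LINT x|torus. (\<Sum>k\<in>A. Re (c k) * (f x * wave k 0 x) + Im (c k) * (f x * wave k (pi / 2) x)))"
    by (simp add: Re_trig_sum sum_distrib_left algebra_simps)
  also have "\<dots> = (\<Sum>k\<in>A. Re (c k) * (LINT x|torus. f x * wave k 0 x) + Im (c k) * (LINT x|torus. f x * wave k (pi / 2) x))"
    by (subst Bochner_Integration.integral_sum)
      (auto intro!: integrable_mult_wave[OF assms] sum.cong simp: integrable_mult_wave[OF assms])
  finally show ?thesis
    by (simp add: wave_coeff_Re_Im[OF assms] sum_distrib_left algebra_simps)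
qed

lemma Bessel:
  assumes f: "sq_integrable f" and A: "finite A"
  shows "(2 * pi) ^ 3 * (\<Sum>k\<in>A. (cmod (fourier f k))\<^sup>2) \<le> sq_int f"
proof -
  let ?S = "trig_sum (fourier f) A" and ?n = "(2 * pi) ^ 3 * (\<Sum>k\<in>A. (cmod (fourier f k))\<^sup>2)"
  have fi: "integrable torus f" using f by (rule sq_integrable_imp_integrable)
  have S: "sq_integrable (\<lambda>x. Re (?S x))"
    by (intro sq_integrable_continuous continuous_intros)
  have S2: "integrable torus (\<lambda>x. (cmod (?S x))\<^sup>2)"
    by (intro integrable_torus_continuous continuous_intros)
  have "(LINT x|torus. f x * Re (?S x)) = ?n"
    by (simp add: integral_mult_trig_sum[OF fi] cmod_power2 flip: power2_eq_square)
  \<comment> \<open>\<open>A\<close> may be asymmetric and the trigonometric sum then not real.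
    Dropping the imaginary part only lowers the norm, so an inequality in this direction
    suffices.\<close>
  moreover have "(LINT x|torus. (Re (?S x))\<^sup>2) \<le> ?n"
    unfolding trig_sum_norm[OF A, symmetric]
    by (intro integral_mono S2) (use S in \<open>auto simp: sq_integrable_def cmod_power2\<close>)
  ultimately have "0 \<le> sq_int f - 2 * ?n + ?n"
    using sq_int_lincomb[OF f S, of 1 "-1"] sq_int_nonneg[of "\<lambda>x. 1 * f x + (-1) * Re (?S x)"]
    by (simp add: sq_int_def)
  then show ?thesis by simp
qed

lemma fourier_minus:
  assumes "integrable torus f"
  shows "fourier f (- k) = cnj (fourier f k)"
proof -
  have w: "wave (- k) \<theta> x = wave k (- \<theta>) x" for \<theta> x
    using cos_minus[of "kdot k x - \<theta>"] by (simp add: wave_def kdot_minus)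
  have "fourier f (- k) = Complex (LINT x|torus. f x * wave k 0 x) (LINT x|torus. f x * wave k (- (pi / 2)) x) / (2 * pi) ^ 3"
    by (simp add: fourier_eq_waves[OF assms] w)
  also have "\<dots> = cnj (fourier f k)"
    unfolding wave_coeff[OF assms] by (simp add: complex_eq_iff)
  finally show ?thesis .
qed

lemma finite_freq_box: "finite {k :: int^3. \<forall>i. \<bar>k $ i\<bar> \<le> n}"
proof (rule finite_subset)
  show "{k :: int^3. \<forall>i. \<bar>k $ i\<bar> \<le> n} \<subseteq> (\<lambda>(a, b, c). vector [a, b, c]) ` ({-n..n} \<times> {-n..n} \<times> {-n..n})"
  proof
    fix k :: "int^3" assume "k \<in> {k. \<forall>i. \<bar>k $ i\<bar> \<le> n}"
    then have "(k $ 1, k $ 2, k $ 3) \<in> {-n..n} \<times> {-n..n} \<times> {-n..n}" by (auto simp: abs_le_iff minus_le_iff)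
    moreover have "k = (\<lambda>(a, b, c). vector [a, b, c]) (k $ 1, k $ 2, k $ 3)"
      by (simp add: vec_eq_iff forall_3)
    ultimately show "k \<in> (\<lambda>(a, b, c). vector [a, b, c]) ` ({-n..n} \<times> {-n..n} \<times> {-n..n})" by (rule image_eqI[rotated])
  qed
qed simp

text \<open>The partial sums over symmetric frequency boxes are real by the conjugation symmetry.
  Their squared distances are differences of a bounded increasing sequence, so they form a Cauchy
  sequence; the limit inherits the coefficients by Cauchy-Schwarz.\<close>

lemma Riesz_Fischer:
  assumes sym: "\<And>k. c (- k) = cnj (c k)"
    and B: "\<And>A. finite A \<Longrightarrow> (\<Sum>k\<in>A. (cmod (c k))\<^sup>2) \<le> B"
  shows "\<exists>g. sq_integrable g \<and> (\<forall>k. fourier g k = c k) \<and> sq_int g \<le> (2 * pi) ^ 3 * B"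
proof -
  define A where "A n = {k :: int^3. \<forall>i. \<bar>k $ i\<bar> \<le> int n}" for n
  have finA [simp]: "finite (A n)" for n unfolding A_def by (rule finite_freq_box)
  have monoA: "A m \<subseteq> A n" if "m \<le> n" for m n
    unfolding A_def using that by (intro Collect_mono) (meson of_nat_mono order_trans)
  \<comment> \<open>Symmetric frequency sets give real trigonometric sums. The differences of two
    boxes are needed as well, because their norms measure the distance of partial sums.\<close>
  have cnjS: "cnj (trig_sum c C x) = trig_sum c C x" if "uminus ` C = C" for C x
  proof -
    have "cnj (trig_sum c C x) = (\<Sum>k\<in>C. c (- k) * cis (kdot (- k) x))"
      by (simp add: trig_sum_def sym kdot_minus cis_cnj)
    also have "\<dots> = trig_sum c (uminus ` C) x"
      unfolding trig_sum_def by (subst sum.reindex) (auto simp: inj_on_def)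
    finally show ?thesis using that by simp
  qed
  have symA: "uminus ` A n = A n" for n
  proof -
    have m: "- k \<in> A n" if "k \<in> A n" for k using that by (simp add: A_def)
    show ?thesis
    proof (intro equalityI subsetI)
      fix k assume "k \<in> A n"
      then show "k \<in> uminus ` A n" by (intro image_eqI[of _ uminus "- k"] m) auto
    qed (use m in blast)
  qed
  have symD: "uminus ` (A m - A n) = A m - A n" for m n
    using symA by (simp add: image_set_diff[of uminus] inj_def)
  define r where "r n x = Re (trig_sum c (A n) x)" for n x
  have r: "sq_integrable (r n)" for n
    unfolding r_def by (intro sq_integrable_continuous continuous_intros)
  define s where "s n = (\<Sum>k\<in>A n. (cmod (c k))\<^sup>2)" for n
  have norm_real: "sq_int (\<lambda>x. Re (trig_sum c C x)) = (2 * pi) ^ 3 * (\<Sum>k\<in>C. (cmod (c k))\<^sup>2)"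
    if "finite C" "uminus ` C = C" for C
  proof -
    have "Im (trig_sum c C x) = 0" for x
      using cnjS[OF that(2), of x] by (simp add: complex_eq_iff)
    then show ?thesis unfolding sq_int_def trig_sum_norm[OF that(1), symmetric] by (simp add: cmod_power2)
  qed
  have rr: "sq_int (r n) = (2 * pi) ^ 3 * s n" for n
    unfolding r_def s_def by (rule norm_real) (simp_all add: symA)
  have rd: "sq_int (\<lambda>x. r m x - r n x) = (2 * pi) ^ 3 * \<bar>s m - s n\<bar>" for m n
  proof -
    have *: "sq_int (\<lambda>x. r m x - r n x) = (2 * pi) ^ 3 * (s m - s n) \<and> s n \<le> s m" if nm: "n \<le> m" for m n
    proof -
      have "(\<lambda>x. r m x - r n x) = (\<lambda>x. Re (trig_sum c (A m - A n) x))"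
        unfolding r_def trig_sum_def by (simp add: sum_diff monoA[OF nm])
      then have "sq_int (\<lambda>x. r m x - r n x) = (2 * pi) ^ 3 * (\<Sum>k\<in>A m - A n. (cmod (c k))\<^sup>2)"
        using norm_real[of "A m - A n"] symD by simp
      moreover have "(\<Sum>k\<in>A m - A n. (cmod (c k))\<^sup>2) = s m - s n"
        unfolding s_def by (simp add: sum_diff monoA[OF nm])
      moreover have "s n \<le> s m" unfolding s_def by (intro sum_mono2) (use monoA[OF nm] in auto)
      ultimately show ?thesis by simp
    qed
    show ?thesis
    proof (cases "n \<le> m")
      case True then show ?thesis using *[of n m] by simp
    next
      case False
      then have "sq_int (\<lambda>x. r n x - r m x) = (2 * pi) ^ 3 * \<bar>s m - s n\<bar>" using *[of m n] by simp
      then show ?thesis by (simp add: sq_int_def power2_commute)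
    qed
  qed
  have "incseq s" unfolding s_def by (intro incseq_SucI sum_mono2) (use monoA in auto)
  moreover have "s n \<le> B" for n unfolding s_def by (rule B) simp
  ultimately obtain L where "s \<longlonglongrightarrow> L" by (metis incseq_convergent)
  then have "Cauchy s" by (rule LIMSEQ_imp_Cauchy)
  have "\<exists>g. sq_integrable g \<and> (\<lambda>n. sq_int (\<lambda>x. r n x - g x)) \<longlonglongrightarrow> 0"
  proof (rule sq_integrable_complete[OF r])
    fix e :: real assume "0 < e"
    then have "0 < e / (2 * pi) ^ 3" by simp
    from metric_CauchyD[OF \<open>Cauchy s\<close> this] obtain N where
      "\<And>m n. N \<le> m \<Longrightarrow> N \<le> n \<Longrightarrow> \<bar>s m - s n\<bar> < e / (2 * pi) ^ 3" by (auto simp: dist_real_def)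
    then show "\<exists>N. \<forall>m\<ge>N. \<forall>n\<ge>N. sq_int (\<lambda>x. r m x - r n x) < e"
      unfolding rd by (intro exI[of _ N]) (simp add: pos_less_divide_eq mult.commute)
  qed
  then obtain g where g: "sq_integrable g" and lim: "(\<lambda>n. sq_int (\<lambda>x. r n x - g x)) \<longlonglongrightarrow> 0" by auto
  have gi: "integrable torus g" using g by (rule sq_integrable_imp_integrable)
  have fr: "fourier (r n) k = c k" if "k \<in> A n" for n k
  proof -
    have ri: "complex_of_real (r n x) = trig_sum c (A n) x" for x
      using cnjS[OF symA, of n x] by (simp add: r_def complex_eq_iff)
    have "(CLINT x|torus. complex_of_real (r n x) * cis (- kdot k x)) =
        (CLINT x|torus. \<Sum>l\<in>A n. c l * cis (kdot (l - k) x))"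
      unfolding ri by (simp add: trig_sum_def sum_distrib_right kdot_diff mult.assoc cis_mult)
    also have "\<dots> = (\<Sum>l\<in>A n. c l * (CLINT x|torus. cis (kdot (l - k) x)))"
      by (subst Bochner_Integration.integral_sum)
        (auto intro!: integrable_torus_continuous continuous_intros)
    also have "\<dots> = (\<Sum>l\<in>A n. if l = k then c k * (2 * pi) ^ 3 else 0)"
      by (intro sum.cong refl) (auto simp: torus_integral_cis)
    also have "\<dots> = c k * (2 * pi) ^ 3" using that by simp
    finally show ?thesis by (simp add: fourier_def kdot_def)
  qed
  have fw: "(LINT x|torus. g x * wave k \<theta> x) = (2 * pi) ^ 3 * Re (cis \<theta> * cnj (c k))" for k \<theta>
  proof -
    have w: "sq_integrable (wave k \<theta>)" by (intro sq_integrable_continuous continuous_intros)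
    have "(\<lambda>n. sqrt (sq_int (\<lambda>x. r n x - g x)) * sqrt (sq_int (wave k \<theta>))) \<longlonglongrightarrow> sqrt 0 * sqrt (sq_int (wave k \<theta>))"
      by (intro tendsto_intros lim)
    then have l0: "(\<lambda>n. sqrt (sq_int (\<lambda>x. r n x - g x)) * sqrt (sq_int (wave k \<theta>))) \<longlonglongrightarrow> 0" by simp
    have "(\<lambda>n. (LINT x|torus. r n x * wave k \<theta> x) - (LINT x|torus. g x * wave k \<theta> x)) \<longlonglongrightarrow> 0"
    proof (rule Lim_null_comparison[OF _ l0], intro always_eventually allI)
      fix n
      have "(LINT x|torus. r n x * wave k \<theta> x) - (LINT x|torus. g x * wave k \<theta> x) = (LINT x|torus. (r n x - g x) * wave k \<theta> x)"
        by (simp add: left_diff_distrib sq_integrable_mult[OF r w] sq_integrable_mult[OF g w])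
      then show "norm ((LINT x|torus. r n x * wave k \<theta> x) - (LINT x|torus. g x * wave k \<theta> x))
          \<le> sqrt (sq_int (\<lambda>x. r n x - g x)) * sqrt (sq_int (wave k \<theta>))"
        using Cauchy_Schwarz_torus[OF sq_integrable_lincomb[OF r g, of 1 n "-1"] w] by simp
    qed
    then have "(\<lambda>n. LINT x|torus. r n x * wave k \<theta> x) \<longlonglongrightarrow> (LINT x|torus. g x * wave k \<theta> x)"
      by (simp add: LIM_zero_iff)
    moreover have "eventually (\<lambda>n. (LINT x|torus. r n x * wave k \<theta> x) = (2 * pi) ^ 3 * Re (cis \<theta> * cnj (c k))) sequentially"
      unfolding eventually_sequentially
    proof (intro exI allI impI)
      fix n assume n: "nat (\<Sum>i\<in>UNIV. \<bar>k $ i\<bar>) \<le> n"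
      have "\<bar>k $ i\<bar> \<le> int n" for i
      proof -
        have "\<bar>k $ i\<bar> \<le> (\<Sum>i\<in>UNIV. \<bar>k $ i\<bar>)" by (rule member_le_sum) auto
        then show ?thesis using n by linarith
      qed
      then have "k \<in> A n" unfolding A_def by simp
      then show "(LINT x|torus. r n x * wave k \<theta> x) = (2 * pi) ^ 3 * Re (cis \<theta> * cnj (c k))"
        by (simp only: wave_coeff[OF sq_integrable_imp_integrable[OF r]] fr)
    qed
    ultimately show ?thesis
      using LIMSEQ_unique[OF _ tendsto_eventually] by blast
  qed
  have fg: "fourier g k = c k" for k
    using fw[of k 0] fw[of k "pi / 2"] by (simp add: fourier_eq_waves[OF gi] complex_eq_iff)
  \<comment> \<open>The pairing of \<open>r n\<close> with \<open>g\<close> equals the squared norm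
    of \<open>r n\<close>, so the squared norm of \<open>g\<close> exceeds that of
    \<open>r n\<close> exactly by the squared distance, which tends to 0.\<close>
  have "sq_int g \<le> (2 * pi) ^ 3 * B + sq_int (\<lambda>x. r n x - g x)" for n
  proof -
    have "(LINT x|torus. r n x * g x) = (2 * pi) ^ 3 * s n"
      using integral_mult_trig_sum[OF gi, of c "A n"]
      by (simp add: r_def s_def fg cmod_power2 mult.commute flip: power2_eq_square)
    then have "sq_int (\<lambda>x. r n x - g x) = sq_int g - (2 * pi) ^ 3 * s n"
      using sq_int_lincomb[OF r g, of 1 n "-1"] rr by simp
    moreover have "(2 * pi) ^ 3 * s n \<le> (2 * pi) ^ 3 * B"
      unfolding s_def by (intro mult_left_mono B) auto
    ultimately show ?thesis by simp
  qed
  note le = this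
  have "(\<lambda>n. (2 * pi) ^ 3 * B + sq_int (\<lambda>x. r n x - g x)) \<longlonglongrightarrow> (2 * pi) ^ 3 * B + 0"
    by (intro tendsto_intros lim)
  from LIMSEQ_le_const[OF this] le have "sq_int g \<le> (2 * pi) ^ 3 * B" by auto
  then show ?thesis using g fg by blast
qed

lemma in_Lp_2_iff: "in_Lp 2 f \<longleftrightarrow> sq_integrable f"
proof -
  have "\<bar>f x\<bar> powr enn2real 2 = (f x)\<^sup>2" for x
    by (cases "f x = 0") (auto simp: powr_numeral)
  then show ?thesis by (simp add: in_Lp_def sq_integrable_def)
qed

lemma fourier_multiplier_coeff:
  assumes "integrable torus f" "integrable torus g" "fourier g k = complex_of_real (m k) * fourier f k"
  shows "(LINT x|torus. g x * wave k \<theta> x) = m k * (LINT x|torus. f x * wave k \<theta> x)"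
  by (simp add: wave_coeff assms algebra_simps)

text \<open>Makes the choice in \<open>multiplier_op\<close> usable. A gradient \<open>w\<close> in
  the Fourier sense pays for linear growth of the symbol: Bessel for \<open>v\<close> and
  \<open>w\<close> bounds the wanted coefficients, Riesz-Fischer realises them, and evenness of
  \<open>m\<close> makes the result real. Uniqueness carries the norm bound over to the chosen
  image.\<close>

lemma multiplier_op_sobolev:
  assumes v: "sq_integrable v" and w: "\<And>i. sq_integrable (w i)"
    and fw: "\<And>i k. fourier (w i) k = \<i> * of_int (k $ i) * fourier v k"
    and sym: "\<And>k. m (- k) = m k" and C: "\<And>k. (m k)\<^sup>2 \<le> C * (1 + freq_sq k)" "0 \<le> C"
  shows "sq_integrable (multiplier_op m v)"
    and "\<And>k. fourier (multiplier_op m v) k = complex_of_real (m k) * fourier v k"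
    and "sq_int (multiplier_op m v) \<le> C * (sq_int v + (\<Sum>i\<in>UNIV. sq_int (w i)))"
proof -
  let ?c = "\<lambda>k. complex_of_real (m k) * fourier v k"
  let ?N = "sq_int v + (\<Sum>i\<in>UNIV. sq_int (w i))"
  have vi: "integrable torus v" by (rule sq_integrable_imp_integrable[OF v])
  have "(\<Sum>k\<in>A. (cmod (?c k))\<^sup>2) \<le> C * ?N / (2 * pi) ^ 3" if A: "finite A" for A
  proof -
    have "(cmod (?c k))\<^sup>2 \<le> C * ((cmod (fourier v k))\<^sup>2 + (\<Sum>i\<in>UNIV. (cmod (fourier (w i) k))\<^sup>2))" for k
    proof -
      have "(cmod (?c k))\<^sup>2 = (m k)\<^sup>2 * (cmod (fourier v k))\<^sup>2" by (simp add: norm_mult power_mult_distrib)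
      also have "\<dots> \<le> C * (1 + freq_sq k) * (cmod (fourier v k))\<^sup>2" by (intro mult_right_mono C) auto
      also have "\<dots> = C * ((cmod (fourier v k))\<^sup>2 + (\<Sum>i\<in>UNIV. (cmod (fourier (w i) k))\<^sup>2))"
      proof -
        have "(cmod (fourier (w i) k))\<^sup>2 = (of_int (k $ i))\<^sup>2 * (cmod (fourier v k))\<^sup>2" for i
          by (simp add: fw norm_mult power_mult_distrib)
        then have "(\<Sum>i\<in>UNIV. (cmod (fourier (w i) k))\<^sup>2) = freq_sq k * (cmod (fourier v k))\<^sup>2"
          by (simp only: freq_sq_def sum_distrib_right)
        then show ?thesis by (simp only: distrib_right distrib_left mult.assoc mult_1_left)
      qed
      finally show ?thesis .
    qed
    then have "(\<Sum>k\<in>A. (cmod (?c k))\<^sup>2) \<le> (\<Sum>k\<in>A. C * ((cmod (fourier v k))\<^sup>2 + (\<Sum>i\<in>UNIV. (cmod (fourier (w i) k))\<^sup>2)))"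
      by (intro sum_mono)
    also have "\<dots> = C * ((\<Sum>k\<in>A. (cmod (fourier v k))\<^sup>2) + (\<Sum>i\<in>UNIV. \<Sum>k\<in>A. (cmod (fourier (w i) k))\<^sup>2))"
      by (subst sum.swap) (simp only: sum_distrib_left[symmetric] sum.distrib)
    also have "\<dots> \<le> C * (sq_int v / (2 * pi) ^ 3 + (\<Sum>i\<in>UNIV. sq_int (w i) / (2 * pi) ^ 3))"
    proof (intro mult_left_mono add_mono sum_mono C(2))
      show "(\<Sum>k\<in>A. (cmod (fourier v k))\<^sup>2) \<le> sq_int v / (2 * pi) ^ 3"
        using Bessel[OF v A] by (simp add: pos_le_divide_eq mult.commute)
      show "(\<Sum>k\<in>A. (cmod (fourier (w i) k))\<^sup>2) \<le> sq_int (w i) / (2 * pi) ^ 3" for i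
        using Bessel[OF w A] by (simp add: pos_le_divide_eq mult.commute)
    qed
    also have "\<dots> = C * ?N / (2 * pi) ^ 3" by (simp only: add_divide_distrib sum_divide_distrib times_divide_eq_right[symmetric])
    finally show ?thesis .
  qed
  moreover have "?c (- k) = cnj (?c k)" for k by (simp add: sym fourier_minus[OF vi])
  ultimately obtain g where g: "sq_integrable g" "\<And>k. fourier g k = ?c k" "sq_int g \<le> (2 * pi) ^ 3 * (C * ?N / (2 * pi) ^ 3)"
    using Riesz_Fischer[of ?c "C * ?N / (2 * pi) ^ 3"] by blast
  then have "is_multiplier_image 2 m v g" by (simp add: is_multiplier_image_def in_Lp_2_iff)
  then have "is_multiplier_image 2 m v (multiplier_op m v)" unfolding multiplier_op_def by (rule someI[of "is_multiplier_image 2 m v" g])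
  then show 1: "sq_integrable (multiplier_op m v)" and 2: "\<And>k. fourier (multiplier_op m v) k = ?c k"
    by (simp_all add: is_multiplier_image_def in_Lp_2_iff)
  have "AE x in torus. multiplier_op m v x = g x"
    by (rule fourier_unique) (auto intro!: sq_integrable_imp_integrable 1 g(1) simp: 2 g(2))
  then have "sq_int (multiplier_op m v) = sq_int g"
    by (rule sq_int_cong_AE) (auto intro: sq_integrable_measurable 1 g)
  then show "sq_int (multiplier_op m v) \<le> C * ?N" using g(3) by simp
qed

section \<open>Lebesgue and Sobolev norms\<close>

lemma enn2real_ge_1:
  assumes "1 \<le> p" "p \<noteq> \<infinity>"
  shows "1 \<le> enn2real p"
proof -
  have "ennreal 1 \<le> ennreal (enn2real p)" using assms by (simp add: ennreal_enn2real_if)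
  then show ?thesis by (subst (asm) ennreal_le_iff) auto
qed

lemma in_Lp_imp_integrable:
  assumes f: "in_Lp p f" and p: "1 \<le> p"
  shows "integrable torus f"
proof (cases "p = \<infinity>")
  case True
  then obtain C where C: "AE x in torus. \<bar>f x\<bar> \<le> C" using f by (auto simp: in_Lp_def)
  show ?thesis
  proof (rule Bochner_Integration.integrable_bound)
    show "integrable torus (\<lambda>_. C)" by (rule integrable_torus_continuous) simp
    show "AE x in torus. norm (f x) \<le> norm C" using C by eventually_elim simp
  qed (use f in \<open>simp add: in_Lp_def\<close>)
next
  case False
  let ?p = "enn2real p"
  have p1: "1 \<le> ?p" by (rule enn2real_ge_1[OF p False])
  show ?thesis
  proof (rule Bochner_Integration.integrable_bound[where f = "\<lambda>x. 1 + \<bar>f x\<bar> powr ?p"])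
    show "integrable torus (\<lambda>x. 1 + \<bar>f x\<bar> powr ?p)"
      using f False integrable_torus_continuous[of "\<lambda>_. 1::real"] by (auto simp: in_Lp_def)
    show "AE x in torus. norm (f x) \<le> norm (1 + \<bar>f x\<bar> powr ?p)"
    proof (rule AE_I2)
      fix x
      show "norm (f x) \<le> norm (1 + \<bar>f x\<bar> powr ?p)"
      proof (cases "\<bar>f x\<bar> \<le> 1")
        case False
        then have "\<bar>f x\<bar> powr 1 \<le> \<bar>f x\<bar> powr ?p" using p1 by (intro powr_mono) auto
        then show ?thesis using False by simp
      qed (simp add: add_increasing2)
    qed
  qed (use f in \<open>auto simp: in_Lp_def\<close>)
qed

lemma in_Lp_1_iff: "in_Lp 1 f \<longleftrightarrow> integrable torus f"
proof
  show "in_Lp 1 f \<Longrightarrow> integrable torus f" by (rule in_Lp_imp_integrable[OF _ order_refl])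
  show "integrable torus f \<Longrightarrow> in_Lp 1 f" by (simp add: in_Lp_def)
qed

lemma Lp_norm_cong_AE:
  assumes "AE x in torus. f x = g x" "f \<in> borel_measurable torus" "g \<in> borel_measurable torus"
  shows "Lp_norm p f = Lp_norm p g"
proof -
  have "(AE x in torus. \<bar>f x\<bar> \<le> C) = (AE x in torus. \<bar>g x\<bar> \<le> C)" for C
    using assms(1) by (intro AE_cong_simp iffI) (auto elim: AE_mp)
  moreover have "(LINT x|torus. \<bar>f x\<bar> powr enn2real p) = (LINT x|torus. \<bar>g x\<bar> powr enn2real p)"
    by (rule integral_cong_AE) (use assms in \<open>auto elim: eventually_mono\<close>)
  ultimately show ?thesis by (simp add: Lp_norm_def)
qed

text \<open>One constant serves all exponents, because the volume (2 pi)^3 is at least 1 and so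
  bounds each of its roots, and also the factor 1 at p = \<infinity>.\<close>

lemma Lp_bounded:
  assumes m: "f \<in> borel_measurable torus" and b: "\<And>x. \<bar>f x\<bar> \<le> M" and p: "1 \<le> p"
  shows "in_Lp p f" "0 \<le> Lp_norm p f" "Lp_norm p f \<le> (2 * pi) ^ 3 * M"
proof -
  have M: "0 \<le> M" using b[of 0] by simp
  have V1: "1 \<le> (2 * pi) ^ 3" using pi_gt3 by (intro one_le_power) simp
  have "in_Lp p f \<and> 0 \<le> Lp_norm p f \<and> Lp_norm p f \<le> (2 * pi) ^ 3 * M"
  proof (cases "p = \<infinity>")
    case True
    let ?S = "{C. 0 \<le> C \<and> (AE x in torus. \<bar>f x\<bar> \<le> C)}"
    have MS: "M \<in> ?S" using b M by simp
    have "0 \<le> Inf ?S" by (rule cInf_greatest) (use MS in auto)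
    moreover have "Inf ?S \<le> M" by (rule cInf_lower[OF MS]) (auto intro: bdd_belowI)
    moreover have "1 * M \<le> (2 * pi) ^ 3 * M" using V1 M by (rule mult_right_mono)
    ultimately show ?thesis using True m b by (auto simp: in_Lp_def Lp_norm_def)
  next
    case False
    let ?p = "enn2real p"
    have p1: "1 \<le> ?p" by (rule enn2real_ge_1[OF p False])
    have le: "\<bar>f x\<bar> powr ?p \<le> M powr ?p" for x using b p1 by (intro powr_mono2) auto
    have c: "integrable torus (\<lambda>x. M powr ?p)" by (rule integrable_torus_continuous) simp
    have i: "integrable torus (\<lambda>x. \<bar>f x\<bar> powr ?p)"
      by (rule Bochner_Integration.integrable_bound[OF c]) (use m le in auto)
    have "(LINT x|torus. \<bar>f x\<bar> powr ?p) \<le> (LINT x|torus. M powr ?p)"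
      by (rule integral_mono[OF i c le])
    then have I: "(LINT x|torus. \<bar>f x\<bar> powr ?p) \<le> (2 * pi) ^ 3 * M powr ?p"
      using measure_torus by simp
    have "Lp_norm p f \<le> ((2 * pi) ^ 3 * M powr ?p) powr (1 / ?p)"
      unfolding Lp_norm_def using False p1 I by (auto intro!: powr_mono2)
    also have "\<dots> = ((2 * pi) ^ 3) powr (1 / ?p) * M"
      using M p1 by (simp add: powr_mult powr_powr)
    also have "\<dots> \<le> ((2 * pi) ^ 3) powr 1 * M"
      using V1 M p1 by (intro mult_right_mono powr_mono) (auto simp: divide_le_eq)
    finally have "Lp_norm p f \<le> (2 * pi) ^ 3 * M" by simp
    then show ?thesis using False i m by (auto simp: in_Lp_def Lp_norm_def)
  qed
  then show "in_Lp p f" "0 \<le> Lp_norm p f" "Lp_norm p f \<le> (2 * pi) ^ 3 * M" by auto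
qed

text \<open>Cauchy-Schwarz for the square of \<open>f\<close> against the constant 1, whose squared
  norm is the volume.\<close>

lemma in_Lp_4:
  assumes "in_Lp 4 f"
  shows "sq_integrable f" "sq_int f \<le> sqrt ((2 * pi) ^ 3) * (Lp_norm 4 f)\<^sup>2"
proof -
  have e: "enn2real 4 = 4" by simp
  have p4: "\<bar>f x\<bar> powr 4 = ((f x)\<^sup>2)\<^sup>2" for x
    by (cases "f x = 0") (auto simp: powr_numeral power_even_abs_numeral simp flip: power_mult)
  have m [measurable]: "f \<in> borel_measurable torus" using assms by (simp add: in_Lp_def)
  have s2: "sq_integrable (\<lambda>x. (f x)\<^sup>2)"
    using assms by (simp add: in_Lp_def sq_integrable_def e p4)
  have "integrable torus (\<lambda>x. (f x)\<^sup>2)" by (rule sq_integrable_imp_integrable[OF s2])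
  then show "sq_integrable f" by (simp add: sq_integrable_def)
  have one: "sq_integrable (\<lambda>_. 1)" by (rule sq_integrable_continuous) simp
  have "sq_int f \<le> \<bar>LINT x|torus. (f x)\<^sup>2 * 1\<bar>" by (simp add: sq_int_def)
  also have "\<dots> \<le> sqrt (sq_int (\<lambda>x. (f x)\<^sup>2)) * sqrt (sq_int (\<lambda>_. 1))"
    by (rule Cauchy_Schwarz_torus[OF s2 one])
  also have "sq_int (\<lambda>_. 1) = (2 * pi) ^ 3" using measure_torus by (simp add: sq_int_def)
  also have "sqrt (sq_int (\<lambda>x. (f x)\<^sup>2)) = (Lp_norm 4 f)\<^sup>2"
  proof -
    have "(Lp_norm 4 f)\<^sup>2 = (sq_int (\<lambda>x. (f x)\<^sup>2) powr (1 / 4)) powr 2"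
      by (simp add: Lp_norm_def e p4 sq_int_def powr_numeral)
    also have "\<dots> = sq_int (\<lambda>x. (f x)\<^sup>2) powr (1 / 2)" by (simp add: powr_powr)
    finally show ?thesis by (simp add: powr_half_sqrt sq_int_nonneg)
  qed
  finally show "sq_int f \<le> sqrt ((2 * pi) ^ 3) * (Lp_norm 4 f)\<^sup>2" by (simp add: mult.commute)
qed

section \<open>Weak derivatives\<close>

lemma torus_unique_waves:
  assumes "integrable torus f" "integrable torus g"
    and "\<And>k \<theta>. (LINT x|torus. f x * wave k \<theta> x) = (LINT x|torus. g x * wave k \<theta> x)"
  shows "AE x in torus. f x = g x"
  by (rule fourier_unique) (simp_all add: fourier_eq_waves assms)

text \<open>Waves are smooth test functions, and testing with them already fixes all Fourier
  coefficients.\<close>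

lemma weak_deriv_unique:
  assumes "is_weak_deriv \<alpha> f g" "is_weak_deriv \<alpha> f h"
  shows "AE x in torus. g x = h x"
proof (rule torus_unique_waves)
  show "(LINT x|torus. g x * wave k \<theta> x) = (LINT x|torus. h x * wave k \<theta> x)" for k \<theta>
  proof -
    have "(-1) ^ mi_order \<alpha> * (LINT x|torus. g x * wave k \<theta> x) = (-1) ^ mi_order \<alpha> * (LINT x|torus. h x * wave k \<theta> x)"
      using assms smooth_torus_wave1[of k \<theta>] unfolding is_weak_deriv_def by metis
    then show ?thesis by (simp add: minus_one_power_iff split: if_splits)
  qed
qed (use assms in \<open>simp_all add: is_weak_deriv_def in_Lp_1_iff\<close>)

lemma is_weak_deriv_weak_deriv:
  assumes "is_weak_deriv \<alpha> f g"
  shows "is_weak_deriv \<alpha> f (weak_deriv \<alpha> f)" "AE x in torus. weak_deriv \<alpha> f x = g x"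
proof -
  show 1: "is_weak_deriv \<alpha> f (weak_deriv \<alpha> f)" unfolding weak_deriv_def
    using assms by (rule someI[of "is_weak_deriv \<alpha> f" g])
  show "AE x in torus. weak_deriv \<alpha> f x = g x" by (rule weak_deriv_unique[OF 1 assms])
qed

lemma is_weak_deriv_two_waves:
  "is_weak_deriv \<alpha> (\<lambda>x. a * wave k \<theta> x + b * wave l \<eta> x)
    (\<lambda>x. a * (mono_symbol \<alpha> k * wave k (\<theta> + mi_order \<alpha> * (pi / 2)) x)
       + b * (mono_symbol \<alpha> l * wave l (\<eta> + mi_order \<alpha> * (pi / 2)) x))"
proof -
  have "(LINT x|torus. (a * wave k \<theta> x + b * wave l \<eta> x) * mi_partial \<alpha> \<phi> x) =
    (-1) ^ mi_order \<alpha> * (LINT x|torus. (a * (mono_symbol \<alpha> k * wave k (\<theta> + mi_order \<alpha> * (pi / 2)) x)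
       + b * (mono_symbol \<alpha> l * wave l (\<eta> + mi_order \<alpha> * (pi / 2)) x)) * \<phi> x)" if \<phi>: "smooth_torus \<phi>" for \<phi>
  proof -
    have c: "continuous_on UNIV \<phi>" "continuous_on UNIV (mi_partial \<alpha> \<phi>)"
      using partial_parts(3)[OF \<phi>] \<phi> by (auto simp: smooth_torus_def intro: differentiable_imp_continuous_UNIV)
    have i: "integrable torus (\<lambda>x. wave k \<theta> x * mi_partial \<alpha> \<phi> x)"
        "integrable torus (\<lambda>x. (c * wave k \<theta> x) * \<phi> x)" for k \<theta> c
      by (intro integrable_torus_continuous continuous_intros c)+
    have "(LINT x|torus. (a * wave k \<theta> x + b * wave l \<eta> x) * mi_partial \<alpha> \<phi> x) =
      a * (LINT x|torus. wave k \<theta> x * mi_partial \<alpha> \<phi> x) + b * (LINT x|torus. wave l \<eta> x * mi_partial \<alpha> \<phi> x)"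
      using i by (simp add: distrib_right mult.assoc)
    also have "\<dots> = (-1) ^ mi_order \<alpha> * (a * (LINT x|torus. (mono_symbol \<alpha> k * wave k (\<theta> + mi_order \<alpha> * (pi / 2)) x) * \<phi> x)
        + b * (LINT x|torus. (mono_symbol \<alpha> l * wave l (\<eta> + mi_order \<alpha> * (pi / 2)) x) * \<phi> x))"
      unfolding wave_parts[OF \<phi>] by (simp only: distrib_left mult.left_commute)
    also have "a * (LINT x|torus. (mono_symbol \<alpha> k * wave k (\<theta> + mi_order \<alpha> * (pi / 2)) x) * \<phi> x)
        + b * (LINT x|torus. (mono_symbol \<alpha> l * wave l (\<eta> + mi_order \<alpha> * (pi / 2)) x) * \<phi> x) =
      (LINT x|torus. a * ((mono_symbol \<alpha> k * wave k (\<theta> + mi_order \<alpha> * (pi / 2)) x) * \<phi> x)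
        + b * ((mono_symbol \<alpha> l * wave l (\<eta> + mi_order \<alpha> * (pi / 2)) x) * \<phi> x))"
      by (subst Bochner_Integration.integral_add) (intro integrable_mult_right i | simp only: integral_mult_right_zero)+
    finally show ?thesis by (simp only: distrib_right mult.assoc)
  qed
  then show ?thesis unfolding is_weak_deriv_def in_Lp_1_iff
    by (intro conjI allI impI integrable_torus_continuous continuous_intros)
qed

section \<open>Sobolev norms of sums of two waves\<close>

lemma freq_sq_nonneg: "0 \<le> freq_sq k"
  unfolding freq_sq_def by (intro sum_nonneg) auto

lemma freq_sq_minus: "freq_sq (- k) = freq_sq k"
  by (simp add: freq_sq_def)

lemma freq_le: "\<bar>real_of_int (k $ i)\<bar> \<le> 1 + freq_sq k"
proof -
  have "(real_of_int (k $ i))\<^sup>2 \<le> freq_sq k" unfolding freq_sq_def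
    by (rule member_le_sum) auto
  moreover have "2 * \<bar>real_of_int (k $ i)\<bar> * 1 \<le> \<bar>real_of_int (k $ i)\<bar>\<^sup>2 + 1\<^sup>2" by (rule sum_squares_bound)
  ultimately show ?thesis by simp
qed

lemma mono_symbol_le:
  assumes "mi_order \<alpha> \<le> n"
  shows "\<bar>mono_symbol \<alpha> k\<bar> \<le> (1 + freq_sq k) ^ n"
proof -
  have "\<bar>mono_symbol \<alpha> k\<bar> \<le> (1 + freq_sq k) ^ (\<alpha> $ 1) * (1 + freq_sq k) ^ (\<alpha> $ 2) * (1 + freq_sq k) ^ (\<alpha> $ 3)"
    unfolding mono_symbol_def abs_mult power_abs
    by (intro mult_mono power_mono freq_le) (auto simp: freq_sq_nonneg)
  also have "\<dots> = (1 + freq_sq k) ^ mi_order \<alpha>" by (simp add: mi_order_def sum_3 power_add)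
  also have "\<dots> \<le> (1 + freq_sq k) ^ n" using assms freq_sq_nonneg[of k] by (intro power_increasing) auto
  finally show ?thesis .
qed

text \<open>A sum over an infinite index set would be 0 by default, and the Sobolev norm would then
  not control its individual terms.\<close>

lemma finite_mi_order: "finite {\<alpha>. mi_order \<alpha> \<le> n}"
proof (rule finite_subset)
  show "{\<alpha>. mi_order \<alpha> \<le> n} \<subseteq> (\<lambda>(a, b, c). vector [a, b, c]) ` ({..n} \<times> {..n} \<times> {..n})"
  proof
    fix \<alpha> assume "\<alpha> \<in> {\<alpha>. mi_order \<alpha> \<le> n}"
    then have "(\<alpha> $ 1, \<alpha> $ 2, \<alpha> $ 3) \<in> {..n} \<times> {..n} \<times> {..n}" by (auto simp: mi_order_def sum_3)
    moreover have "\<alpha> = (\<lambda>(a, b, c). vector [a, b, c]) (\<alpha> $ 1, \<alpha> $ 2, \<alpha> $ 3)"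
      by (simp add: vec_eq_iff forall_3)
    ultimately show "\<alpha> \<in> (\<lambda>(a, b, c). vector [a, b, c]) ` ({..n} \<times> {..n} \<times> {..n})" by (rule image_eqI[rotated])
  qed
qed simp

lemma abs_two_waves_le:
  assumes "\<bar>A\<bar> \<le> a" "\<bar>B\<bar> \<le> b"
  shows "\<bar>A * wave k \<theta> x + B * wave l \<eta> x\<bar> \<le> a + b"
proof -
  have "\<bar>A * wave k \<theta> x\<bar> \<le> a * 1" "\<bar>B * wave l \<eta> x\<bar> \<le> b * 1"
    unfolding abs_mult using assms abs_wave_le by (intro mult_mono; force)+
  then show ?thesis by linarith
qed

lemma fourier_wave_zero:
  assumes "j \<noteq> k" "j \<noteq> - k"
  shows "fourier (wave k \<theta>) j = 0"
proof -
  have "integrable torus (wave k \<theta>)" by (intro integrable_torus_continuous continuous_intros)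
  moreover have "k + j \<noteq> 0" using assms(2) by (simp add: eq_neg_iff_add_eq_0 add.commute)
  ultimately show ?thesis using assms by (simp add: fourier_eq_waves torus_integral_wave_mult complex_eq_iff)
qed

text \<open>The coefficients of the wave vanish off the two frequencies \<open>k\<close> and
  \<open>- k\<close>, and there an even symbol takes the value \<open>m k\<close>.\<close>

lemma fourier_wave_multiplier:
  assumes "\<And>k. m (- k) = (m k :: real)"
  shows "complex_of_real (m j) * fourier (wave k \<theta>) j = complex_of_real (m k) * fourier (wave k \<theta>) j"
proof (cases "j = k \<or> j = - k")
  case True
  then have "m j = m k" using assms[of k] by auto
  then show ?thesis by simp
next
  case False
  then show ?thesis using fourier_wave_zero[of j k \<theta>] by simp
qed

lemma sobolev_W_two_waves:
  assumes p: "1 \<le> p"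
  shows "\<exists>C n. 0 \<le> C \<and> (\<forall>a k \<theta> b l \<eta>. let f = (\<lambda>x. a * wave k \<theta> x + b * wave l \<eta> x) in
    f \<in> sp_carrier (sobolev_W m p) \<and> 0 \<le> sp_norm (sobolev_W m p) f \<and>
    sp_norm (sobolev_W m p) f \<le> C * (\<bar>a\<bar> * (1 + freq_sq k) ^ n + \<bar>b\<bar> * (1 + freq_sq l) ^ n))"
proof (intro exI[of _ "card {\<alpha>. mi_order \<alpha> \<le> m} * (2 * pi) ^ 3"] exI[of _ m] conjI allI)
  show "0 \<le> card {\<alpha>. mi_order \<alpha> \<le> m} * (2 * pi) ^ 3" by simp
  fix a b \<theta> \<eta> :: real and k l :: "int^3"
  define f where "f = (\<lambda>x. a * wave k \<theta> x + b * wave l \<eta> x)"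
  define M where "M = \<bar>a\<bar> * (1 + freq_sq k) ^ m + \<bar>b\<bar> * (1 + freq_sq l) ^ m"
  define D where "D \<alpha> x = (a * mono_symbol \<alpha> k) * wave k (\<theta> + mi_order \<alpha> * (pi / 2)) x
       + (b * mono_symbol \<alpha> l) * wave l (\<eta> + mi_order \<alpha> * (pi / 2)) x" for \<alpha> x
  have w: "is_weak_deriv \<alpha> f (D \<alpha>)" for \<alpha>
    using is_weak_deriv_two_waves[of \<alpha> a k \<theta> b l \<eta>] unfolding f_def D_def by (simp add: mult.assoc)
  have Dm: "D \<alpha> \<in> borel_measurable torus" for \<alpha>
    unfolding D_def by (intro measurable_torus_continuous continuous_intros)
  have Db: "\<bar>D \<alpha> x\<bar> \<le> M" if "mi_order \<alpha> \<le> m" for \<alpha> x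
    unfolding D_def M_def using mono_symbol_le[OF that]
    by (intro abs_two_waves_le) (auto simp: abs_mult intro!: mult_left_mono)
  have fm: "f \<in> borel_measurable torus"
    unfolding f_def by (intro measurable_torus_continuous continuous_intros)
  have "in_Lp p f" by (rule Lp_bounded(1)[OF fm _ p]) (unfold f_def, rule abs_two_waves_le, rule order_refl, rule order_refl)
  then have c: "f \<in> sp_carrier (sobolev_W m p)"
    using w Lp_bounded(1)[OF Dm Db p] by (auto simp: sobolev_W_def)
  have eq: "Lp_norm p (weak_deriv \<alpha> f) = Lp_norm p (D \<alpha>)" for \<alpha>
    using is_weak_deriv_weak_deriv[OF w[of \<alpha>]] Dm
    by (intro Lp_norm_cong_AE) (auto simp: is_weak_deriv_def in_Lp_def)
  have n0: "0 \<le> sp_norm (sobolev_W m p) f"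
    unfolding sobolev_W_def using Lp_bounded(2)[OF Dm Db p] by (auto simp: eq intro!: sum_nonneg)
  have "sp_norm (sobolev_W m p) f \<le> card {\<alpha>. mi_order \<alpha> \<le> m} * ((2 * pi) ^ 3 * M)"
    unfolding sobolev_W_def using Lp_bounded(3)[OF Dm Db p] by (auto simp: eq intro!: sum_bounded_above)
  then show "let f = (\<lambda>x. a * wave k \<theta> x + b * wave l \<eta> x) in
    f \<in> sp_carrier (sobolev_W m p) \<and> 0 \<le> sp_norm (sobolev_W m p) f \<and>
    sp_norm (sobolev_W m p) f \<le> card {\<alpha>. mi_order \<alpha> \<le> m} * (2 * pi) ^ 3 * (\<bar>a\<bar> * (1 + freq_sq k) ^ m + \<bar>b\<bar> * (1 + freq_sq l) ^ m)"
    using c n0 unfolding Let_def f_def[symmetric] M_def[symmetric] by (simp only: mult.assoc simp_thms)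
qed

lemma sobolev_H_two_waves:
  assumes s: "0 \<le> s" and p: "1 \<le> p"
  shows "\<exists>C n. 0 \<le> C \<and> (\<forall>a k \<theta> b l \<eta>. let f = (\<lambda>x. a * wave k \<theta> x + b * wave l \<eta> x) in
    f \<in> sp_carrier (sobolev_H s p) \<and> 0 \<le> sp_norm (sobolev_H s p) f \<and>
    sp_norm (sobolev_H s p) f \<le> C * (\<bar>a\<bar> * (1 + freq_sq k) ^ n + \<bar>b\<bar> * (1 + freq_sq l) ^ n))"
proof -
  define n where "n = nat \<lceil>s / 2\<rceil>"
  have sn: "s / 2 \<le> real n" unfolding n_def by linarith
  define m where "m k = (1 + freq_sq k) powr (s / 2)" for k
  have m: "m (- k) = m k" for k by (simp add: m_def freq_sq_minus)
  have mb: "\<bar>m k\<bar> \<le> (1 + freq_sq k) ^ n" for k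
  proof -
    have "m k \<le> (1 + freq_sq k) powr n" unfolding m_def using sn freq_sq_nonneg[of k] by (intro powr_mono) auto
    also have "\<dots> = (1 + freq_sq k) ^ n" using freq_sq_nonneg[of k] by (intro powr_realpow) auto
    finally show ?thesis by (simp add: m_def)
  qed
  show ?thesis
  proof (intro exI[of _ "(2 * pi) ^ 3"] exI[of _ n] conjI allI)
    fix a b \<theta> \<eta> :: real and k l :: "int^3"
    define f where "f = (\<lambda>x. a * wave k \<theta> x + b * wave l \<eta> x)"
    define M where "M = \<bar>a\<bar> * (1 + freq_sq k) ^ n + \<bar>b\<bar> * (1 + freq_sq l) ^ n"
    define g where "g x = (a * m k) * wave k \<theta> x + (b * m l) * wave l \<eta> x" for x
    have wi: "integrable torus (wave k \<theta>)" for k \<theta> by (intro integrable_torus_continuous continuous_intros)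
    have fi: "integrable torus f" unfolding f_def by (intro integrable_torus_continuous continuous_intros)
    have gm: "g \<in> borel_measurable torus" unfolding g_def by (intro measurable_torus_continuous continuous_intros)
    have gb: "\<bar>g x\<bar> \<le> M" for x
      unfolding g_def M_def using mb by (intro abs_two_waves_le) (auto simp: abs_mult intro!: mult_left_mono)
    have im: "is_multiplier_image p m f g"
    proof -
      have "fourier g j = complex_of_real (m j) * fourier f j" for j
        unfolding g_def[abs_def] f_def fourier_linear[OF wi wi]
        by (simp only: of_real_mult mult.assoc distrib_left mult.left_commute[of "of_real (m j)"]
            fourier_wave_multiplier[of m j, OF m])
      then show ?thesis using Lp_bounded(1)[OF gm gb p] by (simp add: is_multiplier_image_def)
    qed
    let ?h = "SOME g. is_multiplier_image p m f g"
    have im': "is_multiplier_image p m f ?h" using im by (rule someI[of "is_multiplier_image p m f" g])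
    have "AE x in torus. ?h x = g x"
      by (rule fourier_unique) (use im im' in_Lp_imp_integrable[OF _ p] in \<open>auto simp: is_multiplier_image_def\<close>)
    then have eq: "Lp_norm p ?h = Lp_norm p g"
      by (rule Lp_norm_cong_AE) (use im' gm in \<open>auto simp: is_multiplier_image_def in_Lp_def\<close>)
    have c: "f \<in> sp_carrier (sobolev_H s p)"
      using im fi by (auto simp: sobolev_H_def in_Lp_1_iff m_def[abs_def])
    have nrm: "sp_norm (sobolev_H s p) f = Lp_norm p g"
      using eq by (simp add: sobolev_H_def m_def[abs_def])
    show "let f = (\<lambda>x. a * wave k \<theta> x + b * wave l \<eta> x) in
      f \<in> sp_carrier (sobolev_H s p) \<and> 0 \<le> sp_norm (sobolev_H s p) f \<and>
      sp_norm (sobolev_H s p) f \<le> (2 * pi) ^ 3 * (\<bar>a\<bar> * (1 + freq_sq k) ^ n + \<bar>b\<bar> * (1 + freq_sq l) ^ n)"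
      using c nrm Lp_bounded(2,3)[OF gm gb p] unfolding Let_def f_def[symmetric] M_def[symmetric] by simp
  qed simp
qed

text \<open>All data of the argument are combinations of two waves. Treating both scales of spaces
  alike, it suffices that such functions belong to the space and that their norms are nonnegative
  and at most polynomial in the frequencies. Nonnegativity matters because the functions T and K are
  controlled only on the nonnegative quadrant.\<close>

lemma sobolev_space_two_waves:
  assumes "sobolev_space X"
  obtains C n where "0 \<le> C"
    and "\<And>a k \<theta> b l \<eta>. (\<lambda>x. a * wave k \<theta> x + b * wave l \<eta> x) \<in> sp_carrier X"
    and "\<And>a k \<theta> b l \<eta>. 0 \<le> sp_norm X (\<lambda>x. a * wave k \<theta> x + b * wave l \<eta> x)"
    and "\<And>a k \<theta> b l \<eta>. sp_norm X (\<lambda>x. a * wave k \<theta> x + b * wave l \<eta> x)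
      \<le> C * (\<bar>a\<bar> * (1 + freq_sq k) ^ n + \<bar>b\<bar> * (1 + freq_sq l) ^ n)"
proof -
  have "\<exists>C n. 0 \<le> C \<and> (\<forall>a k \<theta> b l \<eta>. let f = (\<lambda>x. a * wave k \<theta> x + b * wave l \<eta> x) in
    f \<in> sp_carrier X \<and> 0 \<le> sp_norm X f \<and>
    sp_norm X f \<le> C * (\<bar>a\<bar> * (1 + freq_sq k) ^ n + \<bar>b\<bar> * (1 + freq_sq l) ^ n))"
    using assms unfolding sobolev_space_def
  proof (elim disjE exE conjE)
    fix m p assume "1 \<le> p" "X = sobolev_W m p"
    then show ?thesis using sobolev_W_two_waves by simp
  next
    fix s p assume "0 \<le> s" "1 < p" "X = sobolev_H s p"
    then show ?thesis using sobolev_H_two_waves[of s p] by simp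
  qed
  then show ?thesis using that unfolding Let_def by blast
qed

section \<open>Functions with square-integrable gradient\<close>

lemma fourier_derivative:
  assumes v: "integrable torus v" and w: "integrable torus w"
    and p: "\<And>\<theta>. (LINT x|torus. w x * wave k \<theta> x) = - c * (LINT x|torus. v x * wave k (\<theta> + pi / 2) x)"
  shows "fourier w k = \<i> * of_real c * fourier v k"
proof -
  have "(LINT x|torus. v x * wave k pi x) = - (LINT x|torus. v x * wave k 0 x)"
    by (simp add: wave_coeff[OF v])
  then show ?thesis
    using p[of 0] p[of "pi / 2"] by (simp add: fourier_eq_waves v w complex_eq_iff)
qed

lemma smooth_torus_gradient:
  assumes "smooth_torus \<phi>"
  shows "sq_integrable \<phi>" "sq_integrable (partial i \<phi>)"
    "fourier (partial i \<phi>) k = \<i> * of_int (k $ i) * fourier \<phi> k"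
proof -
  show 1: "sq_integrable \<phi>" and 2: "sq_integrable (partial i \<phi>)"
    using partial_parts[OF assms] by (auto intro: sq_integrable_continuous)
  show "fourier (partial i \<phi>) k = \<i> * of_int (k $ i) * fourier \<phi> k"
    using fourier_derivative[OF 1[THEN sq_integrable_imp_integrable] 2[THEN sq_integrable_imp_integrable]
        partial_parts(1)[OF assms]] by simp
qed

text \<open>Reduces W(1,4) to a square-integrable gradient described on the Fourier side, the form
  that \<open>multiplier_op_sobolev\<close> expects. The factor 4 counts the function and its three
  first derivatives, each bounded by the whole norm.\<close>

lemma W14_gradient:
  assumes v: "v \<in> sp_carrier (sobolev_W 1 4)"
  obtains w where "sq_integrable v" "\<And>i. sq_integrable (w i)"
    "\<And>i k. fourier (w i) k = \<i> * of_int (k $ i) * fourier v k"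
    "sq_int v + (\<Sum>i\<in>UNIV. sq_int (w i)) \<le> 4 * sqrt ((2 * pi) ^ 3) * (sp_norm (sobolev_W 1 4) v)\<^sup>2"
proof -
  let ?e = "\<lambda>i. \<chi> j. if j = i then (1 :: nat) else 0"
  let ?N = "sp_norm (sobolev_W 1 4) v"
  let ?s = "sqrt ((2 * pi) ^ 3)"
  have e: "mi_order (?e i) = 1" "mono_symbol (?e i) k = of_int (k $ i)" for i k
    using exhaust_3[of i] by (auto simp: mi_order_def sum_3 mono_symbol_def)
  have v4: "in_Lp 4 v" using v by (simp add: sobolev_W_def)
  have vi: "integrable torus v" by (rule sq_integrable_imp_integrable[OF in_Lp_4(1)[OF v4]])
  define w where "w i = weak_deriv (?e i) v" for i
  have wd: "is_weak_deriv \<alpha> v (weak_deriv \<alpha> v)" and w4: "in_Lp 4 (weak_deriv \<alpha> v)" if "mi_order \<alpha> \<le> 1" for \<alpha>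
  proof -
    have "\<exists>g. in_Lp 4 g \<and> is_weak_deriv \<alpha> v g" using v that by (simp add: sobolev_W_def)
    then obtain g where g: "in_Lp 4 g" "is_weak_deriv \<alpha> v g" by blast
    show 1: "is_weak_deriv \<alpha> v (weak_deriv \<alpha> v)" by (rule is_weak_deriv_weak_deriv(1)[OF g(2)])
    have m: "weak_deriv \<alpha> v \<in> borel_measurable torus" using 1 by (simp add: is_weak_deriv_def in_Lp_def)
    have "integrable torus (\<lambda>x. \<bar>weak_deriv \<alpha> v x\<bar> powr enn2real 4)"
      by (rule integrable_cong_AE_imp[of _ "\<lambda>x. \<bar>g x\<bar> powr enn2real 4"])
        (use g m is_weak_deriv_weak_deriv(2)[OF g(2)] in \<open>auto simp: in_Lp_def elim: eventually_mono\<close>)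
    then show "in_Lp 4 (weak_deriv \<alpha> v)" using m by (simp add: in_Lp_def)
  qed
  have N: "Lp_norm 4 (weak_deriv \<alpha> v) \<le> ?N" if "mi_order \<alpha> \<le> 1" for \<alpha>
    unfolding sobolev_W_def using that finite_mi_order[of 1]
    by (auto intro!: member_le_sum simp: Lp_norm_def)
  have b: "sq_int (weak_deriv \<alpha> v) \<le> ?s * ?N\<^sup>2" if "mi_order \<alpha> \<le> 1" for \<alpha>
  proof -
    have "sq_int (weak_deriv \<alpha> v) \<le> ?s * (Lp_norm 4 (weak_deriv \<alpha> v))\<^sup>2" by (rule in_Lp_4(2)[OF w4[OF that]])
    also have "\<dots> \<le> ?s * ?N\<^sup>2"
      by (intro mult_left_mono power_mono N that) (auto simp: Lp_norm_def)
    finally show ?thesis .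
  qed
  have 0: "is_weak_deriv 0 v v"
    unfolding is_weak_deriv_def in_Lp_1_iff using vi by (simp add: mi_partial_def mi_order_def)
  have "sq_int v = sq_int (weak_deriv 0 v)"
    using is_weak_deriv_weak_deriv[OF 0] vi
    by (intro sq_int_cong_AE) (auto simp: is_weak_deriv_def in_Lp_def elim: eventually_mono)
  then have bv: "sq_int v \<le> ?s * ?N\<^sup>2" using b[of 0] by (simp add: mi_order_def)
  have wi: "sq_integrable (w i)" for i unfolding w_def by (rule in_Lp_4(1)[OF w4]) (simp add: e)
  show ?thesis
  proof (rule that[of w])
    show "sq_integrable v" by (rule in_Lp_4(1)[OF v4])
    show "sq_integrable (w i)" for i by (rule wi)
    show "fourier (w i) k = \<i> * of_int (k $ i) * fourier v k" for i k
    proof -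
      have "(LINT x|torus. w i x * wave k \<theta> x) = - of_int (k $ i) * (LINT x|torus. v x * wave k (\<theta> + pi / 2) x)" for \<theta>
      proof -
        have "(LINT x|torus. v x * mi_partial (?e i) (wave k \<theta>) x) = - (LINT x|torus. w i x * wave k \<theta> x)"
          using wd[of "?e i"] smooth_torus_wave1[of k \<theta>] by (simp add: is_weak_deriv_def e w_def)
        moreover have "mi_partial (?e i) (wave k \<theta>) = (\<lambda>x. of_int (k $ i) * wave k (\<theta> + pi / 2) x)"
          using mi_partial_wave[of "?e i" 1 k \<theta>] by (simp add: e)
        ultimately show ?thesis by (simp add: mult.left_commute[of _ "of_int (k $ i)"])
      qed
      from fourier_derivative[OF vi sq_integrable_imp_integrable[OF wi] this] show ?thesis by simp
    qed
    have "(\<Sum>i\<in>(UNIV :: 3 set). sq_int (w i)) \<le> (\<Sum>i\<in>(UNIV :: 3 set). ?s * ?N\<^sup>2)"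
      unfolding w_def by (intro sum_mono b) (simp add: e)
    then show "sq_int v + (\<Sum>i\<in>UNIV. sq_int (w i)) \<le> 4 * ?s * ?N\<^sup>2" using bv by simp
  qed
qed

section \<open>A growing mode of a tridiagonal system\<close>

text \<open>With q n = (l + d n) / \<mu> n this solves the adjoint recursion outwards from \<psi> 0
  = 0, normalised by \<psi> 1 = 1. The rate \<open>l\<close> is left free, to be fixed by the
  behaviour at infinity.\<close>

fun shoot :: "(nat \<Rightarrow> real) \<Rightarrow> nat \<Rightarrow> real" where
  "shoot q 0 = 0"
| "shoot q (Suc 0) = 1"
| "shoot q (Suc (Suc n)) = q (Suc n) * shoot q (Suc n) - shoot q n"

text \<open>The growth rate is the least one for which the solution of the recursion stays positive; at that
  rate the solution must decay, since growth in the far field would persist for smaller rates.\<close>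

lemma growing_mode:
  fixes \<mu> d :: "nat \<Rightarrow> real"
  assumes \<mu>: "\<And>n. 1 \<le> n \<Longrightarrow> 0 < \<mu> n" "\<And>n. 1 \<le> n \<Longrightarrow> \<mu> n \<le> B" and d: "\<And>n. 1 \<le> n \<Longrightarrow> 0 \<le> d n"
    and L: "0 < L" "L + d 1 \<le> \<mu> 1" "L + d 2 \<le> \<mu> 2"
    and n1: "\<And>n. N \<le> n \<Longrightarrow> 6 * \<mu> n \<le> L"
  obtains l \<psi> where "L \<le> l" "\<psi> 0 = 0" "\<And>n. 1 \<le> n \<Longrightarrow> 0 < \<psi> n"
    "\<And>n. 1 \<le> n \<Longrightarrow> (l + d n) * \<psi> n = \<mu> n * (\<psi> (n + 1) + \<psi> (n - 1))"
    "\<And>n. N \<le> n \<Longrightarrow> 1 \<le> n \<Longrightarrow> \<psi> (n + 1) \<le> \<psi> n / 2"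
proof -
  define P where "P l n = shoot (\<lambda>n. (l + d n) / \<mu> n) n" for l n
  have P0: "P l 0 = 0" and P1: "P l (Suc 0) = 1"
    and PS: "P l (Suc (Suc n)) = (l + d (Suc n)) / \<mu> (Suc n) * P l (Suc n) - P l n" for l n
    by (simp_all add: P_def)
  have Pc: "isCont (\<lambda>l. P l n) l" for n l
  proof (induction n rule: less_induct)
    case (less n)
    show ?case
    proof (cases n)
      case 0 then show ?thesis by (simp add: P0)
    next
      case (Suc m)
      show ?thesis
      proof (cases m)
        case 0 then show ?thesis using Suc by (simp add: P1)
      next
        case (Suc m')
        then have c: "isCont (\<lambda>l. P l (Suc m')) l" "isCont (\<lambda>l. P l m') l" using \<open>n = Suc m\<close> less by auto
        have "\<mu> (Suc m') \<noteq> 0" using \<mu>(1)[of "Suc m'"] by simp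
        then have "isCont (\<lambda>l. (l + d (Suc m')) / \<mu> (Suc m') * P l (Suc m') - P l m') l"
          by (intro continuous_intros c) auto
        then show ?thesis using \<open>n = Suc m\<close> Suc by (simp add: PS)
      qed
    qed
  qed
  define S where "S = {l. 0 < l \<and> (\<forall>n. 0 < P l (Suc n))}"
  \<comment> \<open>Positivity of the third value already forces (l + d 1) (l + d 2) > \<mu> 1 \<mu>
    2, which fails below \<open>L\<close>. This is the reason for the hypotheses on the first two
    couplings.\<close>
  have S_L: "L \<le> l" if "l \<in> S" for l
  proof (rule ccontr)
    assume "\<not> L \<le> l"
    then have "l + d 1 \<le> \<mu> 1" "l + d 2 < \<mu> 2" using L by auto
    moreover have "0 < l + d 1" "0 < l + d 2" using that d[of 1] d[of 2] by (auto simp: S_def)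
    ultimately have "(l + d 1) * (l + d 2) < \<mu> 1 * \<mu> 2" by (intro mult_le_less_imp_less) auto
    moreover have "P l (Suc (Suc (Suc 0))) = ((l + d 1) * (l + d 2)) / (\<mu> 1 * \<mu> 2) - 1"
      by (simp add: PS P1 P0 numeral_2_eq_2 mult.commute)
    moreover have "0 < \<mu> 1 * \<mu> 2" using \<mu>(1)[of 1] \<mu>(1)[of 2] by simp
    ultimately have "P l (Suc (Suc (Suc 0))) < 0" by simp
    then show False using that by (auto simp: S_def dest: less_asym)
  qed
  \<comment> \<open>At this rate all quotients are at least 2, so the solution never
    decreases.\<close>
  have "2 * \<bar>B\<bar> + 1 \<in> S"
  proof -
    let ?l = "2 * \<bar>B\<bar> + 1"
    have "P ?l n \<le> P ?l (Suc n) \<and> 0 < P ?l (Suc n)" for n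
    proof (induction n)
      case 0 show ?case by (simp add: P0 P1)
    next
      case (Suc n)
      have "2 * \<mu> (Suc n) \<le> ?l + d (Suc n)" using \<mu>(2)[of "Suc n"] d[of "Suc n"] by simp
      then have "2 \<le> (?l + d (Suc n)) / \<mu> (Suc n)" using \<mu>(1)[of "Suc n"] by (simp add: pos_le_divide_eq)
      then have "2 * P ?l (Suc n) \<le> (?l + d (Suc n)) / \<mu> (Suc n) * P ?l (Suc n)" using Suc by (intro mult_right_mono) auto
      then show ?case using Suc unfolding PS by linarith
    qed
    then show ?thesis by (simp add: S_def)
  qed
  then have S: "S \<noteq> {}" by blast
  have bdd: "bdd_below S" using S_L by (rule bdd_belowI)
  define l where "l = Inf S"
  have lL: "L \<le> l" unfolding l_def using S S_L by (rule cInf_greatest)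
  have l_least: "l \<le> x" if "x \<in> S" for x unfolding l_def using that bdd by (rule cInf_lower)
  \<comment> \<open>\<open>S\<close> contains rates arbitrarily close to its infimum; a negative
    value at the infimum would persist there by continuity.\<close>
  have nonneg: "0 \<le> P l n" for n
  proof (rule ccontr)
    assume n: "\<not> 0 \<le> P l n"
    then have "eventually (\<lambda>x. P x n < 0) (at l)"
      using Pc[where n = n and l = l] by (intro order_tendstoD(2)) (auto simp: isCont_def)
    then obtain e where e: "0 < e" "\<And>x. x \<noteq> l \<Longrightarrow> dist x l < e \<Longrightarrow> P x n < 0" unfolding eventually_at by auto
    obtain x where x: "x \<in> S" "x < l + e" using cInf_lessD[OF S, of "l + e"] e(1) l_def by auto
    have "l \<le> x" using l_least x by simp
    then have "P x n < 0" using e(2)[of x] n x(2) by (cases "x = l") (auto simp: dist_real_def)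
    then show False using x(1) P0 unfolding S_def by (cases n) (auto dest: less_asym)
  qed
  \<comment> \<open>A zero after a positive value would be followed by a negative one, since the
    recursion then only flips the sign of the value before the zero.\<close>
  have pos: "0 < P l (Suc n)" for n
  proof (induction n)
    case 0 show ?case by (simp add: P1)
  next
    case (Suc n)
    have "P l (Suc (Suc n)) \<noteq> 0"
    proof
      assume z: "P l (Suc (Suc n)) = 0"
      have "P l (Suc (Suc (Suc n))) = - P l (Suc n)" by (subst PS) (simp add: z)
      then show False using Suc nonneg[of "Suc (Suc (Suc n))"] by simp
    qed
    then show ?case using nonneg[of "Suc (Suc n)"] by simp
  qed
  \<comment> \<open>If the halving fails at one far index, a slightly smaller rate keeps all values
    up to there positive and keeps the failure. In the far field the failure reproduces itself
    together with positivity, so the smaller rate lies in \<open>S\<close>, against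
    minimality.\<close>
  have decay: "P l (n + 1) \<le> P l n / 2" if n: "N \<le> n" "1 \<le> n" for n
  proof (rule ccontr)
    assume "\<not> ?thesis"
    then have gt: "P l n < 2 * P l (Suc n)" by simp
    have tend: "((\<lambda>x. P x m) \<longlongrightarrow> P l m) (at_left l)" for m
      using Pc[where n = m and l = l] by (auto simp: isCont_def intro: filterlim_mono[OF _ order_refl at_le])
    have "eventually (\<lambda>x. \<forall>m\<in>{..n}. 0 < P x (Suc m)) (at_left l)"
      using pos by (intro eventually_ball_finite ballI order_tendstoD(1)[OF tend]) auto
    moreover have "eventually (\<lambda>x. 0 < 2 * P x (Suc n) - P x n) (at_left l)"
      using gt by (intro order_tendstoD(1)[of _ "2 * P l (Suc n) - P l n"] tendsto_intros tend) auto
    moreover have "eventually (\<lambda>x. 5 / 6 * l < x) (at_left l)"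
      using L(1) lL by (intro order_tendstoD(1)[of _ l] tendsto_ident_at) auto
    moreover have "eventually (\<lambda>x. x < l) (at_left l)"
      by (simp add: eventually_at_filter)
    ultimately have "eventually (\<lambda>x. (\<forall>m\<in>{..n}. 0 < P x (Suc m)) \<and> 0 < 2 * P x (Suc n) - P x n \<and> 5 / 6 * l < x \<and> x < l) (at_left l)"
      by eventually_elim auto
    then obtain x where x: "\<And>m. m \<le> n \<Longrightarrow> 0 < P x (Suc m)" "P x n < 2 * P x (Suc n)" "5 / 6 * l < x" "x < l"
      using eventually_happens'[OF trivial_limit_at_left_real] by fastforce
    have far: "P x m < 2 * P x (Suc m) \<and> 0 < P x (Suc m)" if "n \<le> m" for m
      using that
    proof (induction m rule: dec_induct)
      case base show ?case using x by simp
    next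
      case (step m)
      have "6 * \<mu> (Suc m) \<le> L" using n1[of "Suc m"] n step by simp
      \<comment> \<open>Room for lowering the rate: 6 \<mu> \<le> L \<le> l and x > 5/6 l leave a
        quotient of at least 5. Subtracting a previous value below twice the current one then leaves
        more than three times the current value.\<close>
      then have "5 * \<mu> (Suc m) \<le> x + d (Suc m)" using x(3) lL d[of "Suc m"] by simp
      then have "5 \<le> (x + d (Suc m)) / \<mu> (Suc m)" using \<mu>(1)[of "Suc m"] by (simp add: pos_le_divide_eq)
      then have "5 * P x (Suc m) \<le> (x + d (Suc m)) / \<mu> (Suc m) * P x (Suc m)"
        using step by (intro mult_right_mono) auto
      then have "5 * P x (Suc m) \<le> P x (Suc (Suc m)) + P x m" by (simp add: PS)
      moreover have "P x m < 2 * P x (Suc m)" "0 < P x (Suc m)" using step.IH by auto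
      ultimately show ?case by linarith
    qed
    have "0 < P x (Suc m)" for m using x(1)[of m] far[of m] by (cases "m \<le> n") auto
    moreover have "0 < x" using x(3) lL L(1) by simp
    ultimately have "x \<in> S" by (simp add: S_def)
    then show False using l_least x(4) by force
  qed
  show ?thesis
  proof (rule that[of l "P l"])
    show "0 < P l n" if "1 \<le> n" for n using pos[of "n - 1"] that by simp
    show "(l + d n) * P l n = \<mu> n * (P l (n + 1) + P l (n - 1))" if "1 \<le> n" for n
    proof -
      obtain m where m: "n = Suc m" using \<open>1 \<le> n\<close> by (cases n) auto
      then show ?thesis using \<mu>(1)[OF \<open>1 \<le> n\<close>] by (simp add: PS)
    qed
  qed (use lL P0 decay in auto)
qed

section \<open>A lower Gronwall inequality\<close>

text \<open>\<open>G\<close> is merely integrable and the inequality holds only almost everywhere,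
  so \<open>F\<close> cannot be differentiated. The integrating factor is applied one level higher,
  to the primitive of the continuous representative of \<open>F\<close>.\<close>

lemma Gronwall_lower:
  fixes F G :: "real \<Rightarrow> real"
  assumes l: "0 < l" and t: "0 < t" "t < T"
    and G: "\<And>s. s \<in> {0<..<T} \<Longrightarrow> integrable (lebesgue_on {0<..<s}) G"
    and F: "\<And>s. s \<in> {0<..<T} \<Longrightarrow> F s = F0 + (LINT \<tau>|lebesgue_on {0<..<s}. G \<tau>)"
    and ge: "AE \<tau> in lebesgue_on {0<..<T}. l * F \<tau> - \<rho> \<le> G \<tau>"
  shows "(F0 - \<rho> / l) * exp (l * t) + \<rho> / l \<le> F t"
proof -
  have conv: "(LINT \<tau>|lebesgue_on {0<..<s}. f \<tau>) = integral {0..s} f" "f integrable_on {0..s}"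
    if "integrable (lebesgue_on {0<..<s}) f" for s and f :: "real \<Rightarrow> real"
  proof -
    show "(LINT \<tau>|lebesgue_on {0<..<s}. f \<tau>) = integral {0..s} f"
      using lebesgue_integral_eq_integral[OF that] by (simp add: integral_open_interval_real)
    show "f integrable_on {0..s}"
      using integrable_on_lebesgue_on[OF that] by (simp add: integrable_on_open_interval_real)
  qed
  define E where "E s = F0 + integral {0..s} G" for s
  have EF: "E s = F s" if "s \<in> {0<..<T}" for s
    using conv(1)[OF G[OF that]] F[OF that] by (simp add: E_def)
  have Gi: "G integrable_on {0..t}" by (rule conv(2)[OF G]) (use t in auto)
  have Ec: "continuous_on {0..t} E"
    unfolding E_def by (intro continuous_intros indefinite_integral_continuous_1 Gi)
  define I where "I s = integral {0..s} E" for s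
  have I': "(I has_real_derivative E s) (at s within {0..t})" if "s \<in> {0..t}" for s
    unfolding I_def using integral_has_real_derivative[OF Ec that] .
  have lower: "F0 + l * I s - \<rho> * s \<le> E s" if s: "s \<in> {0..t}" for s
  proof (cases "s = 0")
    case True then show ?thesis by (simp add: E_def I_def)
  next
    case False
    then have s0: "0 < s" "s \<le> t" "s \<in> {0<..<T}" using s t by auto
    have "integrable (lebesgue_on {0..s}) (\<lambda>\<tau>. l * E \<tau> - \<rho>)"
      by (intro continuous_imp_integrable_real continuous_intros continuous_on_subset[OF Ec]) (use s0 in auto)
    then have "set_integrable lebesgue {0..s} (\<lambda>\<tau>. l * E \<tau> - \<rho>)"
      by (simp add: integrable_restrict_space set_integrable_def)
    then have "set_integrable lebesgue {0<..<s} (\<lambda>\<tau>. l * E \<tau> - \<rho>)"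
      by (rule set_integrable_subset) auto
    then have i: "integrable (lebesgue_on {0<..<s}) (\<lambda>\<tau>. l * E \<tau> - \<rho>)"
      by (simp add: integrable_restrict_space set_integrable_def)
    have Ei: "E integrable_on {0..s}"
      by (rule integrable_continuous_interval[OF continuous_on_subset[OF Ec]]) (use s0 in auto)
    have "F0 + l * I s - \<rho> * s = F0 + integral {0..s} (\<lambda>\<tau>. l * E \<tau> - \<rho>)"
    proof -
      have "integral {0..s} (\<lambda>\<tau>. l * E \<tau> - \<rho>) = integral {0..s} (\<lambda>\<tau>. l * E \<tau>) - integral {0..s} (\<lambda>\<tau>. \<rho>)"
        by (intro Henstock_Kurzweil_Integration.integral_diff integrable_on_mult_right Ei integrable_const_ivl)
      then show ?thesis using s0 by (simp add: I_def mult.commute)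
    qed
    also have "\<dots> = F0 + (LINT \<tau>|lebesgue_on {0<..<s}. l * E \<tau> - \<rho>)" using conv(1)[OF i] by simp
    also have "\<dots> \<le> F0 + (LINT \<tau>|lebesgue_on {0<..<s}. G \<tau>)"
    proof (intro add_left_mono integral_mono_AE i G s0)
      have "AE \<tau> in lebesgue. \<tau> \<in> {0<..<T} \<longrightarrow> l * F \<tau> - \<rho> \<le> G \<tau>"
        using ge by (subst (asm) AE_restrict_space_iff) auto
      then have "AE \<tau> in lebesgue. \<tau> \<in> {0<..<s} \<longrightarrow> l * E \<tau> - \<rho> \<le> G \<tau>"
        by eventually_elim (use s0 EF in auto)
      then show "AE \<tau> in lebesgue_on {0<..<s}. l * E \<tau> - \<rho> \<le> G \<tau>"
        by (subst AE_restrict_space_iff) auto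
    qed
    also have "\<dots> = E s" using F[OF s0(3)] EF[OF s0(3)] by simp
    finally show ?thesis .
  qed
  \<comment> \<open>\<open>lower\<close> bounds \<open>E\<close> from below by a differentiable
    function. \<open>Y\<close> is that function minus the equilibrium \<rho> / l, times exp (- l s),
    and its derivative is l exp (- l s) times the nonnegative gap in \<open>lower\<close>.\<close>
  define Y where "Y s = exp (- l * s) * (F0 + l * I s - \<rho> * s - \<rho> / l)" for s
  have "Y 0 \<le> Y t"
  proof (rule DERIV_nonneg_imp_increasing_open[OF less_imp_le[OF t(1)]])
    fix s assume s: "0 < s" "s < t"
    have "(I has_real_derivative E s) (at s)"
      using I'[of s] s by (simp add: at_within_Icc_at)
    then have "(Y has_real_derivative exp (- l * s) * (l * (E s - (F0 + l * I s - \<rho> * s)))) (at s)"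
      unfolding Y_def using l by (auto intro!: derivative_eq_intros simp: field_simps)
    moreover have "0 \<le> exp (- l * s) * (l * (E s - (F0 + l * I s - \<rho> * s)))"
      using lower[of s] s l by (intro mult_nonneg_nonneg) auto
    ultimately show "\<exists>y. (Y has_real_derivative y) (at s) \<and> 0 \<le> y" by blast
  next
    have "continuous_on {0..t} I" using I' by (meson DERIV_continuous_on)
    then show "continuous_on {0..t} Y" unfolding Y_def by (intro continuous_intros)
  qed
  then have "F0 - \<rho> / l \<le> exp (- l * t) * (F0 + l * I t - \<rho> * t - \<rho> / l)"
    by (simp add: Y_def I_def)
  also have "\<dots> \<le> exp (- l * t) * (E t - \<rho> / l)" using lower[of t] t by (intro mult_left_mono) auto
  finally have "(F0 - \<rho> / l) * exp (l * t) \<le> exp (- l * t) * (E t - \<rho> / l) * exp (l * t)"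
    by (rule mult_right_mono) simp
  also have "\<dots> = E t - \<rho> / l" by (simp add: exp_minus)
  finally show ?thesis using EF[of t] t by simp
qed

section \<open>The velocity symbols\<close>

definition MG_symbol :: "real \<Rightarrow> real \<Rightarrow> real \<Rightarrow> 3 \<Rightarrow> int^3 \<Rightarrow> real" where
  "MG_symbol \<Omega> \<beta> \<eta> i = (if i = 1 then MG_symbol1 \<Omega> \<beta> \<eta> else if i = 2 then MG_symbol2 \<Omega> \<beta> \<eta> else MG_symbol3 \<Omega> \<beta> \<eta>)"

lemma MG_symbol_simps:
  "MG_symbol \<Omega> \<beta> \<eta> 1 = MG_symbol1 \<Omega> \<beta> \<eta>" "MG_symbol \<Omega> \<beta> \<eta> 2 = MG_symbol2 \<Omega> \<beta> \<eta>"
  "MG_symbol \<Omega> \<beta> \<eta> 3 = MG_symbol3 \<Omega> \<beta> \<eta>"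
  by (simp_all add: MG_symbol_def)

lemma MG_velocity_nth: "MG_velocity \<Omega> \<beta> \<eta> \<theta> x $ i = multiplier_op (MG_symbol \<Omega> \<beta> \<eta> i) \<theta> x"
  using exhaust_3[of i] by (auto simp: MG_velocity_def MG_symbol_simps)

lemma MG_symbol_minus: "MG_symbol \<Omega> \<beta> \<eta> i (- k) = MG_symbol \<Omega> \<beta> \<eta> i k"
  using exhaust_3[of i]
  by (auto simp: MG_symbol_simps MG_symbol1_def MG_symbol2_def MG_symbol3_def MG_denom_def freq_sq_minus)

text \<open>Here a, b and r stand for the absolute values of the third and second component and of the
  whole frequency.\<close>

lemma MG_quotient_bound:
  fixes a b c r y w D N :: real
  assumes w: "0 < w" and c: "0 < c" and a: "1 \<le> a" and r: "1 \<le> r" and y: "\<bar>y\<bar> \<le> r"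
    and D: "D = 4 * w\<^sup>2 * a\<^sup>2 * r\<^sup>2 + c\<^sup>2 * b ^ 4" and b: "0 \<le> b"
    and N: "\<bar>N\<bar> \<le> 2 * w * \<bar>y\<bar> * a * r\<^sup>2 + c * r\<^sup>2 * b\<^sup>2 * a"
  shows "(N / D)\<^sup>2 \<le> (1 / w\<^sup>2) * r\<^sup>2"
proof -
  have "0 < 4 * w\<^sup>2 * a\<^sup>2 * r\<^sup>2" using w a r by simp
  then have Dp: "0 < D" unfolding D by (intro add_pos_nonneg) simp_all
  \<comment> \<open>The first part of the numerator is compared with the first part of
    \<open>D\<close>; a \<ge> 1 supplies the missing factor \<open>a\<close>.\<close>
  have "2 * w * \<bar>y\<bar> * a * r\<^sup>2 \<le> 2 * w * r * (a * a) * r\<^sup>2"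
    using w a r y by (intro mult_mono mult_nonneg_nonneg) auto
  also have "\<dots> = r / (2 * w) * (4 * w\<^sup>2 * a\<^sup>2 * r\<^sup>2)" using w by (simp add: field_simps power2_eq_square)
  also have "\<dots> \<le> r / (2 * w) * D" using w r unfolding D by (intro mult_left_mono) auto
  finally have 1: "2 * w * \<bar>y\<bar> * a * r\<^sup>2 \<le> r / (2 * w) * D" .
  \<comment> \<open>The second part lies between the two terms of \<open>D\<close>: the inequality 2
    u v \<le> u^2 + v^2 for their square roots. Each part receives half of r / w.\<close>
  have "2 * (2 * w * a * r) * (c * b\<^sup>2) \<le> (2 * w * a * r)\<^sup>2 + (c * b\<^sup>2)\<^sup>2" by (rule sum_squares_bound)
  also have "\<dots> = D" unfolding D by (simp add: power_mult_distrib flip: power_mult)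
  finally have "r / (2 * w) * (2 * (2 * w * a * r) * (c * b\<^sup>2)) \<le> r / (2 * w) * D"
    using w r by (intro mult_left_mono) auto
  moreover have "r / (2 * w) * (2 * (2 * w * a * r) * (c * b\<^sup>2)) = 2 * (c * r\<^sup>2 * b\<^sup>2 * a)"
    using w by (simp add: field_simps power2_eq_square)
  moreover have "0 \<le> c * r\<^sup>2 * b\<^sup>2 * a" using c a by simp
  ultimately have 2: "c * r\<^sup>2 * b\<^sup>2 * a \<le> r / (2 * w) * D" by linarith
  have "\<bar>N\<bar> \<le> r / w * D" using N 1 2 by (simp add: field_simps)
  then have "\<bar>N / D\<bar> \<le> r / w" using Dp by (simp only: abs_divide abs_of_pos pos_divide_le_eq)
  then have "\<bar>N / D\<bar>\<^sup>2 \<le> (r / w)\<^sup>2" by (rule power_mono) simp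
  then show ?thesis by (simp add: power_divide)
qed

text \<open>All three symbols have order at most one despite the degenerate denominator, so the
  velocity of a function with square-integrable gradient is square integrable.\<close>

lemma MG_symbol_bound:
  assumes "0 < \<Omega>" "0 < \<beta>" "0 < \<eta>"
  shows "(MG_symbol \<Omega> \<beta> \<eta> i k)\<^sup>2 \<le> (1 / \<Omega>\<^sup>2) * (1 + freq_sq k)"
proof (cases "k $ 3 = 0")
  case True
  then have "MG_symbol \<Omega> \<beta> \<eta> i k = 0"
    using exhaust_3[of i] by (auto simp: MG_symbol_simps MG_symbol1_def MG_symbol2_def MG_symbol3_def)
  then show ?thesis using freq_sq_nonneg[of k] by simp
next
  case False
  define x y z c r where "x = real_of_int (k $ 1)" "y = real_of_int (k $ 2)" "z = real_of_int (k $ 3)"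
    "c = \<beta>\<^sup>2 / \<eta>" "r = sqrt (freq_sq k)"
  note defs = this
  have c: "0 < c" using assms by (simp add: defs)
  have q: "freq_sq k = x\<^sup>2 + y\<^sup>2 + z\<^sup>2" by (simp add: freq_sq_def sum_3 defs)
  have rq: "r\<^sup>2 = freq_sq k" by (simp add: defs freq_sq_nonneg)
  have z: "1 \<le> \<bar>z\<bar>" using False unfolding defs by linarith
  have comp: "\<bar>real_of_int (k $ i)\<bar> \<le> r" for i
  proof -
    have "(real_of_int (k $ i))\<^sup>2 \<le> freq_sq k" unfolding freq_sq_def by (rule member_le_sum) auto
    then show ?thesis unfolding defs by (rule real_le_rsqrt[of "\<bar>real_of_int (k $ i)\<bar>", simplified])
  qed
  then have xr: "\<bar>x\<bar> \<le> r" and yr: "\<bar>y\<bar> \<le> r" and zr: "\<bar>z\<bar> \<le> r" unfolding defs by auto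
  have r1: "1 \<le> r" using z zr by linarith
  have D: "MG_denom \<Omega> \<beta> \<eta> k = 4 * \<Omega>\<^sup>2 * \<bar>z\<bar>\<^sup>2 * r\<^sup>2 + c\<^sup>2 * \<bar>y\<bar> ^ 4"
    unfolding MG_denom_def rq by (simp add: defs)
  have t: "c * \<bar>u\<bar> * \<bar>y\<bar>\<^sup>2 * \<bar>z\<bar> \<le> c * r\<^sup>2 * \<bar>y\<bar>\<^sup>2 * \<bar>z\<bar>" if "\<bar>u\<bar> \<le> r" for u
  proof -
    have "r * 1 \<le> r * r" using r1 by (intro mult_left_mono) auto
    then have "\<bar>u\<bar> \<le> r\<^sup>2" using that by (simp add: power2_eq_square)
    then show ?thesis using c by (intro mult_right_mono mult_left_mono) auto
  qed
  have "(MG_symbol \<Omega> \<beta> \<eta> i k)\<^sup>2 \<le> (1 / \<Omega>\<^sup>2) * r\<^sup>2"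
  proof -
    consider "i = 1" | "i = 2" | "i = 3" using exhaust_3 by blast
    then show ?thesis
    proof cases
      case 1
      have e: "MG_symbol \<Omega> \<beta> \<eta> i k = (2 * \<Omega> * y * z * r\<^sup>2 - c * x * y\<^sup>2 * z) / MG_denom \<Omega> \<beta> \<eta> k"
        using 1 False unfolding rq by (simp add: MG_symbol_simps MG_symbol1_def defs)
      have "\<bar>2 * \<Omega> * y * z * r\<^sup>2 - c * x * y\<^sup>2 * z\<bar> \<le> \<bar>2 * \<Omega> * y * z * r\<^sup>2\<bar> + \<bar>c * x * y\<^sup>2 * z\<bar>"
        by (rule abs_triangle_ineq4)
      also have "\<dots> = 2 * \<Omega> * \<bar>y\<bar> * \<bar>z\<bar> * r\<^sup>2 + c * \<bar>x\<bar> * \<bar>y\<bar>\<^sup>2 * \<bar>z\<bar>"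
        using assms c by (simp add: abs_mult)
      also have "\<dots> \<le> 2 * \<Omega> * \<bar>y\<bar> * \<bar>z\<bar> * r\<^sup>2 + c * r\<^sup>2 * \<bar>y\<bar>\<^sup>2 * \<bar>z\<bar>"
        by (intro add_left_mono t xr)
      finally show ?thesis unfolding e
        by (intro MG_quotient_bound[OF assms(1) c z r1 yr D abs_ge_zero])
    next
      case 2
      have e: "MG_symbol \<Omega> \<beta> \<eta> i k = (- 2 * \<Omega> * x * z * r\<^sup>2 - c * y ^ 3 * z) / MG_denom \<Omega> \<beta> \<eta> k"
        using 2 False unfolding rq by (simp add: MG_symbol_simps MG_symbol2_def defs)
      have "\<bar>- 2 * \<Omega> * x * z * r\<^sup>2 - c * y ^ 3 * z\<bar> \<le> \<bar>- 2 * \<Omega> * x * z * r\<^sup>2\<bar> + \<bar>c * y ^ 3 * z\<bar>"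
        by (rule abs_triangle_ineq4)
      also have "\<dots> = 2 * \<Omega> * \<bar>x\<bar> * \<bar>z\<bar> * r\<^sup>2 + c * \<bar>y\<bar> * \<bar>y\<bar>\<^sup>2 * \<bar>z\<bar>"
        using assms c by (simp add: abs_mult power3_eq_cube power2_eq_square)
      also have "\<dots> \<le> 2 * \<Omega> * \<bar>x\<bar> * \<bar>z\<bar> * r\<^sup>2 + c * r\<^sup>2 * \<bar>y\<bar>\<^sup>2 * \<bar>z\<bar>"
        by (intro add_left_mono t yr)
      finally show ?thesis unfolding e
        by (intro MG_quotient_bound[OF assms(1) c z r1 xr D abs_ge_zero])
    next
      \<comment> \<open>The third numerator has no factor \<open>z\<close>; as a nonzero integer,
        \<open>z\<close> satisfies |z| \<ge> 1 and may be inserted to reach the common form.\<close>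
      case 3
      have e: "MG_symbol \<Omega> \<beta> \<eta> i k = (c * y\<^sup>2 * (x\<^sup>2 + y\<^sup>2)) / MG_denom \<Omega> \<beta> \<eta> k"
        using 3 False by (simp add: MG_symbol_simps MG_symbol3_def defs)
      have "\<bar>c * y\<^sup>2 * (x\<^sup>2 + y\<^sup>2)\<bar> = c * (x\<^sup>2 + y\<^sup>2) * y\<^sup>2 * 1" using c by (simp add: abs_mult)
      also have "\<dots> \<le> c * r\<^sup>2 * \<bar>y\<bar>\<^sup>2 * \<bar>z\<bar>"
        using c z unfolding rq q power2_abs by (intro mult_mono mult_nonneg_nonneg) auto
      also have "\<dots> \<le> 2 * \<Omega> * \<bar>y\<bar> * \<bar>z\<bar> * r\<^sup>2 + c * r\<^sup>2 * \<bar>y\<bar>\<^sup>2 * \<bar>z\<bar>" using assms(1) by simp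
      finally show ?thesis unfolding e
        by (intro MG_quotient_bound[OF assms(1) c z r1 yr D abs_ge_zero])
    qed
  qed
  also have "\<dots> \<le> (1 / \<Omega>\<^sup>2) * (1 + freq_sq k)" unfolding rq by (intro mult_left_mono) auto
  finally show ?thesis .
qed

lemma MG_symbol_divergence_free: "(\<Sum>i\<in>UNIV. real_of_int (k $ i) * MG_symbol \<Omega> \<beta> \<eta> i k) = 0"
proof (cases "k $ 3 = 0")
  case False
  define x y z c q D where "x = real_of_int (k $ 1)" "y = real_of_int (k $ 2)" "z = real_of_int (k $ 3)"
    "c = \<beta>\<^sup>2 / \<eta>" "q = freq_sq k" "D = MG_denom \<Omega> \<beta> \<eta> k"
  note defs = this
  have "(\<Sum>i\<in>UNIV. real_of_int (k $ i) * MG_symbol \<Omega> \<beta> \<eta> i k) =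
    x * ((2 * \<Omega> * y * z * q - c * x * y\<^sup>2 * z) / D) + y * ((- 2 * \<Omega> * x * z * q - c * y ^ 3 * z) / D)
      + z * ((c * y\<^sup>2 * (x\<^sup>2 + y\<^sup>2)) / D)"
    using False by (simp add: sum_3 MG_symbol_simps MG_symbol1_def MG_symbol2_def MG_symbol3_def defs)
  also have "\<dots> = (x * (2 * \<Omega> * y * z * q - c * x * y\<^sup>2 * z) + y * (- 2 * \<Omega> * x * z * q - c * y ^ 3 * z)
      + z * (c * y\<^sup>2 * (x\<^sup>2 + y\<^sup>2))) / D" by (simp add: add_divide_distrib)
  also have "x * (2 * \<Omega> * y * z * q - c * x * y\<^sup>2 * z) + y * (- 2 * \<Omega> * x * z * q - c * y ^ 3 * z)
      + z * (c * y\<^sup>2 * (x\<^sup>2 + y\<^sup>2)) = 0" by (simp add: algebra_simps power2_eq_square power3_eq_cube)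
  finally show ?thesis by simp
qed (simp add: sum_3 MG_symbol_simps MG_symbol1_def MG_symbol2_def MG_symbol3_def)

section \<open>The steady state\<close>

abbreviation e3 :: "int^3" where "e3 \<equiv> axis 3 1"

text \<open>This is - 2 sin x3. All velocity symbols vanish at its two frequencies.\<close>

definition steady :: "real^3 \<Rightarrow> real" where
  "steady x = 2 * wave e3 (pi / 2) x"

lemma continuous_steady [continuous_intros]: "continuous_on S steady"
  unfolding steady_def by (intro continuous_intros)

lemma sq_integrable_steady: "sq_integrable steady"
  by (intro sq_integrable_continuous continuous_intros)

lemma fourier_scale: "integrable torus f \<Longrightarrow> fourier (\<lambda>x. c * f x) k = c * fourier f k"
  using fourier_linear[of f f c 0] by simp

lemma MG_symbol_steady: "complex_of_real (MG_symbol \<Omega> \<beta> \<eta> i k) * fourier steady k = 0"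
proof (cases "k = e3 \<or> k = - e3")
  case True
  then have "k $ 1 = 0" "k $ 2 = 0" by (auto simp: axis_def)
  then have "MG_symbol \<Omega> \<beta> \<eta> i k = 0"
    using exhaust_3[of i] by (auto simp: MG_symbol_simps MG_symbol1_def MG_symbol2_def MG_symbol3_def)
  then show ?thesis by simp
next
  case False
  have "integrable torus (wave e3 (pi / 2))" by (intro integrable_torus_continuous continuous_intros)
  then have "fourier steady k = 0"
    using False fourier_wave_zero[of k e3 "pi / 2"] unfolding steady_def[abs_def] by (simp add: fourier_scale)
  then show ?thesis by simp
qed

section \<open>Dissipation and velocity of the steady state\<close>

lemma multiplier_op_cong:
  assumes "\<And>k. complex_of_real (m k) * fourier f k = complex_of_real (m k) * fourier g k"
  shows "multiplier_op m f = multiplier_op m g"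
  unfolding multiplier_op_def is_multiplier_image_def assms ..

lemma frac_laplacian_symbol_bound:
  assumes "0 < \<gamma>" "\<gamma> < 1 / 2"
  shows "(freq_sq k powr \<gamma>)\<^sup>2 \<le> 1 * (1 + freq_sq k)"
proof -
  have "(freq_sq k powr \<gamma>)\<^sup>2 = freq_sq k powr (2 * \<gamma>)"
    by (cases "freq_sq k = 0") (simp_all add: power2_eq_square flip: powr_add)
  also have "\<dots> \<le> (1 + freq_sq k) powr (2 * \<gamma>)" using assms freq_sq_nonneg[of k] by (intro powr_mono2) auto
  also have "\<dots> \<le> (1 + freq_sq k) powr 1" using assms freq_sq_nonneg[of k] by (intro powr_mono) auto
  finally show ?thesis using freq_sq_nonneg[of k] by simp
qed

lemma frac_laplacian_smooth:
  assumes \<gamma>: "0 < \<gamma>" "\<gamma> < 1 / 2" and \<phi>: "smooth_torus \<phi>"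
  shows "sq_integrable (frac_laplacian \<gamma> \<phi>)"
    "fourier (frac_laplacian \<gamma> \<phi>) k = complex_of_real (freq_sq k powr \<gamma>) * fourier \<phi> k"
  unfolding frac_laplacian_def
  by (rule multiplier_op_sobolev(1,2)[OF smooth_torus_gradient[OF \<phi>] _ frac_laplacian_symbol_bound[OF \<gamma>]];
      simp add: freq_sq_minus)+

text \<open>The frequencies of the steady state have length 1, so it is an eigenfunction with
  eigenvalue 1. This is why the source is \<kappa> times the steady state.\<close>

lemma integral_steady_frac_laplacian:
  assumes \<gamma>: "0 < \<gamma>" "\<gamma> < 1 / 2" and \<phi>: "smooth_torus \<phi>"
  shows "(LINT x|torus. steady x * frac_laplacian \<gamma> \<phi> x) = (LINT x|torus. steady x * \<phi> x)"
proof -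
  have q: "freq_sq e3 = 1" by (simp add: freq_sq_def axis_def sum_3)
  have "(LINT x|torus. frac_laplacian \<gamma> \<phi> x * wave e3 (pi / 2) x) = (LINT x|torus. \<phi> x * wave e3 (pi / 2) x)"
    using fourier_multiplier_coeff[where m = "\<lambda>k. freq_sq k powr \<gamma>",
        OF sq_integrable_imp_integrable sq_integrable_imp_integrable frac_laplacian_smooth(2)[OF \<gamma> \<phi>]]
      smooth_torus_gradient(1)[OF \<phi>] frac_laplacian_smooth(1)[OF \<gamma> \<phi>] by (simp add: q)
  then show ?thesis by (simp only: steady_def mult.commute[of "2 * _"] mult.left_commute[of _ 2] integral_mult_right_zero)
qed

lemma integral_frac_laplacian_wave:
  assumes \<gamma>: "0 < \<gamma>" "\<gamma> < 1 / 2" and f: "f \<in> borel_measurable torus"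
  shows "(LINT x|torus. f x * frac_laplacian \<gamma> (wave k 0) x) = freq_sq k powr \<gamma> * (LINT x|torus. f x * wave k 0 x)"
proof -
  let ?m = "\<lambda>k. freq_sq k powr \<gamma>"
  note s = frac_laplacian_smooth[OF \<gamma> smooth_torus_wave1[of k 0]]
  have wi: "integrable torus (wave k 0)" by (intro integrable_torus_continuous continuous_intros)
  have "AE x in torus. frac_laplacian \<gamma> (wave k 0) x = ?m k * wave k 0 x"
    by (rule fourier_unique)
      (use s sq_integrable_imp_integrable wi fourier_wave_multiplier[of ?m] in \<open>auto simp: fourier_scale freq_sq_minus\<close>)
  then have "(LINT x|torus. f x * frac_laplacian \<gamma> (wave k 0) x) = (LINT x|torus. f x * (?m k * wave k 0 x))"
    by (intro integral_cong_AE)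
      (use f s sq_integrable_measurable borel_measurable_integrable[OF wi] in \<open>auto elim: eventually_mono\<close>)
  then show ?thesis by (simp only: mult.left_commute[of _ "freq_sq k powr \<gamma>"] integral_mult_right_zero)
qed

text \<open>The zero function is an admissible image, hence the chosen image has zero coefficients
  as well; it is known to vanish only almost everywhere.\<close>

lemma MG_velocity_steady:
  "AE x in torus. MG_velocity \<Omega> \<beta> \<eta> steady x = 0"
proof -
  have "AE x in torus. multiplier_op (MG_symbol \<Omega> \<beta> \<eta> i) steady x = 0" for i
  proof -
    have z: "sq_integrable (\<lambda>_. 0)" by (rule sq_integrable_continuous) simp
    have z0: "fourier (\<lambda>_. 0) k = 0" for k by (simp add: fourier_def)
    let ?g = "multiplier_op (MG_symbol \<Omega> \<beta> \<eta> i) steady"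
    have "is_multiplier_image 2 (MG_symbol \<Omega> \<beta> \<eta> i) steady (\<lambda>_. 0)"
      using z by (simp add: is_multiplier_image_def in_Lp_2_iff z0 MG_symbol_steady)
    then have "is_multiplier_image 2 (MG_symbol \<Omega> \<beta> \<eta> i) steady ?g"
      unfolding multiplier_op_def by (rule someI[of "is_multiplier_image 2 (MG_symbol \<Omega> \<beta> \<eta> i) steady"])
    then show ?thesis
      by (intro fourier_zero_imp_zero) (auto simp: is_multiplier_image_def in_Lp_2_iff MG_symbol_steady sq_integrable_imp_integrable)
  qed
  then have "AE x in torus. \<forall>i. multiplier_op (MG_symbol \<Omega> \<beta> \<eta> i) steady x = 0"
    by (subst AE_all_countable) simp
  then show ?thesis by eventually_elim (simp add: vec_eq_iff MG_velocity_nth)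
qed

section \<open>The flux through a single mode\<close>

lemma grad_wave: "grad (wave k 0) x = (\<chi> i. of_int (k $ i) * wave k (pi / 2) x)"
  using partial_wave[of _ 1 k 0] by (simp add: grad_def)

lemma sq_int_mult_wave_le:
  assumes "sq_integrable f"
  shows "sq_integrable (\<lambda>x. f x * wave k \<theta> x)" "sq_int (\<lambda>x. f x * wave k \<theta> x) \<le> sq_int f"
proof -
  have le: "(f x * wave k \<theta> x)\<^sup>2 \<le> (f x)\<^sup>2" for x
    using abs_wave_le[of k \<theta> x] by (simp add: power_mult_distrib mult_left_le abs_square_le_1)
  have m: "(\<lambda>x. f x * wave k \<theta> x) \<in> borel_measurable torus"
    by (intro borel_measurable_times sq_integrable_measurable[OF assms] measurable_torus_continuous[OF continuous_wave])
  have fi: "integrable torus (\<lambda>x. (f x)\<^sup>2)" using assms by (simp add: sq_integrable_def)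
  have i: "integrable torus (\<lambda>x. (f x * wave k \<theta> x)\<^sup>2)"
    by (rule Bochner_Integration.integrable_bound[OF fi]) (use m le in auto)
  show "sq_integrable (\<lambda>x. f x * wave k \<theta> x)" using m i by (simp add: sq_integrable_def)
  show "sq_int (\<lambda>x. f x * wave k \<theta> x) \<le> sq_int f"
    unfolding sq_int_def by (rule integral_mono[OF i fi le])
qed

text \<open>The symbols vanish on the steady state, so the velocity of \<Theta> is the velocity of -
  v and has the size of \<open>v\<close>. Here \<open>v\<close> is the difference exactly as it
  appears in the Lipschitz estimate, steady state first.\<close>

lemma perturbation_velocity:
  assumes par: "0 < \<Omega>" "0 < \<beta>" "0 < \<eta>" and v: "v \<in> sp_carrier (sobolev_W 1 4)"
    and m: "\<Theta> \<in> borel_measurable torus" and ae: "AE x in torus. \<Theta> x = steady x - v x"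
  shows "sq_integrable \<Theta>" "sq_integrable v"
    "sq_int v \<le> 4 * sqrt ((2 * pi) ^ 3) * (sp_norm (sobolev_W 1 4) v)\<^sup>2"
    "sq_integrable (multiplier_op (MG_symbol \<Omega> \<beta> \<eta> i) \<Theta>)"
    "sq_int (multiplier_op (MG_symbol \<Omega> \<beta> \<eta> i) \<Theta>) \<le> (1 / \<Omega>\<^sup>2) * (4 * sqrt ((2 * pi) ^ 3) * (sp_norm (sobolev_W 1 4) v)\<^sup>2)"
    "fourier (multiplier_op (MG_symbol \<Omega> \<beta> \<eta> i) \<Theta>) k = complex_of_real (MG_symbol \<Omega> \<beta> \<eta> i k) * fourier \<Theta> k"
proof -
  obtain w where w: "sq_integrable v" "\<And>i. sq_integrable (w i)"
    "\<And>i k. fourier (w i) k = \<i> * of_int (k $ i) * fourier v k"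
    "sq_int v + (\<Sum>i\<in>UNIV. sq_int (w i)) \<le> 4 * sqrt ((2 * pi) ^ 3) * (sp_norm (sobolev_W 1 4) v)\<^sup>2"
    using W14_gradient[OF v] by blast
  let ?M = "MG_symbol \<Omega> \<beta> \<eta> i"
  have d: "sq_integrable (\<lambda>x. steady x - v x)"
    using sq_integrable_lincomb[OF sq_integrable_steady w(1), of 1 "-1"] by simp
  have "integrable torus (\<lambda>x. (\<Theta> x)\<^sup>2)"
    by (rule integrable_cong_AE_imp[of _ "\<lambda>x. (steady x - v x)\<^sup>2"])
      (use d m ae in \<open>auto simp: sq_integrable_def elim: eventually_mono\<close>)
  then show T: "sq_integrable \<Theta>" using m by (simp add: sq_integrable_def)
  show "sq_integrable v" by (rule w)
  have s0: "0 \<le> (\<Sum>i\<in>UNIV. sq_int (w i))" by (intro sum_nonneg sq_int_nonneg)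
  then show "sq_int v \<le> 4 * sqrt ((2 * pi) ^ 3) * (sp_norm (sobolev_W 1 4) v)\<^sup>2" using w(4) by linarith
  have neg: "sq_integrable (\<lambda>x. - f x)" "fourier (\<lambda>x. - f x) k = - fourier f k" "sq_int (\<lambda>x. - f x) = sq_int f"
    if "sq_integrable f" for f k
    using sq_integrable_lincomb[OF that that, of "-1" 0] fourier_scale[OF sq_integrable_imp_integrable[OF that], of "-1" k]
    by (simp_all add: sq_int_def)
  have "fourier \<Theta> k = fourier (\<lambda>x. 1 * steady x + (-1) * v x) k" for k
    by (rule fourier_cong_AE[OF _ m]) (use ae sq_integrable_measurable[OF d] in simp_all)
  then have F: "fourier \<Theta> k = fourier steady k - fourier v k" for k
    using fourier_linear[OF sq_integrable_imp_integrable[OF sq_integrable_steady] sq_integrable_imp_integrable[OF w(1)], of 1 "-1" k]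
    by simp
  have Mz: "complex_of_real (?M k) * fourier \<Theta> k = complex_of_real (?M k) * fourier (\<lambda>x. - v x) k" for k
    by (simp add: F right_diff_distrib MG_symbol_steady neg[OF w(1)])
  have eq: "multiplier_op ?M \<Theta> = multiplier_op ?M (\<lambda>x. - v x)"
    by (rule multiplier_op_cong[OF Mz])
  note op = multiplier_op_sobolev[of "\<lambda>x. - v x" "\<lambda>i x. - w i x" ?M "1 / \<Omega>\<^sup>2", OF neg(1)[OF w(1)] neg(1)[OF w(2)] _
      MG_symbol_minus MG_symbol_bound[OF par]]
  have fw: "fourier (\<lambda>x. - w i x) k = \<i> * of_int (k $ i) * fourier (\<lambda>x. - v x) k" for i k
    by (simp add: neg[OF w(1)] neg[OF w(2)] w(3))
  show "sq_integrable (multiplier_op ?M \<Theta>)" unfolding eq by (rule op(1)[OF fw]) simp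
  show "fourier (multiplier_op ?M \<Theta>) k = complex_of_real (?M k) * fourier \<Theta> k"
    unfolding Mz unfolding eq by (rule op(2)[OF fw]) simp
  have "sq_int (multiplier_op ?M \<Theta>) \<le> (1 / \<Omega>\<^sup>2) * (sq_int (\<lambda>x. - v x) + (\<Sum>i\<in>UNIV. sq_int (\<lambda>x. - w i x)))"
    unfolding eq by (rule op(3)[OF fw]) simp
  also have "\<dots> \<le> (1 / \<Omega>\<^sup>2) * (4 * sqrt ((2 * pi) ^ 3) * (sp_norm (sobolev_W 1 4) v)\<^sup>2)"
    using w(4) by (intro mult_left_mono) (simp_all add: neg[OF w(1)] neg[OF w(2)])
  finally show "sq_int (multiplier_op ?M \<Theta>) \<le> \<dots>" .
qed

text \<open>Origin of the tridiagonal coupling: multiplication by the steady state moves the third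
  frequency one step both ways and produces cosines only, so the cosine coefficients form a closed
  system.\<close>

lemma steady_mult_wave:
  "steady x * wave k (pi / 2) x = wave (k - e3) 0 x - wave (k + e3) 0 x"
proof -
  have "kdot e3 x + kdot k x + (pi / 2 + pi / 2) = (kdot k x + kdot e3 x) + pi" by simp
  then have 1: "wave (e3 + k) (pi / 2 + pi / 2) x = - wave (k + e3) 0 x"
    by (simp only: wave_def kdot_add cos_periodic_pi add_0_right)
  have 2: "wave (e3 - k) (pi / 2 - pi / 2) x = wave (k - e3) 0 x"
    using cos_minus[of "kdot k x - kdot e3 x"] by (simp add: wave_def kdot_diff)
  have "steady x * wave k (pi / 2) x = 2 * (wave e3 (pi / 2) x * wave k (pi / 2) x)" by (simp add: steady_def)
  also have "\<dots> = wave (k - e3) 0 x - wave (k + e3) 0 x" unfolding wave_mult 1 2 by simp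
  finally show ?thesis .
qed

text \<open>Splitting the transported factor into the steady state minus \<open>v\<close> gives a
  linear part with shifted frequencies and a part containing both \<open>v\<close> and its velocity.
  The latter is quadratic in the norm of \<open>v\<close> by Cauchy-Schwarz.\<close>

lemma mode_flux:
  assumes par: "0 < \<Omega>" "0 < \<beta>" "0 < \<eta>" and v: "v \<in> sp_carrier (sobolev_W 1 4)"
    and m: "\<Theta> \<in> borel_measurable torus" and ae: "AE x in torus. \<Theta> x = steady x - v x"
  shows "\<bar>(LINT x|torus. \<Theta> x * (MG_velocity \<Omega> \<beta> \<eta> \<Theta> x \<bullet> grad (wave k 0) x))
      - (MG_symbol3 \<Omega> \<beta> \<eta> (k + e3) * (LINT x|torus. \<Theta> x * wave (k + e3) 0 x)
        + MG_symbol3 \<Omega> \<beta> \<eta> (k - e3) * (LINT x|torus. \<Theta> x * wave (k - e3) 0 x))\<bar>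
    \<le> (\<Sum>i\<in>UNIV. \<bar>of_int (k $ i)\<bar>) * (4 * sqrt ((2 * pi) ^ 3) / \<Omega> * (sp_norm (sobolev_W 1 4) v)\<^sup>2)"
proof -
  note pv = perturbation_velocity[OF par v m ae]
  define U where "U i = multiplier_op (MG_symbol \<Omega> \<beta> \<eta> i) \<Theta>" for i
  define V where "V = 4 * sqrt ((2 * pi) ^ 3) * (sp_norm (sobolev_W 1 4) v)\<^sup>2"
  have V0: "0 \<le> V" by (simp add: V_def)
  have vV: "sq_int v \<le> V" using pv(3) by (simp add: V_def)
  have U: "sq_integrable (U i)" for i using pv(4) by (simp add: U_def)
  have UV: "sq_int (U i) \<le> (1 / \<Omega>\<^sup>2) * V" for i using pv(5) by (simp add: U_def V_def)
  let ?A = "\<lambda>k. LINT x|torus. \<Theta> x * wave k 0 x"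
  let ?M = "MG_symbol \<Omega> \<beta> \<eta>"
  have Uw: "(LINT x|torus. U i x * wave l 0 x) = ?M i l * ?A l" for i l
    unfolding U_def
    by (rule fourier_multiplier_coeff[OF sq_integrable_imp_integrable[OF pv(1)] sq_integrable_imp_integrable[OF pv(4)] pv(6)])
  let ?w = "wave k (pi / 2)"
  have vw: "sq_integrable (\<lambda>x. v x * ?w x)" by (rule sq_int_mult_wave_le(1)[OF pv(2)])
  have i1: "integrable torus (\<lambda>x. U i x * wave l 0 x)" for i l
    by (rule integrable_mult_wave[OF sq_integrable_imp_integrable[OF U]])
  have i2: "integrable torus (\<lambda>x. (v x * ?w x) * U i x)" for i
    by (rule sq_integrable_mult[OF vw U])
  define r where "r i = (LINT x|torus. (v x * ?w x) * U i x)" for i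
  have r: "\<bar>r i\<bar> \<le> V / \<Omega>" for i
  proof -
    have "\<bar>r i\<bar> \<le> sqrt (sq_int (\<lambda>x. v x * ?w x)) * sqrt (sq_int (U i))"
      unfolding r_def by (rule Cauchy_Schwarz_torus[OF vw U])
    also have "\<dots> \<le> sqrt V * sqrt ((1 / \<Omega>\<^sup>2) * V)"
      using sq_int_mult_wave_le(2)[OF pv(2), of k "pi / 2"] vV V0 UV
      by (intro mult_mono real_sqrt_le_mono) (auto simp: sq_int_nonneg)
    also have "\<dots> = V / \<Omega>" using par(1) V0 by (simp add: real_sqrt_divide real_sqrt_mult)
    finally show ?thesis .
  qed
  let ?k = "\<lambda>i. real_of_int (k $ i)"
  let ?f = "\<lambda>i x. ?k i * (U i x * wave (k - e3) 0 x - U i x * wave (k + e3) 0 x - (v x * ?w x) * U i x)"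
  have Um: "U i \<in> borel_measurable torus" for i by (rule sq_integrable_measurable[OF U])
  have "(LINT x|torus. \<Theta> x * (MG_velocity \<Omega> \<beta> \<eta> \<Theta> x \<bullet> grad (wave k 0) x)) = (LINT x|torus. (\<Sum>i\<in>UNIV. ?f i x))"
  proof (rule integral_cong_AE)
    have "(\<lambda>x. \<Theta> x * (\<Sum>i\<in>UNIV. U i x * (?k i * ?w x))) \<in> borel_measurable torus"
      by (intro borel_measurable_times borel_measurable_sum m Um measurable_torus_continuous continuous_intros)
    then show "(\<lambda>x. \<Theta> x * (MG_velocity \<Omega> \<beta> \<eta> \<Theta> x \<bullet> grad (wave k 0) x)) \<in> borel_measurable torus"
      by (simp add: inner_vec_def MG_velocity_nth grad_wave U_def)
    show "(\<lambda>x. \<Sum>i\<in>UNIV. ?f i x) \<in> borel_measurable torus"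
      using i1 i2 by (intro borel_measurable_integrable Bochner_Integration.integrable_sum integrable_mult_right
          Bochner_Integration.integrable_diff)
    show "AE x in torus. \<Theta> x * (MG_velocity \<Omega> \<beta> \<eta> \<Theta> x \<bullet> grad (wave k 0) x) = (\<Sum>i\<in>UNIV. ?f i x)"
      using ae
    proof eventually_elim
      case (elim x)
      have "\<Theta> x * (MG_velocity \<Omega> \<beta> \<eta> \<Theta> x \<bullet> grad (wave k 0) x) = (\<Sum>i\<in>UNIV. \<Theta> x * (U i x * (?k i * ?w x)))"
        by (simp add: inner_vec_def MG_velocity_nth grad_wave U_def sum_distrib_left)
      also have "\<dots> = (\<Sum>i\<in>UNIV. ?f i x)"
      proof (intro sum.cong refl)
        fix i
        have "\<Theta> x * (U i x * (?k i * ?w x)) = ?k i * (U i x * (steady x * ?w x) - (v x * ?w x) * U i x)"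
          by (simp add: elim algebra_simps)
        then show "\<Theta> x * (U i x * (?k i * ?w x)) = ?f i x" unfolding steady_mult_wave by (simp add: algebra_simps)
      qed
      finally show ?case .
    qed
  qed
  also have "\<dots> = (\<Sum>i\<in>UNIV. ?k i * (?M i (k - e3) * ?A (k - e3) - ?M i (k + e3) * ?A (k + e3) - r i))"
    unfolding r_def Uw[symmetric] using i1 i2 by simp
  also have "\<dots> = ?A (k - e3) * (\<Sum>i\<in>UNIV. ?k i * ?M i (k - e3)) - ?A (k + e3) * (\<Sum>i\<in>UNIV. ?k i * ?M i (k + e3)) - (\<Sum>i\<in>UNIV. ?k i * r i)"
    by (simp add: sum_3 algebra_simps)
  \<comment> \<open>Incompressibility at the shifted frequency, not at \<open>k\<close>, leaves only
    the third symbol. The opposite sign at k + e3 cancels the minus sign of the product formula, so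
    both couplings are positive.\<close>
  also have "(\<Sum>i\<in>UNIV. ?k i * ?M i (k - e3)) = ?M 3 (k - e3)"
    using MG_symbol_divergence_free[of "k - e3" \<Omega> \<beta> \<eta>] by (simp add: sum_3 axis_def algebra_simps)
  also have "(\<Sum>i\<in>UNIV. ?k i * ?M i (k + e3)) = - ?M 3 (k + e3)"
    using MG_symbol_divergence_free[of "k + e3" \<Omega> \<beta> \<eta>] by (simp add: sum_3 axis_def algebra_simps)
  finally have "(LINT x|torus. \<Theta> x * (MG_velocity \<Omega> \<beta> \<eta> \<Theta> x \<bullet> grad (wave k 0) x))
      - (MG_symbol3 \<Omega> \<beta> \<eta> (k + e3) * ?A (k + e3) + MG_symbol3 \<Omega> \<beta> \<eta> (k - e3) * ?A (k - e3)) = - (\<Sum>i\<in>UNIV. ?k i * r i)"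
    by (simp add: MG_symbol_simps algebra_simps)
  moreover have "\<bar>\<Sum>i\<in>UNIV. ?k i * r i\<bar> \<le> (\<Sum>i\<in>UNIV. \<bar>?k i\<bar> * (V / \<Omega>))"
    by (rule order_trans[OF sum_abs]) (intro sum_mono, simp only: abs_mult mult_left_mono[OF r abs_ge_zero])
  moreover have "(\<Sum>i\<in>UNIV. \<bar>?k i\<bar> * (V / \<Omega>)) = (\<Sum>i\<in>UNIV. \<bar>?k i\<bar>) * (4 * sqrt ((2 * pi) ^ 3) / \<Omega> * (sp_norm (sobolev_W 1 4) v)\<^sup>2)"
    unfolding sum_distrib_right V_def by simp
  ultimately show ?thesis by (simp only: abs_minus_cancel)
qed

section \<open>The unstable modes\<close>

text \<open>The anisotropic choice of the first component as the square of the second makes the third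
  symbol of order j squared for bounded n, while the dissipation is of order j to the power 4 gamma.\<close>

definition mode_freq :: "nat \<Rightarrow> nat \<Rightarrow> int^3" where
  "mode_freq j n = vector [int j ^ 2, int j, int n]"

lemma mode_freq_nth: "mode_freq j n $ 1 = int j ^ 2" "mode_freq j n $ 2 = int j" "mode_freq j n $ 3 = int n"
  by (simp_all add: mode_freq_def)

lemma mode_freq_add: "mode_freq j n + e3 = mode_freq j (Suc n)"
  and mode_freq_diff: "mode_freq j (Suc n) - e3 = mode_freq j n"
  by (simp_all add: vec_eq_iff forall_3 mode_freq_nth axis_def)

lemma freq_sq_mode: "freq_sq (mode_freq j n) = real j ^ 4 + real j ^ 2 + real n ^ 2"
  by (simp add: freq_sq_def sum_3 mode_freq_nth flip: power_mult)

lemma MG_symbol3_mode: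
  "MG_symbol3 \<Omega> \<beta> \<eta> (mode_freq j n) = (if n = 0 then 0 else
    ((\<beta>\<^sup>2 / \<eta>) * real j ^ 2 * (real j ^ 4 + real j ^ 2)) /
      (4 * \<Omega>\<^sup>2 * real n ^ 2 * (real j ^ 4 + real j ^ 2 + real n ^ 2) + (\<beta>\<^sup>2 / \<eta>)\<^sup>2 * real j ^ 4))"
  by (simp add: MG_symbol3_def MG_denom_def freq_sq_mode mode_freq_nth flip: power_mult)

text \<open>The upper bound keeps only the rotational term of the denominator and decays in
  \<open>n\<close>, as the far field of \<open>growing_mode\<close> requires. The lower bound is for
  n = 1, 2, the two couplings that drive the growth.\<close>

lemma MG_symbol3_mode_bounds:
  assumes par: "0 < \<Omega>" "0 < \<beta>" "0 < \<eta>" and j: "1 \<le> j" and n: "1 \<le> n"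
  shows "0 < MG_symbol3 \<Omega> \<beta> \<eta> (mode_freq j n)"
    and "MG_symbol3 \<Omega> \<beta> \<eta> (mode_freq j n) \<le> (\<beta>\<^sup>2 / \<eta>) / (4 * \<Omega>\<^sup>2) * real j ^ 2 / real n ^ 2"
    and "n \<le> 2 \<Longrightarrow> (\<beta>\<^sup>2 / \<eta>) / (96 * \<Omega>\<^sup>2 + (\<beta>\<^sup>2 / \<eta>)\<^sup>2) * real j ^ 2 \<le> MG_symbol3 \<Omega> \<beta> \<eta> (mode_freq j n)"
proof -
  define c x y D where "c = \<beta>\<^sup>2 / \<eta>" "x = real j" "y = real n"
    "D = 4 * \<Omega>\<^sup>2 * y ^ 2 * (x ^ 4 + x ^ 2 + y ^ 2) + c\<^sup>2 * x ^ 4"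
  note defs = this
  have c: "0 < c" and x: "1 \<le> x" and y: "1 \<le> y" using par j n by (auto simp: defs)
  have M: "MG_symbol3 \<Omega> \<beta> \<eta> (mode_freq j n) = (c * x\<^sup>2 * (x ^ 4 + x\<^sup>2)) / D"
    using n by (simp add: MG_symbol3_mode defs)
  have num: "0 < c * x\<^sup>2 * (x ^ 4 + x\<^sup>2)" using c x by (intro mult_pos_pos add_pos_pos) auto
  have w: "0 < 4 * \<Omega>\<^sup>2 * y\<^sup>2" using par y by simp
  have "0 < 4 * \<Omega>\<^sup>2 * y ^ 2 * (x ^ 4 + x ^ 2 + y ^ 2)" using w x by (intro mult_pos_pos add_pos_pos) auto
  then have D: "0 < D" unfolding defs by (rule add_pos_nonneg) simp
  show "0 < MG_symbol3 \<Omega> \<beta> \<eta> (mode_freq j n)" unfolding M using num D by simp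
  have "(4 * \<Omega>\<^sup>2 * y\<^sup>2) * (x ^ 4 + x\<^sup>2) \<le> (4 * \<Omega>\<^sup>2 * y\<^sup>2) * (x ^ 4 + x ^ 2 + y ^ 2)"
    using w by (intro mult_left_mono) auto
  also have "\<dots> \<le> D" unfolding defs by simp
  finally have "(c * x\<^sup>2) * ((4 * \<Omega>\<^sup>2 * y\<^sup>2) * (x ^ 4 + x\<^sup>2)) \<le> (c * x\<^sup>2) * D" using c by (intro mult_left_mono) auto
  then have "(c * x\<^sup>2 * (x ^ 4 + x\<^sup>2)) / D \<le> (c * x\<^sup>2) / (4 * \<Omega>\<^sup>2 * y\<^sup>2)"
    using D w by (simp add: divide_le_eq pos_le_divide_eq mult_ac)
  then show "MG_symbol3 \<Omega> \<beta> \<eta> (mode_freq j n) \<le> (\<beta>\<^sup>2 / \<eta>) / (4 * \<Omega>\<^sup>2) * real j ^ 2 / real n ^ 2"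
    unfolding M by (simp add: defs)
  \<comment> \<open>Here y^2 \<le> 4 and x^4 + x^2 + y^2 \<le> 6 x^4, so the constant 96 below is 4
    * 4 * 6.\<close>
  assume n2: "n \<le> 2"
  have x24: "x ^ 2 \<le> x ^ 4" using x by (intro power_increasing) auto
  have x4: "1 \<le> x ^ 4" using x by (rule one_le_power)
  have "y \<le> 2" using n2 unfolding defs by simp
  then have "y ^ 2 \<le> 2 ^ 2" using y by (intro power_mono) auto
  then have y2: "y ^ 2 \<le> 4" by simp
  have "4 * \<Omega>\<^sup>2 * y ^ 2 * (x ^ 4 + x ^ 2 + y ^ 2) \<le> 4 * \<Omega>\<^sup>2 * 4 * (6 * x ^ 4)"
    using x24 x4 y2 by (intro mult_mono mult_nonneg_nonneg) auto
  then have "D \<le> (96 * \<Omega>\<^sup>2 + c\<^sup>2) * x ^ 4" unfolding defs by (simp add: algebra_simps)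
  also have "\<dots> \<le> (96 * \<Omega>\<^sup>2 + c\<^sup>2) * (x ^ 4 + x\<^sup>2)" by (intro mult_left_mono) auto
  finally have "(c * x\<^sup>2) * D \<le> (c * x\<^sup>2) * ((96 * \<Omega>\<^sup>2 + c\<^sup>2) * (x ^ 4 + x\<^sup>2))"
    using c by (intro mult_left_mono) auto
  moreover have "0 < 96 * \<Omega>\<^sup>2 + c\<^sup>2" using par by (intro add_pos_nonneg) auto
  ultimately have "c / (96 * \<Omega>\<^sup>2 + c\<^sup>2) * x\<^sup>2 \<le> (c * x\<^sup>2 * (x ^ 4 + x\<^sup>2)) / D"
    using D by (simp add: divide_le_eq pos_le_divide_eq mult_ac)
  then show "(\<beta>\<^sup>2 / \<eta>) / (96 * \<Omega>\<^sup>2 + (\<beta>\<^sup>2 / \<eta>)\<^sup>2) * real j ^ 2 \<le> MG_symbol3 \<Omega> \<beta> \<eta> (mode_freq j n)"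
    unfolding M by (simp add: defs)
qed

text \<open>The condition \<gamma> < 1/2 enters as a negative exponent 4 \<gamma> - 2. The factor 6
  bounds the squared length of the first two mode frequencies in units of j^4.\<close>

lemma dissipation_sublinear:
  assumes "0 < \<kappa>" "0 < \<gamma>" "\<gamma> < 1 / 2" "0 < c"
  shows "eventually (\<lambda>j::nat. \<kappa> * (6 * real j ^ 4) powr \<gamma> \<le> c * real j ^ 2) sequentially"
proof -
  have "((\<lambda>x::real. \<kappa> * 6 powr \<gamma> * x powr (4 * \<gamma> - 2)) \<longlongrightarrow> \<kappa> * 6 powr \<gamma> * 0) at_top"
    using assms by (intro tendsto_intros tendsto_neg_powr filterlim_ident) auto
  then have "eventually (\<lambda>x::real. \<kappa> * 6 powr \<gamma> * x powr (4 * \<gamma> - 2) < c) at_top"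
    using assms by (intro order_tendstoD(2)) auto
  then have "eventually (\<lambda>x::real. \<kappa> * (6 * x ^ 4) powr \<gamma> \<le> c * x ^ 2) at_top"
    using eventually_gt_at_top[of "0::real"]
  proof eventually_elim
    case (elim x)
    have eq: "\<kappa> * (6 * x ^ 4) powr \<gamma> = \<kappa> * 6 powr \<gamma> * x powr (4 * \<gamma> - 2) * x ^ 2"
    proof -
      have "(x ^ 4) powr \<gamma> = (x powr 4) powr \<gamma>" using elim by (simp add: powr_numeral)
      also have "\<dots> = x powr (4 * \<gamma> - 2) * x powr 2" by (simp add: powr_powr flip: powr_add)
      also have "x powr 2 = x ^ 2" using elim by (simp add: powr_numeral)
      finally show ?thesis using elim by (simp add: powr_mult)
    qed
    show ?case unfolding eq using elim by (intro mult_right_mono) auto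
  qed
  then show ?thesis by (rule eventually_compose_filterlim[OF _ filterlim_real_sequentially])
qed

lemma exp_beats_power:
  fixes c h B :: real
  assumes "0 < c" "0 < h"
  shows "eventually (\<lambda>j::nat. B * real j ^ p < h * exp (c * real j ^ 2)) sequentially"
proof -
  have "((\<lambda>x::real. B * (x ^ p / exp x)) \<longlongrightarrow> B * 0) at_top"
    by (intro tendsto_intros tendsto_power_div_exp_0)
  then have 0: "eventually (\<lambda>x::real. B * (x ^ p / exp x) < h) at_top"
    using assms by (intro order_tendstoD(2)) auto
  have "eventually (\<lambda>x::real. B * x ^ p < h * exp (c * x ^ 2)) at_top"
    using 0 eventually_ge_at_top[of "1 / c"] eventually_ge_at_top[of "1 :: real"]
  proof eventually_elim
    case (elim x)
    have "B * x ^ p < h * exp x" using elim(1) by (simp add: pos_divide_less_eq)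
    also have "1 \<le> c * x" using elim assms by (simp add: pos_divide_le_eq mult.commute)
    then have "1 * x \<le> c * x * x" using elim by (intro mult_right_mono) auto
    then have "h * exp x \<le> h * exp (c * x ^ 2)" using assms by (simp add: power2_eq_square mult.assoc)
    finally show ?case .
  qed
  then show ?thesis by (rule eventually_compose_filterlim[OF _ filterlim_real_sequentially])
qed

text \<open>Beyond instability, what matters is uniformity: \<open>c\<close>, \<open>N\<close> and
  the decay constant are independent of \<open>j\<close>, so the later bounds depend on
  \<open>j\<close> only polynomially.\<close>

lemma MG_growing_mode:
  assumes par: "0 < \<Omega>" "0 < \<beta>" "0 < \<eta>" and \<kappa>: "0 < \<kappa>" and \<gamma>: "0 < \<gamma>" "\<gamma> < 1 / 2"
  obtains c N where "0 < c" "1 \<le> N"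
    "eventually (\<lambda>j::nat. 1 \<le> j \<and> (\<exists>l \<psi> m. c * real j ^ 2 \<le> l \<and> \<psi> 0 = 0 \<and> (\<forall>n\<ge>1. 0 < \<psi> n) \<and>
      (\<forall>n\<ge>1. (l + \<kappa> * freq_sq (mode_freq j n) powr \<gamma>) * \<psi> n =
        MG_symbol3 \<Omega> \<beta> \<eta> (mode_freq j n) * (\<psi> (n + 1) + \<psi> (n - 1))) \<and>
      1 \<le> m \<and> m \<le> N \<and> \<psi> m = 1 \<and> (\<forall>n\<ge>1. \<psi> n \<le> 2 ^ N * (1 / 2) ^ n))) sequentially"
proof -
  define c0 where "c0 = \<beta>\<^sup>2 / \<eta>"
  \<comment> \<open>Half of the lower bound on the coupling; the other half absorbs the dissipation
    for large \<open>j\<close>.\<close>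
  define c where "c = c0 / (96 * \<Omega>\<^sup>2 + c0\<^sup>2) / 2"
  have "2 * (b / 2) = b" for b :: real by simp
  then have c2: "2 * c = c0 / (96 * \<Omega>\<^sup>2 + c0\<^sup>2)" unfolding c_def .
  have c0: "0 < c0" using par by (simp add: c0_def)
  have "0 < 96 * \<Omega>\<^sup>2 + c0\<^sup>2" using par by (intro add_pos_nonneg) auto
  then have c: "0 < c" using c0 by (simp add: c_def)
  \<comment> \<open>From this index on, the upper bound with its factor 1 / n^2 falls below c j^2 /
    6. The powers of \<open>j\<close> cancel, so \<open>N\<close> does not depend on
    \<open>j\<close>.\<close>
  define N where "N = nat \<lceil>6 * (c0 / (4 * \<Omega>\<^sup>2)) / c\<rceil> + 1"
  have N: "6 * (c0 / (4 * \<Omega>\<^sup>2)) / c \<le> real N" unfolding N_def by linarith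
  have N1: "1 \<le> N" by (simp add: N_def)
  have "eventually (\<lambda>j::nat. 1 \<le> j \<and> (\<exists>l \<psi> m. c * real j ^ 2 \<le> l \<and> \<psi> 0 = 0 \<and> (\<forall>n\<ge>1. 0 < \<psi> n) \<and>
      (\<forall>n\<ge>1. (l + \<kappa> * freq_sq (mode_freq j n) powr \<gamma>) * \<psi> n =
        MG_symbol3 \<Omega> \<beta> \<eta> (mode_freq j n) * (\<psi> (n + 1) + \<psi> (n - 1))) \<and>
      1 \<le> m \<and> m \<le> N \<and> \<psi> m = 1 \<and> (\<forall>n\<ge>1. \<psi> n \<le> 2 ^ N * (1 / 2) ^ n))) sequentially"
    using dissipation_sublinear[OF \<kappa> \<gamma> c] eventually_ge_at_top[of "1::nat"]
  proof eventually_elim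
    case (elim j)
    let ?\<mu> = "\<lambda>n. MG_symbol3 \<Omega> \<beta> \<eta> (mode_freq j n)"
    let ?d = "\<lambda>n. \<kappa> * freq_sq (mode_freq j n) powr \<gamma>"
    note b = MG_symbol3_mode_bounds[OF par \<open>1 \<le> j\<close>, folded c0_def]
    have j: "1 \<le> real j" using elim by simp
    have low: "c * real j ^ 2 + ?d n \<le> ?\<mu> n" if "1 \<le> n" "n \<le> 2" for n
    proof -
      have "real n ^ 2 \<le> 2 ^ 2" using that by (intro power_mono) auto
      moreover have "real j ^ 2 \<le> real j ^ 4" "1 \<le> real j ^ 4" using j by (auto intro: power_increasing)
      ultimately have "freq_sq (mode_freq j n) \<le> 6 * real j ^ 4" unfolding freq_sq_mode by simp
      then have "?d n \<le> \<kappa> * (6 * real j ^ 4) powr \<gamma>"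
        using \<kappa> \<gamma> freq_sq_nonneg by (intro mult_left_mono powr_mono2) auto
      then have "?d n \<le> c * real j ^ 2" using elim(1) by linarith
      moreover have "2 * c * real j ^ 2 \<le> ?\<mu> n" using b(3)[OF that] c2 by simp
      ultimately show ?thesis by linarith
    qed
    obtain l \<psi> where l: "c * real j ^ 2 \<le> l" "\<psi> 0 = 0" "\<And>n. 1 \<le> n \<Longrightarrow> 0 < \<psi> n"
      "\<And>n. 1 \<le> n \<Longrightarrow> (l + ?d n) * \<psi> n = ?\<mu> n * (\<psi> (n + 1) + \<psi> (n - 1))"
      "\<And>n. N \<le> n \<Longrightarrow> 1 \<le> n \<Longrightarrow> \<psi> (n + 1) \<le> \<psi> n / 2"
    proof (rule growing_mode[of ?\<mu> "c0 / (4 * \<Omega>\<^sup>2) * real j ^ 2" ?d "c * real j ^ 2" N])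
      show "0 < ?\<mu> n" if "1 \<le> n" for n by (rule b(1)[OF that])
      show "?\<mu> n \<le> c0 / (4 * \<Omega>\<^sup>2) * real j ^ 2" if "1 \<le> n" for n
      proof -
        have "?\<mu> n \<le> c0 / (4 * \<Omega>\<^sup>2) * real j ^ 2 / real n ^ 2" by (rule b(2)[OF that])
        also have "\<dots> \<le> c0 / (4 * \<Omega>\<^sup>2) * real j ^ 2 / 1" using that c0 by (intro divide_left_mono) auto
        finally show ?thesis by simp
      qed
      show "6 * ?\<mu> n \<le> c * real j ^ 2" if n: "N \<le> n" for n
      proof -
        have n1: "1 \<le> real n" using n N1 by simp
        have "6 * (c0 / (4 * \<Omega>\<^sup>2)) / c \<le> real n" using N n by linarith
        also have "\<dots> \<le> real n ^ 2" using n1 by (simp add: power2_eq_square)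
        finally have q: "6 * (c0 / (4 * \<Omega>\<^sup>2)) \<le> c * real n ^ 2" by (simp only: pos_divide_le_eq[OF c] mult.commute)
        have "6 * ?\<mu> n \<le> 6 * (c0 / (4 * \<Omega>\<^sup>2)) * real j ^ 2 / real n ^ 2" using b(2)[of n] n N1 by simp
        also have "\<dots> \<le> (c * real n ^ 2) * real j ^ 2 / real n ^ 2"
          using q by (intro divide_right_mono mult_right_mono) auto
        also have "\<dots> = c * real j ^ 2" using n1 by simp
        finally show ?thesis .
      qed
      show "0 < c * real j ^ 2" using c j by simp
    qed (use low \<kappa> in auto)
    \<comment> \<open>Normalising at the largest of the first \<open>N\<close> values bounds these
      by 1, and the halving beyond \<open>N\<close> does the rest. The index \<open>m\<close> may
      vary with \<open>j\<close> but stays below \<open>N\<close>, which bounds the frequency of the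
      perturbation placed there.\<close>
    have "\<exists>m\<in>{1..N}. \<forall>n\<in>{1..N}. \<psi> n \<le> \<psi> m"
    proof -
      have f: "finite (\<psi> ` {1..N})" "\<psi> ` {1..N} \<noteq> {}" using N1 by auto
      obtain m where "m \<in> {1..N}" "\<psi> m = Max (\<psi> ` {1..N})" using Max_in[OF f] by auto
      then show ?thesis using f by (intro bexI[of _ m]) auto
    qed
    then obtain m where m: "1 \<le> m" "m \<le> N" "\<And>n. 1 \<le> n \<Longrightarrow> n \<le> N \<Longrightarrow> \<psi> n \<le> \<psi> m" by auto
    have pm: "0 < \<psi> m" by (rule l(3)[OF m(1)])
    define \<phi> where "\<phi> n = \<psi> n / \<psi> m" for n
    have small: "\<phi> n \<le> 2 ^ N * (1 / 2) ^ n" if "1 \<le> n" for n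
    proof (cases "n \<le> N")
      case True
      then have "\<phi> n \<le> 1" using m(3)[OF that] pm by (simp add: \<phi>_def)
      also have "(1 :: real) \<le> 2 ^ (N - n)" by simp
      also have "\<dots> = 2 ^ N * (1 / 2) ^ n" using True by (simp add: power_diff power_one_over field_simps)
      finally show ?thesis .
    next
      case False
      then have "N \<le> n" by simp
      then show ?thesis
      proof (induction n rule: dec_induct)
        case base
        have "\<phi> N \<le> 1" using m(3)[of N] N1 pm by (simp add: \<phi>_def)
        then show ?case by (simp add: power_one_over)
      next
        case (step n)
        have "\<psi> (n + 1) \<le> \<psi> n / 2" using l(5)[of n] step N1 by simp
        then have "\<phi> (Suc n) \<le> \<phi> n / 2" using pm by (simp add: \<phi>_def field_simps)
        then show ?case using step by simp
      qed
    qed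
    show ?case
    proof (intro conjI exI[of _ l] exI[of _ \<phi>] exI[of _ m] allI impI small l(1) m \<open>1 \<le> j\<close>)
      show "0 < \<phi> n" if "1 \<le> n" for n using l(3)[OF that] pm by (simp add: \<phi>_def)
      show "(l + ?d n) * \<phi> n = ?\<mu> n * (\<phi> (n + 1) + \<phi> (n - 1))" if "1 \<le> n" for n
        unfolding \<phi>_def add_divide_distrib[symmetric] times_divide_eq_right l(4)[OF that] ..
    qed (use l(2) pm in \<open>simp_all add: \<phi>_def\<close>)
  qed
  then show ?thesis using that c N1 by blast
qed

text \<open>Summation by parts moves the operator onto \<psi>, where it acts as multiplication by
  \<open>l\<close>. The zeros of \<psi> and \<mu> at index 0 remove the left boundary terms; those
  at the cutoff remain.\<close>

lemma tridiagonal_sum: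
  fixes \<mu> d \<psi> A :: "nat \<Rightarrow> real"
  assumes "\<psi> 0 = 0" "\<mu> 0 = 0"
    and eq: "\<And>n. 1 \<le> n \<Longrightarrow> (l + d n) * \<psi> n = \<mu> n * (\<psi> (n + 1) + \<psi> (n - 1))"
  shows "(\<Sum>n\<in>{1..M}. \<psi> n * (- d n * A n + (\<mu> (n + 1) * A (n + 1) + \<mu> (n - 1) * A (n - 1)))) =
    l * (\<Sum>n\<in>{1..M}. \<psi> n * A n) + \<psi> M * \<mu> (M + 1) * A (M + 1) - \<psi> (M + 1) * \<mu> M * A M"
proof (induction M)
  case 0
  then show ?case using assms by simp
next
  case (Suc M)
  have "d (Suc M) * \<psi> (Suc M) = \<mu> (Suc M) * (\<psi> (Suc (Suc M)) + \<psi> M) - l * \<psi> (Suc M)"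
    using eq[of "Suc M"] by (simp add: algebra_simps)
  then have "d (Suc M) * \<psi> (Suc M) * A (Suc M) = (\<mu> (Suc M) * (\<psi> (Suc (Suc M)) + \<psi> M) - l * \<psi> (Suc M)) * A (Suc M)"
    by (simp only:)
  then show ?case using Suc by (simp add: algebra_simps)
qed

section \<open>Weak solutions near the steady state\<close>

lemma steady_as_two_waves: "steady = (\<lambda>x. 2 * wave e3 (pi / 2) x + 0 * wave 0 0 x)"
  by (rule ext) (simp add: steady_def)

text \<open>Through the uniqueness clause of well-posedness this identifies the unperturbed solution
  at almost every time.\<close>

lemma steady_weak_solution:
  assumes \<gamma>: "0 < \<gamma>" "\<gamma> < 1 / 2" and X: "sobolev_space X"
  shows "MG_weak_solution \<Omega> \<beta> \<eta> \<kappa> \<gamma> (\<lambda>x. \<kappa> * steady x) X T steady (\<lambda>_. steady)"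
proof -
  obtain C n where "0 \<le> C" and C: "\<And>a k \<theta> b l \<eta>. (\<lambda>x. a * wave k \<theta> x + b * wave l \<eta> x) \<in> sp_carrier X"
    "\<And>a k \<theta> b l \<eta>. 0 \<le> sp_norm X (\<lambda>x. a * wave k \<theta> x + b * wave l \<eta> x)"
    "\<And>a k \<theta> b l \<eta>. sp_norm X (\<lambda>x. a * wave k \<theta> x + b * wave l \<eta> x) \<le> C * (\<bar>a\<bar> * (1 + freq_sq k) ^ n + \<bar>b\<bar> * (1 + freq_sq l) ^ n)"
    by (rule sobolev_space_two_waves[OF X]) (rule that; blast)
  have sX: "steady \<in> sp_carrier X" unfolding steady_as_two_waves by (rule C(1))
  \<comment> \<open>Strong measurability is shown with the constant approximating sequence, whose
    error is the norm of the zero function; the two-wave bounds with zero amplitudes give 0.\<close>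
  have "sp_norm X (\<lambda>x. 0) = 0" using C(2)[of 0 0 0 0 0 0] C(3)[of 0 0 0 0 0 0] by simp
  then have "in_Linf_time T X (\<lambda>_. steady)"
    unfolding in_Linf_time_def using sX
    by (intro conjI exI[of _ "sp_norm X steady"] exI[of _ "\<lambda>_ _. steady"]) auto
  moreover have "in_Lp 1 steady" unfolding in_Lp_1_iff by (rule sq_integrable_imp_integrable[OF sq_integrable_steady])
  moreover have z: "(LINT x|torus. f x * (MG_velocity \<Omega> \<beta> \<eta> steady x \<bullet> grad \<phi> x)) = 0" for f \<phi>
    by (rule integral_eq_zero_AE) (use MG_velocity_steady[of \<Omega> \<beta> \<eta>] in \<open>eventually_elim, simp\<close>)
  moreover have "(LINT x|torus. MG_velocity \<Omega> \<beta> \<eta> steady x \<bullet> grad \<phi> x) = 0" for \<phi>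
    using z[of "\<lambda>_. 1" \<phi>] by simp
  moreover have "integrable (lebesgue_on {0<..<t}) (\<lambda>_. c)" for t c :: real
  proof -
    have "finite_measure (lebesgue_on {0<..<t})" by (rule finite_measure_lebesgue_on) auto
    then show ?thesis by (rule finite_measure.integrable_const)
  qed
  ultimately show ?thesis
    unfolding MG_weak_solution_def by (simp add: integral_steady_frac_laplacian[OF \<gamma>] mult.assoc)
qed

lemma integral_steady_wave:
  assumes "k \<noteq> e3" "k \<noteq> - e3"
  shows "(LINT x|torus. steady x * wave k 0 x) = 0"
proof -
  have "e3 + k \<noteq> 0" using assms(2) by (simp add: eq_neg_iff_add_eq_0 add.commute)
  then show ?thesis using assms(1) by (simp add: steady_def mult.assoc torus_integral_wave_mult)
qed

text \<open>The source and the steady state live on the frequencies \<open>e3\<close> and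
  \<open>- e3\<close> and are invisible to the other modes. The integrability clauses of the weak
  formulation justify splitting the time integral.\<close>

lemma mode_equation:
  assumes \<gamma>: "0 < \<gamma>" "\<gamma> < 1 / 2"
    and sol: "MG_weak_solution \<Omega> \<beta> \<eta> \<kappa> \<gamma> (\<lambda>x. \<kappa> * steady x) X T \<theta> \<Theta>"
    and \<theta>: "\<theta> \<in> borel_measurable torus" and k: "k \<noteq> e3" "k \<noteq> - e3" and t: "t \<in> {0<..<T}"
  defines "G \<equiv> \<lambda>\<tau>. - (\<kappa> * freq_sq k powr \<gamma>) * (LINT x|torus. \<Theta> \<tau> x * wave k 0 x)
      + (LINT x|torus. \<Theta> \<tau> x * (MG_velocity \<Omega> \<beta> \<eta> (\<Theta> \<tau>) x \<bullet> grad (wave k 0) x))"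
  shows "integrable (lebesgue_on {0<..<t}) G"
    and "(LINT x|torus. \<Theta> t x * wave k 0 x) = (LINT x|torus. \<theta> x * wave k 0 x) + (LINT \<tau>|lebesgue_on {0<..<t}. G \<tau>)"
proof -
  let ?A = "\<lambda>\<tau>. LINT x|torus. \<Theta> \<tau> x * wave k 0 x"
  let ?D = "\<lambda>\<tau>. LINT x|torus. \<Theta> \<tau> x * frac_laplacian \<gamma> (wave k 0) x"
  let ?B = "\<lambda>\<tau>. LINT x|torus. \<Theta> \<tau> x * (MG_velocity \<Omega> \<beta> \<eta> (\<Theta> \<tau>) x \<bullet> grad (wave k 0) x)"
  let ?L = "lebesgue_on {0<..<t}"
  have i: "integrable torus (\<Theta> \<tau>)" if "\<tau> \<in> {0..<T}" for \<tau>
    using sol that by (auto simp: MG_weak_solution_def in_Lp_1_iff)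
  have D: "?D \<tau> = freq_sq k powr \<gamma> * ?A \<tau>" if "\<tau> \<in> {0..<T}" for \<tau>
    by (rule integral_frac_laplacian_wave[OF \<gamma>]) (use i[OF that] in simp)
  have w: "integrable ?L ?D" "integrable ?L ?B"
    "(LINT x|torus. (\<Theta> t x - \<Theta> 0 x) * wave k 0 x) + \<kappa> * (LINT \<tau>|?L. ?D \<tau>) - (LINT \<tau>|?L. ?B \<tau>)
      = (LINT \<tau>|?L. LINT x|torus. \<kappa> * steady x * wave k 0 x)"
    using sol smooth_torus_wave1[of k 0] t unfolding MG_weak_solution_def by blast+
  have GD: "G \<tau> = - \<kappa> * ?D \<tau> + ?B \<tau>" if "\<tau> \<in> {0<..<t}" for \<tau>
    using D[of \<tau>] that t by (simp add: G_def)
  have wi: "integrable ?L (\<lambda>\<tau>. - \<kappa> * ?D \<tau> + ?B \<tau>)"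
    by (intro Bochner_Integration.integrable_add integrable_mult_right w)
  then show "integrable ?L G"
    by (subst Bochner_Integration.integrable_cong[OF refl GD]) auto
  have "(LINT \<tau>|?L. G \<tau>) = (LINT \<tau>|?L. - \<kappa> * ?D \<tau> + ?B \<tau>)"
    by (rule Bochner_Integration.integral_cong[OF refl GD]) simp
  also have "\<dots> = - \<kappa> * (LINT \<tau>|?L. ?D \<tau>) + (LINT \<tau>|?L. ?B \<tau>)"
    using w by simp
  finally have G: "(LINT \<tau>|?L. G \<tau>) = - \<kappa> * (LINT \<tau>|?L. ?D \<tau>) + (LINT \<tau>|?L. ?B \<tau>)" .
  have "(LINT x|torus. (\<Theta> t x - \<Theta> 0 x) * wave k 0 x) = ?A t - ?A 0"
    using i[of t] i[of 0] t by (simp add: left_diff_distrib integrable_mult_wave)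
  moreover have "?A 0 = (LINT x|torus. \<theta> x * wave k 0 x)"
  proof (rule integral_cong_AE)
    have "AE x in torus. \<Theta> 0 x = \<theta> x" using sol by (simp add: MG_weak_solution_def)
    then show "AE x in torus. \<Theta> 0 x * wave k 0 x = \<theta> x * wave k 0 x" by eventually_elim simp
    have w: "wave k 0 \<in> borel_measurable torus" by (rule measurable_torus_continuous[OF continuous_wave])
    show "(\<lambda>x. \<theta> x * wave k 0 x) \<in> borel_measurable torus" by (rule borel_measurable_times[OF \<theta> w])
    show "(\<lambda>x. \<Theta> 0 x * wave k 0 x) \<in> borel_measurable torus"
      by (rule borel_measurable_times[OF borel_measurable_integrable[OF i] w]) (use t in auto)
  qed
  moreover have "(LINT x|torus. \<kappa> * steady x * wave k 0 x) = 0"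
    using integral_steady_wave[OF k] by (simp add: mult.assoc)
  ultimately show "?A t = (LINT x|torus. \<theta> x * wave k 0 x) + (LINT \<tau>|?L. G \<tau>)"
    using w(3) G by simp
qed

text \<open>Abstract form of the instability: \<open>a\<close> bounds all coefficients,
  \<open>r n\<close> the nonlinear remainder of mode \<open>n\<close>, and \<rho> collects the
  truncation error at \<open>M\<close> and the weighted remainders. The sum weighted by \<psi> then
  satisfies a scalar differential inequality.\<close>

lemma unstable_growth:
  fixes A b :: "nat \<Rightarrow> real \<Rightarrow> real" and A0 \<mu> d \<psi> r :: "nat \<Rightarrow> real"
  assumes l: "0 < l" and \<psi>: "\<psi> 0 = 0" "\<And>n. 1 \<le> n \<Longrightarrow> 0 < \<psi> n"
    and eq: "\<And>n. 1 \<le> n \<Longrightarrow> (l + d n) * \<psi> n = \<mu> n * (\<psi> (n + 1) + \<psi> (n - 1))"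
    and \<mu>: "\<mu> 0 = 0" "\<And>n. 1 \<le> n \<Longrightarrow> 0 < \<mu> n" "\<And>n. 1 \<le> n \<Longrightarrow> \<mu> n \<le> B"
    and M: "1 \<le> M" and t: "0 < t" "t < T"
    and int: "\<And>n s. 1 \<le> n \<Longrightarrow> s \<in> {0<..<T} \<Longrightarrow> integrable (lebesgue_on {0<..<s}) (\<lambda>\<tau>. - d n * A n \<tau> + b n \<tau>)"
    and A: "\<And>n s. 1 \<le> n \<Longrightarrow> s \<in> {0<..<T} \<Longrightarrow> A n s = A0 n + (LINT \<tau>|lebesgue_on {0<..<s}. - d n * A n \<tau> + b n \<tau>)"
    and ae: "AE \<tau> in lebesgue_on {0<..<T}. \<forall>n\<ge>1. \<bar>A n \<tau>\<bar> \<le> a \<and>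
      \<bar>b n \<tau> - (\<mu> (n + 1) * A (n + 1) \<tau> + \<mu> (n - 1) * A (n - 1) \<tau>)\<bar> \<le> r n"
  defines "\<rho> \<equiv> B * a * (\<psi> M + \<psi> (M + 1)) + (\<Sum>n\<in>{1..M}. \<psi> n * r n)"
  shows "((\<Sum>n\<in>{1..M}. \<psi> n * A0 n) - \<rho> / l) * exp (l * t) + \<rho> / l \<le> (\<Sum>n\<in>{1..M}. \<psi> n * A n t)"
proof (rule Gronwall_lower[OF l t, where G = "\<lambda>\<tau>. \<Sum>n\<in>{1..M}. \<psi> n * (- d n * A n \<tau> + b n \<tau>)"
      and F = "\<lambda>\<tau>. \<Sum>n\<in>{1..M}. \<psi> n * A n \<tau>"])
  fix s assume s: "s \<in> {0<..<T}"
  show "integrable (lebesgue_on {0<..<s}) (\<lambda>\<tau>. \<Sum>n\<in>{1..M}. \<psi> n * (- d n * A n \<tau> + b n \<tau>))"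
    by (intro Bochner_Integration.integrable_sum integrable_mult_right int s) simp
  have "(LINT \<tau>|lebesgue_on {0<..<s}. (\<Sum>n\<in>{1..M}. \<psi> n * (- d n * A n \<tau> + b n \<tau>))) =
      (\<Sum>n\<in>{1..M}. \<psi> n * (LINT \<tau>|lebesgue_on {0<..<s}. - d n * A n \<tau> + b n \<tau>))"
    by (subst Bochner_Integration.integral_sum, intro integrable_mult_right int s)
      (simp_all only: atLeastAtMost_iff integral_mult_right_zero)
  also have "\<dots> = (\<Sum>n\<in>{1..M}. \<psi> n * (A n s - A0 n))"
    by (intro sum.cong refl) (use A[OF _ s] in simp)
  finally show "(\<Sum>n\<in>{1..M}. \<psi> n * A n s) = (\<Sum>n\<in>{1..M}. \<psi> n * A0 n) +
      (LINT \<tau>|lebesgue_on {0<..<s}. (\<Sum>n\<in>{1..M}. \<psi> n * (- d n * A n \<tau> + b n \<tau>)))"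
    by (simp add: right_diff_distrib sum_subtractf)
next
  show "AE \<tau> in lebesgue_on {0<..<T}. l * (\<Sum>n\<in>{1..M}. \<psi> n * A n \<tau>) - \<rho> \<le> (\<Sum>n\<in>{1..M}. \<psi> n * (- d n * A n \<tau> + b n \<tau>))"
    using ae
  proof eventually_elim
    case (elim \<tau>)
    let ?R = "\<lambda>n. b n \<tau> - (\<mu> (n + 1) * A (n + 1) \<tau> + \<mu> (n - 1) * A (n - 1) \<tau>)"
    have "(\<Sum>n\<in>{1..M}. \<psi> n * (- d n * A n \<tau> + b n \<tau>)) =
      (\<Sum>n\<in>{1..M}. \<psi> n * (- d n * A n \<tau> + (\<mu> (n + 1) * A (n + 1) \<tau> + \<mu> (n - 1) * A (n - 1) \<tau>))) + (\<Sum>n\<in>{1..M}. \<psi> n * ?R n)"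
      unfolding sum.distrib[symmetric] by (intro sum.cong refl) (simp add: algebra_simps)
    also have "(\<Sum>n\<in>{1..M}. \<psi> n * (- d n * A n \<tau> + (\<mu> (n + 1) * A (n + 1) \<tau> + \<mu> (n - 1) * A (n - 1) \<tau>))) =
        l * (\<Sum>n\<in>{1..M}. \<psi> n * A n \<tau>) + \<psi> M * \<mu> (M + 1) * A (M + 1) \<tau> - \<psi> (M + 1) * \<mu> M * A M \<tau>"
      by (rule tridiagonal_sum[where A = "\<lambda>n. A n \<tau>", OF \<psi>(1) \<mu>(1) eq])
    finally have G: "(\<Sum>n\<in>{1..M}. \<psi> n * (- d n * A n \<tau> + b n \<tau>)) =
        l * (\<Sum>n\<in>{1..M}. \<psi> n * A n \<tau>) + \<psi> M * \<mu> (M + 1) * A (M + 1) \<tau> - \<psi> (M + 1) * \<mu> M * A M \<tau>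
        + (\<Sum>n\<in>{1..M}. \<psi> n * ?R n)" .
    have bd: "\<bar>\<psi> m * \<mu> k * A k \<tau>\<bar> \<le> \<psi> m * (B * a)" if "1 \<le> m" "1 \<le> k" for m k
    proof -
      have "\<bar>\<psi> m * \<mu> k * A k \<tau>\<bar> = \<psi> m * (\<mu> k * \<bar>A k \<tau>\<bar>)"
        using \<psi>(2)[OF that(1)] \<mu>(2)[OF that(2)] by (simp add: abs_mult)
      also have "\<dots> \<le> \<psi> m * (B * a)"
        using \<psi>(2)[OF that(1)] \<mu>(2,3)[OF that(2)] elim that(2) by (intro mult_left_mono mult_mono) auto
      finally show ?thesis .
    qed
    have "\<bar>\<Sum>n\<in>{1..M}. \<psi> n * ?R n\<bar> \<le> (\<Sum>n\<in>{1..M}. \<psi> n * r n)"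
    proof (rule order_trans[OF sum_abs], rule sum_mono)
      fix n assume n: "n \<in> {1..M}"
      then have "\<bar>\<psi> n * ?R n\<bar> = \<psi> n * \<bar>?R n\<bar>" using \<psi>(2)[of n] by (simp add: abs_mult)
      also have "\<dots> \<le> \<psi> n * r n" using \<psi>(2)[of n] n elim by (intro mult_left_mono) auto
      finally show "\<bar>\<psi> n * ?R n\<bar> \<le> \<psi> n * r n" .
    qed
    moreover have "\<rho> = \<psi> M * (B * a) + \<psi> (M + 1) * (B * a) + (\<Sum>n\<in>{1..M}. \<psi> n * r n)"
      by (simp add: \<rho>_def algebra_simps)
    ultimately show ?case unfolding G using bd[of M "M + 1"] bd[of "M + 1" M] M by linarith
  qed
qed

text \<open>The unperturbed solution is the steady state only at almost every time, so the final
  comparison needs some good time late in the interval.\<close>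

lemma AE_interval_witness:
  assumes "AE \<tau> in lebesgue_on {0<..<T}. P \<tau>" "0 \<le> t0" "t0 < T"
  shows "\<exists>\<tau>::real. t0 < \<tau> \<and> \<tau> < T \<and> P \<tau>"
proof (rule ccontr)
  assume n: "\<not> ?thesis"
  have "AE \<tau> in lebesgue. \<tau> \<in> {0<..<T} \<longrightarrow> P \<tau>"
    using assms(1) by (subst (asm) AE_restrict_space_iff) auto
  then have "AE \<tau> in lebesgue. \<tau> \<notin> {t0<..<T}"
    by eventually_elim (use n assms in auto)
  then have "{t0<..<T} \<in> null_sets lebesgue" by (subst (asm) AE_iff_null_sets[symmetric]) auto
  then have "negligible (box t0 T)" by (simp add: negligible_iff_null_sets box_real)
  then have "box t0 T = {}" using negligible_interval(2) by blast
  then show False using assms(3) by (simp add: box_real)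
qed

lemma mode_freq_neq_e3:
  assumes "1 \<le> j"
  shows "mode_freq j n \<noteq> e3" "mode_freq j n \<noteq> - e3"
  using assms by (auto simp: vec_eq_iff forall_3 mode_freq_nth axis_def)

text \<open>The constant is nonnegative because otherwise the norm of the nonzero steady state in W(1,4)
  would vanish.\<close>

lemma embedded_W14_constant:
  assumes X: "sobolev_space X" and emb: "embedded X (sobolev_W 1 4)"
  obtains C where "0 \<le> C" "\<And>f. f \<in> sp_carrier X \<Longrightarrow> f \<in> sp_carrier (sobolev_W 1 4)"
    "\<And>f. f \<in> sp_carrier X \<Longrightarrow> sp_norm (sobolev_W 1 4) f \<le> C * sp_norm X f"
proof -
  obtain C where sub: "sp_carrier X \<subseteq> sp_carrier (sobolev_W 1 4)"
    and C: "\<And>f. f \<in> sp_carrier X \<Longrightarrow> sp_norm (sobolev_W 1 4) f \<le> C * sp_norm X f"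
    using emb by (auto simp: embedded_def)
  obtain D n where "0 \<le> D" and D: "\<And>a k \<theta> b l \<eta>. (\<lambda>x. a * wave k \<theta> x + b * wave l \<eta> x) \<in> sp_carrier X"
    "\<And>a k \<theta> b l \<eta>. 0 \<le> sp_norm X (\<lambda>x. a * wave k \<theta> x + b * wave l \<eta> x)"
    "\<And>a k \<theta> b l \<eta>. sp_norm X (\<lambda>x. a * wave k \<theta> x + b * wave l \<eta> x) \<le> D * (\<bar>a\<bar> * (1 + freq_sq k) ^ n + \<bar>b\<bar> * (1 + freq_sq l) ^ n)"
    by (rule sobolev_space_two_waves[OF X]) (rule that; blast)
  have sX: "steady \<in> sp_carrier X" "0 \<le> sp_norm X steady" unfolding steady_as_two_waves by (rule D)+
  have "0 \<le> C"
  proof (rule ccontr)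
    assume "\<not> 0 \<le> C"
    then have "C * sp_norm X steady \<le> 0" using sX(2) by (simp add: mult_nonpos_nonneg)
    then have "sp_norm (sobolev_W 1 4) steady \<le> 0" using C[OF sX(1)] by linarith
    moreover have "0 \<le> sp_norm (sobolev_W 1 4) steady"
      unfolding sobolev_W_def by (auto intro!: sum_nonneg simp: Lp_norm_def)
    ultimately have z: "sp_norm (sobolev_W 1 4) steady = 0" by simp
    have "steady \<in> sp_carrier (sobolev_W 1 4)" using sX sub by blast
    then obtain w where "sq_integrable steady" "\<And>i. sq_integrable (w i)"
      "\<And>i k. fourier (w i) k = \<i> * of_int (k $ i) * fourier steady k"
      and "sq_int steady + (\<Sum>i\<in>UNIV. sq_int (w i)) \<le> 4 * sqrt ((2 * pi) ^ 3) * (sp_norm (sobolev_W 1 4) steady)\<^sup>2"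
      using W14_gradient by blast
    moreover have "0 \<le> (\<Sum>i\<in>UNIV. sq_int (w i))" by (intro sum_nonneg sq_int_nonneg)
    ultimately have "sq_int steady \<le> 0" unfolding z by simp
    moreover have "sq_int steady = 2 * (2 * pi) ^ 3"
    proof -
      have "e3 + e3 \<noteq> 0" by (simp add: vec_eq_iff axis_def forall_3)
      then have "(LINT x|torus. wave e3 (pi / 2) x * wave e3 (pi / 2) x) = (2 * pi) ^ 3 / 2"
        by (simp add: torus_integral_wave_mult)
      moreover have "(steady x)\<^sup>2 = 4 * (wave e3 (pi / 2) x * wave e3 (pi / 2) x)" for x
        by (simp add: steady_def power2_eq_square)
      ultimately show ?thesis by (simp add: sq_int_def)
    qed
    ultimately show False using pi_gt_zero by simp
  qed
  then show ?thesis using that sub C by blast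
qed

theorem theorem4p7:
  fixes \<Omega> \<beta> \<eta> \<kappa> \<gamma> :: real and X Y :: torus_space
  assumes "0 < \<Omega>" and "0 < \<beta>" and "0 < \<eta>" and "0 < \<kappa>"
    and "0 < \<gamma>" and "\<gamma> < 1 / 2"
    and "sobolev_space X" and "sobolev_space Y"
    and "embedded Y X" and "embedded X (sobolev_W 1 4)"
  shows "\<exists>S. smooth_torus S \<and> \<not> MG_Lipschitz_well_posed \<Omega> \<beta> \<eta> \<kappa> \<gamma> S X Y"
proof (intro exI conjI notI)
  note par = assms(1-3) and \<gamma> = assms(5,6)
  let ?S = "\<lambda>x. \<kappa> * steady x"
  show "smooth_torus ?S"
    using smooth_torus_wave[of "\<kappa> * 2" e3 "pi / 2"] by (simp add: steady_def mult.assoc)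
  assume "MG_Lipschitz_well_posed \<Omega> \<beta> \<eta> \<kappa> \<gamma> ?S X Y"
  then obtain T K :: "real \<times> real \<Rightarrow> real" where
    cT: "continuous_on ({0..} \<times> {0..}) T" and cK: "continuous_on ({0..} \<times> {0..}) K"
    and TK: "\<And>z. z \<in> {0..} \<times> {0..} \<Longrightarrow> 0 < T z \<and> 0 < K z"
    and wp: "\<And>\<theta>1 \<theta>2. \<theta>1 \<in> sp_carrier Y \<Longrightarrow> \<theta>2 \<in> sp_carrier Y \<Longrightarrow>
      \<exists>\<Theta>1 \<Theta>2. MG_unique_solution \<Omega> \<beta> \<eta> \<kappa> \<gamma> ?S X (T (sp_norm Y \<theta>1, sp_norm Y \<theta>2)) \<theta>1 \<Theta>1 \<and>
        MG_unique_solution \<Omega> \<beta> \<eta> \<kappa> \<gamma> ?S X (T (sp_norm Y \<theta>1, sp_norm Y \<theta>2)) \<theta>2 \<Theta>2 \<and>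
        (\<forall>t \<in> {0..T (sp_norm Y \<theta>1, sp_norm Y \<theta>2)}. (\<lambda>x. \<Theta>1 t x - \<Theta>2 t x) \<in> sp_carrier X \<and>
          sp_norm X (\<lambda>x. \<Theta>1 t x - \<Theta>2 t x) \<le> K (sp_norm Y \<theta>1, sp_norm Y \<theta>2) * sp_norm Y (\<lambda>x. \<theta>1 x - \<theta>2 x))"
    unfolding MG_Lipschitz_well_posed_def Let_def by blast
  obtain CY p where CY: "0 \<le> CY" and
    Yc: "\<And>a k \<theta> b l \<eta>. (\<lambda>x. a * wave k \<theta> x + b * wave l \<eta> x) \<in> sp_carrier Y" and
    Y0: "\<And>a k \<theta> b l \<eta>. 0 \<le> sp_norm Y (\<lambda>x. a * wave k \<theta> x + b * wave l \<eta> x)" and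
    Yn: "\<And>a k \<theta> b l \<eta>. sp_norm Y (\<lambda>x. a * wave k \<theta> x + b * wave l \<eta> x) \<le> CY * (\<bar>a\<bar> * (1 + freq_sq k) ^ p + \<bar>b\<bar> * (1 + freq_sq l) ^ p)"
    by (rule sobolev_space_two_waves[OF assms(8)]) (rule that; blast)
  obtain CX where CX: "0 \<le> CX" and XW: "\<And>f. f \<in> sp_carrier X \<Longrightarrow> f \<in> sp_carrier (sobolev_W 1 4)"
    and XWn: "\<And>f. f \<in> sp_carrier X \<Longrightarrow> sp_norm (sobolev_W 1 4) f \<le> CX * sp_norm X f"
    by (rule embedded_W14_constant[OF assms(7,10)]) (rule that; blast)
  \<comment> \<open>The first summand bounds the norm of the steady state (amplitude 2, frequency of
    length 1); the 1 leaves room for the perturbation.\<close>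
  define R where "R = CY * (2 * 2 ^ p) + 1"
  have R0: "0 \<le> R" unfolding R_def using CY by simp
  \<comment> \<open>Continuity of T and K on this square gives a positive minimal time and a finite
    Lipschitz constant that are independent of the mode and of the amplitude chosen below.\<close>
  have Z: "compact ({0..R} \<times> {0..R})" "{0..R} \<times> {0..R} \<noteq> {}" "{0..R} \<times> {0..R} \<subseteq> {0..} \<times> {0..}"
    using R0 by (auto intro: compact_Times)
  obtain zT where zT: "zT \<in> {0..R} \<times> {0..R}" "\<And>z. z \<in> {0..R} \<times> {0..R} \<Longrightarrow> T zT \<le> T z"
    using continuous_attains_inf[OF Z(1,2) continuous_on_subset[OF cT Z(3)]] by blast
  obtain zK where zK: "zK \<in> {0..R} \<times> {0..R}" "\<And>z. z \<in> {0..R} \<times> {0..R} \<Longrightarrow> K z \<le> K zK"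
    using continuous_attains_sup[OF Z(1,2) continuous_on_subset[OF cK Z(3)]] by blast
  define Tm Km where "Tm = T zT" "Km = K zK"
  note TmKm = this
  have Tm: "0 < Tm" and Km: "0 < Km" using TK zT(1) zK(1) Z(3) unfolding TmKm by blast+

  obtain c N where c: "0 < c" and N: "1 \<le> N" and
    gm: "eventually (\<lambda>j::nat. 1 \<le> j \<and> (\<exists>l \<psi> m. c * real j ^ 2 \<le> l \<and> \<psi> 0 = 0 \<and> (\<forall>n\<ge>1. 0 < \<psi> n) \<and>
      (\<forall>n\<ge>1. (l + \<kappa> * freq_sq (mode_freq j n) powr \<gamma>) * \<psi> n =
        MG_symbol3 \<Omega> \<beta> \<eta> (mode_freq j n) * (\<psi> (n + 1) + \<psi> (n - 1))) \<and>
      1 \<le> m \<and> m \<le> N \<and> \<psi> m = 1 \<and> (\<forall>n\<ge>1. \<psi> n \<le> 2 ^ N * (1 / 2) ^ n))) sequentially"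
    by (rule MG_growing_mode[OF par assms(4) \<gamma>])
  define V where "V = 4 * sqrt ((2 * pi) ^ 3)"
  \<comment> \<open>Cauchy-Schwarz constant for a mode coefficient against the W(1,4) norm;
    \<open>h\<close> below is the squared norm of a nonconstant cosine.\<close>
  define B0 where "B0 = sqrt V * sqrt ((2 * pi) ^ 3)"
  define h where "h = (2 * pi) ^ 3 / 2"
  have V: "0 < V" and B0: "0 \<le> B0" and h: "0 < h" by (simp_all add: V_def B0_def h_def)
  \<comment> \<open>Collects all factors of the final upper bound that do not depend on
    \<open>j\<close>. The exponent 4 p arises because the squared frequency is of order j^4 and the
    norm of Y costs its p-th power.\<close>
  define q where "q = 2 ^ N * B0 * (CX * Km * (CY * (3 + real N ^ 2) ^ p))"
  have ev: "eventually (\<lambda>j::nat. q * real j ^ (4 * p) < h / 2 * exp (c * Tm / 2 * real j ^ 2)) sequentially"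
    using c Tm h by (intro exp_beats_power) auto
  obtain j where j1: "1 \<le> j" and jq: "q * real j ^ (4 * p) < h / 2 * exp (c * Tm / 2 * real j ^ 2)"
    and "\<exists>l \<psi> m. c * real j ^ 2 \<le> l \<and> \<psi> 0 = 0 \<and> (\<forall>n\<ge>1. 0 < \<psi> n) \<and>
      (\<forall>n\<ge>1. (l + \<kappa> * freq_sq (mode_freq j n) powr \<gamma>) * \<psi> n =
        MG_symbol3 \<Omega> \<beta> \<eta> (mode_freq j n) * (\<psi> (n + 1) + \<psi> (n - 1))) \<and>
      1 \<le> m \<and> m \<le> N \<and> \<psi> m = 1 \<and> (\<forall>n\<ge>1. \<psi> n \<le> 2 ^ N * (1 / 2) ^ n)"
    using eventually_happens'[OF sequentially_bot eventually_conj[OF gm ev]] by blast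
  then obtain l \<psi> m where l: "c * real j ^ 2 \<le> l" and \<psi>0: "\<psi> 0 = 0" and \<psi>p: "\<And>n. 1 \<le> n \<Longrightarrow> 0 < \<psi> n"
    and \<psi>e: "\<And>n. 1 \<le> n \<Longrightarrow> (l + \<kappa> * freq_sq (mode_freq j n) powr \<gamma>) * \<psi> n =
        MG_symbol3 \<Omega> \<beta> \<eta> (mode_freq j n) * (\<psi> (n + 1) + \<psi> (n - 1))"
    and m: "1 \<le> m" "m \<le> N" "\<psi> m = 1" and \<psi>b: "\<And>n. 1 \<le> n \<Longrightarrow> \<psi> n \<le> 2 ^ N * (1 / 2) ^ n"
    by blast
  have "0 < c * real j ^ 2" using c j1 by simp
  then have l0: "0 < l" using l by linarith
  let ?k = "mode_freq j"
  define \<mu> where "\<mu> n = MG_symbol3 \<Omega> \<beta> \<eta> (?k n)" for n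
  define d where "d n = \<kappa> * freq_sq (?k n) powr \<gamma>" for n
  define B1 where "B1 = (\<beta>\<^sup>2 / \<eta>) / (4 * \<Omega>\<^sup>2) * real j ^ 2"
  have \<mu>0: "\<mu> 0 = 0" by (simp add: \<mu>_def MG_symbol3_mode)
  have \<mu>p: "0 < \<mu> n" and \<mu>b: "\<mu> n \<le> B1" if "1 \<le> n" for n
  proof -
    note b = MG_symbol3_mode_bounds[OF par j1 that]
    show "0 < \<mu> n" using b(1) by (simp add: \<mu>_def)
    have "\<mu> n \<le> B1 / real n ^ 2" using b(2) by (simp add: \<mu>_def B1_def)
    also have "\<dots> \<le> B1 / 1" using that par by (intro divide_left_mono) (auto simp: B1_def)
    finally show "\<mu> n \<le> B1" by simp
  qed
  have B1: "0 \<le> B1" using \<mu>p[of 1] \<mu>b[of 1] by simp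

  define W where "W = CY * (1 + freq_sq (?k m)) ^ p"
  have W0: "0 \<le> W" using CY freq_sq_nonneg[of "?k m"] by (simp add: W_def)
  have Wb: "W \<le> CY * (3 + real N ^ 2) ^ p * real j ^ (4 * p)"
  proof -
    have j': "1 \<le> real j" using j1 by simp
    have "real m ^ 2 \<le> real N ^ 2 * 1" using m by (simp add: power_mono)
    also have "\<dots> \<le> real N ^ 2 * real j ^ 4" using j' by (intro mult_left_mono one_le_power) auto
    finally have "real m ^ 2 \<le> real N ^ 2 * real j ^ 4" .
    moreover have "real j ^ 2 \<le> real j ^ 4" "1 \<le> real j ^ 4" using j' by (auto intro: power_increasing)
    ultimately have "1 + freq_sq (?k m) \<le> (3 + real N ^ 2) * real j ^ 4"
      unfolding freq_sq_mode by (simp add: algebra_simps)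
    then have "(1 + freq_sq (?k m)) ^ p \<le> ((3 + real N ^ 2) * real j ^ 4) ^ p"
      using freq_sq_nonneg[of "?k m"] by (intro power_mono) auto
    then have "W \<le> CY * ((3 + real N ^ 2) * real j ^ 4) ^ p" unfolding W_def using CY by (rule mult_left_mono)
    then show ?thesis by (simp add: power_mult_distrib power_mult mult.assoc)
  qed
  \<comment> \<open>Distance to the steady state in W(1,4) per unit of amplitude: Lipschitz constant
    and embedding constant times the bound \<open>W\<close> for the norm of the perturbing wave in
    Y.\<close>
  define Q where "Q = CX * Km * W"
  have Q0: "0 \<le> Q" using CX Km W0 by (simp add: Q_def)
  define C where "C n = (\<Sum>i\<in>UNIV. \<bar>real_of_int (?k n $ i)\<bar>) * (V / \<Omega>)" for n
  have C0: "0 \<le> C n" for n unfolding C_def using V par by (intro mult_nonneg_nonneg sum_nonneg) auto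

  \<comment> \<open>Truncation error per unit of amplitude. It tends to 0 geometrically, so the
    cutoff can be fixed before the amplitude.\<close>
  define bd where "bd M = B1 * (B0 * Q) * (2 * (2 ^ N * (1 / 2) ^ M))" for M
  have "bd \<longlonglongrightarrow> B1 * (B0 * Q) * (2 * (2 ^ N * 0))"
    unfolding bd_def by (intro tendsto_intros LIMSEQ_power_zero) simp
  then have evM: "eventually (\<lambda>M. bd M < l * h / 4) sequentially"
    using l0 h by (intro order_tendstoD(2)) auto
  obtain M where M: "N \<le> M" "bd M < l * h / 4"
    using eventually_happens'[OF sequentially_bot eventually_conj[OF evM eventually_ge_at_top[of N]]] by blast
  have M1: "1 \<le> M" using M(1) N by linarith
  \<comment> \<open>Weighted quadratic error per squared amplitude. It depends on \<open>M\<close>,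
    so \<epsilon> is chosen last: its first bound keeps the data in the square of side
    \<open>R\<close>, its second makes the quadratic error at most \<epsilon> l h / 4.\<close>
  define E where "E = Q\<^sup>2 * (\<Sum>n\<in>{1..M}. \<psi> n * C n)"
  have E0: "0 \<le> E" unfolding E_def using \<psi>p C0 by (intro mult_nonneg_nonneg sum_nonneg) (auto simp: less_imp_le)
  define \<epsilon> where "\<epsilon> = min (1 / (W + 1)) (l * h / (4 * (E + 1)))"
  have \<epsilon>: "0 < \<epsilon>" unfolding \<epsilon>_def using W0 E0 l0 h by (simp add: add_nonneg_pos)
  have \<epsilon>W: "\<epsilon> * W \<le> 1"
  proof -
    have "\<epsilon> * W \<le> 1 / (W + 1) * W" using W0 unfolding \<epsilon>_def by (intro mult_right_mono) auto
    also have "\<dots> \<le> 1" using W0 by (simp add: divide_le_eq)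
    finally show ?thesis .
  qed
  have \<epsilon>E: "\<epsilon> * E \<le> l * h / 4"
  proof -
    have "\<epsilon> * E \<le> l * h / (4 * (E + 1)) * E" using E0 unfolding \<epsilon>_def by (intro mult_right_mono) auto
    also have "\<dots> = l * h / 4 * (E / (E + 1))" using E0 by (simp add: field_simps)
    also have "\<dots> \<le> l * h / 4 * 1" using E0 l0 h by (intro mult_left_mono) (auto simp: divide_le_eq)
    finally show ?thesis by simp
  qed

  \<comment> \<open>The perturbed solution and its distance to the steady state\<close>
  define \<theta> where "\<theta> x = 2 * wave e3 (pi / 2) x + \<epsilon> * wave (?k m) 0 x" for x
  have e3: "freq_sq e3 = 1" by (simp add: freq_sq_def axis_def sum_3)
  have n1: "sp_norm Y steady \<in> {0..R}"
    using Y0[of 2 e3 "pi / 2" 0 0 0] Yn[of 2 e3 "pi / 2" 0 0 0] by (simp add: steady_as_two_waves R_def e3)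
  have n2: "sp_norm Y \<theta> \<in> {0..R}"
  proof -
    have "sp_norm Y \<theta> \<le> CY * (2 * 2 ^ p) + \<epsilon> * W"
      using Yn[of 2 e3 "pi / 2" \<epsilon> "?k m" 0] \<epsilon> by (simp add: \<theta>_def[abs_def] e3 W_def algebra_simps)
    then show ?thesis using Y0[of 2 e3 "pi / 2" \<epsilon> "?k m" 0] \<epsilon>W by (simp add: R_def \<theta>_def[abs_def])
  qed
  have dn: "sp_norm Y (\<lambda>x. steady x - \<theta> x) \<le> \<epsilon> * W"
  proof -
    have "(\<lambda>x. steady x - \<theta> x) = (\<lambda>x. 0 * wave 0 0 x + (- \<epsilon>) * wave (?k m) 0 x)"
      by (simp add: steady_def \<theta>_def)
    then show ?thesis using Yn[of 0 0 0 "- \<epsilon>" "?k m" 0] \<epsilon> by (simp add: W_def mult.left_commute)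
  qed
  define z where "z = (sp_norm Y steady, sp_norm Y \<theta>)"
  have zR: "z \<in> {0..R} \<times> {0..R}" using n1 n2 by (simp add: z_def)
  have Tz: "Tm \<le> T z" and Kz: "K z \<le> Km" using zT(2)[OF zR] zK(2)[OF zR] by (simp_all add: TmKm)
  have "steady \<in> sp_carrier Y" "\<theta> \<in> sp_carrier Y"
    unfolding steady_as_two_waves \<theta>_def[abs_def] by (rule Yc)+
  from wp[OF this, folded z_def] obtain \<Theta>1 \<Theta>2 where
    u1: "MG_unique_solution \<Omega> \<beta> \<eta> \<kappa> \<gamma> ?S X (T z) steady \<Theta>1" and
    u2: "MG_unique_solution \<Omega> \<beta> \<eta> \<kappa> \<gamma> ?S X (T z) \<theta> \<Theta>2" and
    lip: "\<And>t. t \<in> {0..T z} \<Longrightarrow> (\<lambda>x. \<Theta>1 t x - \<Theta>2 t x) \<in> sp_carrier X \<and>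
      sp_norm X (\<lambda>x. \<Theta>1 t x - \<Theta>2 t x) \<le> K z * sp_norm Y (\<lambda>x. steady x - \<theta> x)"
    by blast
  have w2: "MG_weak_solution \<Omega> \<beta> \<eta> \<kappa> \<gamma> ?S X (T z) \<theta> \<Theta>2" using u2 by (simp add: MG_unique_solution_def)
  have same: "AE \<tau> in lebesgue_on {0<..<T z}. AE x in torus. steady x = \<Theta>1 \<tau> x"
    using u1 steady_weak_solution[OF \<gamma> assms(7)] unfolding MG_unique_solution_def by blast
  define v where "v \<tau> = (\<lambda>x. \<Theta>1 \<tau> x - \<Theta>2 \<tau> x)" for \<tau>
  have vW: "v \<tau> \<in> sp_carrier (sobolev_W 1 4)" and vn: "(sp_norm (sobolev_W 1 4) (v \<tau>))\<^sup>2 \<le> (\<epsilon> * Q)\<^sup>2"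
    if "\<tau> \<in> {0..T z}" for \<tau>
  proof -
    have vX: "v \<tau> \<in> sp_carrier X" and nX: "sp_norm X (v \<tau>) \<le> K z * sp_norm Y (\<lambda>x. steady x - \<theta> x)"
      using lip[OF that] by (simp_all add: v_def)
    show "v \<tau> \<in> sp_carrier (sobolev_W 1 4)" by (rule XW[OF vX])
    have "0 < K z" using TK[of z] zR Z(3) by blast
    then have "K z * sp_norm Y (\<lambda>x. steady x - \<theta> x) \<le> K z * (\<epsilon> * W)" using dn by (intro mult_left_mono) auto
    also have "\<dots> \<le> Km * (\<epsilon> * W)" using Kz \<epsilon> W0 by (intro mult_right_mono) auto
    finally have "CX * sp_norm X (v \<tau>) \<le> CX * (Km * (\<epsilon> * W))" using nX CX by (intro mult_left_mono) auto
    then have "sp_norm (sobolev_W 1 4) (v \<tau>) \<le> \<epsilon> * Q" using XWn[OF vX] by (simp add: Q_def mult_ac)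
    moreover have "0 \<le> sp_norm (sobolev_W 1 4) (v \<tau>)"
      unfolding sobolev_W_def by (auto intro!: sum_nonneg simp: Lp_norm_def)
    ultimately show "(sp_norm (sobolev_W 1 4) (v \<tau>))\<^sup>2 \<le> (\<epsilon> * Q)\<^sup>2" by (rule power_mono)
  qed

  define A where "A n \<tau> = (LINT x|torus. \<Theta>2 \<tau> x * wave (?k n) 0 x)" for n \<tau>
  define b where "b n \<tau> = (LINT x|torus. \<Theta>2 \<tau> x * (MG_velocity \<Omega> \<beta> \<eta> (\<Theta>2 \<tau>) x \<bullet> grad (wave (?k n) 0) x))" for n \<tau>
  have close: "AE \<tau> in lebesgue_on {0<..<T z}. \<forall>n\<ge>1. \<bar>A n \<tau>\<bar> \<le> B0 * (\<epsilon> * Q) \<and>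
      \<bar>b n \<tau> - (\<mu> (n + 1) * A (n + 1) \<tau> + \<mu> (n - 1) * A (n - 1) \<tau>)\<bar> \<le> C n * (\<epsilon> * Q)\<^sup>2"
  proof -
    have "AE \<tau> in lebesgue_on {0<..<T z}. \<tau> \<in> {0<..<T z}" by (rule AE_I2) simp
    with same show ?thesis
    proof eventually_elim
      case (elim \<tau>)
      then have \<tau>: "\<tau> \<in> {0..T z}" by simp
      have "integrable torus (\<Theta>2 \<tau>)" using w2 elim(2) by (auto simp: MG_weak_solution_def in_Lp_1_iff)
      then have me: "\<Theta>2 \<tau> \<in> borel_measurable torus" by simp
      have ae: "AE x in torus. \<Theta>2 \<tau> x = steady x - v \<tau> x" using elim(1) by eventually_elim (simp add: v_def)
      note pv = perturbation_velocity[OF par vW[OF \<tau>] me ae]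
      have sv: "sq_int (v \<tau>) \<le> V * (\<epsilon> * Q)\<^sup>2"
        using pv(3)[folded V_def] mult_left_mono[OF vn[OF \<tau>], of V] V by linarith
      have Ab: "\<bar>A n \<tau>\<bar> \<le> B0 * (\<epsilon> * Q)" for n
      proof -
        have one: "sq_integrable (\<lambda>_. 1)" by (rule sq_integrable_continuous) simp
        have wv: "sq_integrable (wave (?k n) 0)" by (intro sq_integrable_continuous continuous_intros)
        have wi: "sq_int (wave (?k n) 0) \<le> (2 * pi) ^ 3"
          using sq_int_mult_wave_le(2)[OF one, of "?k n" 0] measure_torus by (simp add: sq_int_def)
        \<comment> \<open>The steady state is orthogonal to these modes, so the coefficient is that
          of - v and hence of order \<epsilon>.\<close>
        have "A n \<tau> = (LINT x|torus. steady x * wave (?k n) 0 x - v \<tau> x * wave (?k n) 0 x)"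
          unfolding A_def
        proof (rule integral_cong_AE)
          show "AE x in torus. \<Theta>2 \<tau> x * wave (?k n) 0 x = steady x * wave (?k n) 0 x - v \<tau> x * wave (?k n) 0 x"
            using ae by eventually_elim (simp add: left_diff_distrib)
        qed (intro borel_measurable_times borel_measurable_diff me sq_integrable_measurable wv pv(2) sq_integrable_steady)+
        also have "\<dots> = - (LINT x|torus. v \<tau> x * wave (?k n) 0 x)"
          using integral_steady_wave[OF mode_freq_neq_e3[OF j1, of n]]
            sq_integrable_mult[OF sq_integrable_steady wv] sq_integrable_mult[OF pv(2) wv] by simp
        finally have "\<bar>A n \<tau>\<bar> \<le> sqrt (sq_int (v \<tau>)) * sqrt (sq_int (wave (?k n) 0))"
          using Cauchy_Schwarz_torus[OF pv(2) wv] by simp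
        also have "\<dots> \<le> sqrt (V * (\<epsilon> * Q)\<^sup>2) * sqrt ((2 * pi) ^ 3)"
          using sv wi V by (intro mult_mono real_sqrt_le_mono) (auto simp: sq_int_nonneg)
        also have "\<dots> = B0 * (\<epsilon> * Q)" using \<epsilon> Q0 by (simp add: real_sqrt_mult B0_def)
        finally show ?thesis .
      qed
      have "\<bar>b n \<tau> - (\<mu> (n + 1) * A (n + 1) \<tau> + \<mu> (n - 1) * A (n - 1) \<tau>)\<bar> \<le> C n * (\<epsilon> * Q)\<^sup>2" if n: "1 \<le> n" for n
      proof -
        obtain n' where n': "n = Suc n'" using n by (cases n) auto
        have "\<bar>b n \<tau> - (\<mu> (n + 1) * A (n + 1) \<tau> + \<mu> (n - 1) * A (n - 1) \<tau>)\<bar> \<le> C n * (sp_norm (sobolev_W 1 4) (v \<tau>))\<^sup>2"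
          using mode_flux[OF par vW[OF \<tau>] me ae, of "?k n"]
          by (simp add: n' mode_freq_add mode_freq_diff b_def \<mu>_def A_def C_def V_def mult.assoc)
        also have "\<dots> \<le> C n * (\<epsilon> * Q)\<^sup>2" by (intro mult_left_mono vn[OF \<tau>] C0)
        finally show ?thesis .
      qed
      then show ?case using Ab by blast
    qed
  qed
  \<comment> \<open>A time beyond Tm / 2 keeps the exponent proportional to j^2, while the
    coefficient bounds hold there.\<close>
  obtain t where t: "Tm / 2 < t" "t < T z" and At: "\<And>n. 1 \<le> n \<Longrightarrow> \<bar>A n t\<bar> \<le> B0 * (\<epsilon> * Q)"
    using AE_interval_witness[OF close, of "Tm / 2"] Tm Tz by auto
  define A0 where "A0 n = (LINT x|torus. \<theta> x * wave (?k n) 0 x)" for n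
  have t0: "0 < t" using t Tm by linarith
  define \<rho> where "\<rho> = B1 * (B0 * (\<epsilon> * Q)) * (\<psi> M + \<psi> (M + 1)) + (\<Sum>n\<in>{1..M}. \<psi> n * (C n * (\<epsilon> * Q)\<^sup>2))"
  have \<theta>m: "\<theta> \<in> borel_measurable torus"
    unfolding \<theta>_def[abs_def] by (intro measurable_torus_continuous continuous_intros)
  have grow: "((\<Sum>n\<in>{1..M}. \<psi> n * A0 n) - \<rho> / l) * exp (l * t) + \<rho> / l \<le> (\<Sum>n\<in>{1..M}. \<psi> n * A n t)"
    unfolding \<rho>_def
  proof (rule unstable_growth[where l = l and \<psi> = \<psi> and d = d and \<mu> = \<mu> and A = A and b = b and T = "T z",
        OF l0 \<psi>0 \<psi>p _ \<mu>0 \<mu>p \<mu>b M1 t0 t(2) _ _ close])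
    show "(l + d n) * \<psi> n = \<mu> n * (\<psi> (n + 1) + \<psi> (n - 1))" if "1 \<le> n" for n
      using \<psi>e[OF that] by (simp add: d_def \<mu>_def)
    show "integrable (lebesgue_on {0<..<s}) (\<lambda>\<tau>. - d n * A n \<tau> + b n \<tau>)"
      and "A n s = A0 n + (LINT \<tau>|lebesgue_on {0<..<s}. - d n * A n \<tau> + b n \<tau>)"
      if "1 \<le> n" "s \<in> {0<..<T z}" for n s
      using mode_equation[OF \<gamma> w2 \<theta>m mode_freq_neq_e3[OF j1, of n] that(2)] by (simp_all add: A_def b_def d_def A0_def)
  qed auto
  \<comment> \<open>The perturbation sits in the single mode \<open>m\<close>, where \<psi> equals
    1; M \<ge> N \<ge> m ensures that the truncated sum contains it.\<close>
  have init: "(\<Sum>n\<in>{1..M}. \<psi> n * A0 n) = \<epsilon> * h"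
  proof -
    have "A0 n = (if n = m then \<epsilon> * h else 0)" for n
    proof -
      have ne: "?k m + ?k n \<noteq> 0" using j1 by (auto simp: vec_eq_iff forall_3 mode_freq_nth)
      have inj: "?k m = ?k n \<longleftrightarrow> n = m" by (auto simp: vec_eq_iff forall_3 mode_freq_nth)
      have wi: "integrable torus (\<lambda>x. wave k a x * wave l b x)" for k l a b
        by (intro integrable_torus_continuous continuous_intros)
      have "A0 n = (LINT x|torus. 2 * wave e3 (pi / 2) x * wave (?k n) 0 x) + (LINT x|torus. \<epsilon> * (wave (?k m) 0 x * wave (?k n) 0 x))"
        unfolding A0_def \<theta>_def distrib_right mult.assoc
        by (rule Bochner_Integration.integral_add) (intro integrable_mult_right wi)+
      also have "(LINT x|torus. 2 * wave e3 (pi / 2) x * wave (?k n) 0 x) = 0"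
        using integral_steady_wave[OF mode_freq_neq_e3[OF j1, of n]] by (simp add: steady_def)
      also have "(LINT x|torus. \<epsilon> * (wave (?k m) 0 x * wave (?k n) 0 x)) = (if n = m then \<epsilon> * h else 0)"
        using ne by (simp add: torus_integral_wave_mult inj h_def)
      finally show ?thesis by simp
    qed
    then have "(\<Sum>n\<in>{1..M}. \<psi> n * A0 n) = (\<Sum>n\<in>{1..M}. if n = m then \<epsilon> * h else 0)"
      using m(3) by (intro sum.cong) auto
    then show ?thesis using m M(1) by simp
  qed
  have \<rho>0: "0 \<le> \<rho>"
    unfolding \<rho>_def using \<psi>p C0 B1 B0 \<epsilon> Q0 M1
    by (intro add_nonneg_nonneg mult_nonneg_nonneg sum_nonneg) (auto simp: less_imp_le)
  \<comment> \<open>Truncation and nonlinearity contribute a quarter each, so \<rho> / l removes at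
    most half of the initial value \<epsilon> h.\<close>
  have \<rho>b: "\<rho> \<le> \<epsilon> * (l * h / 2)"
  proof -
    have "\<psi> M + \<psi> (M + 1) \<le> 2 ^ N * (1 / 2) ^ M + 2 ^ N * (1 / 2) ^ M"
    proof (rule add_mono)
      show "\<psi> M \<le> 2 ^ N * (1 / 2) ^ M" by (rule \<psi>b[OF M1])
      have "\<psi> (M + 1) \<le> 2 ^ N * (1 / 2) ^ (M + 1)" by (rule \<psi>b) simp
      also have "\<dots> \<le> 2 ^ N * (1 / 2) ^ M" by simp
      finally show "\<psi> (M + 1) \<le> 2 ^ N * (1 / 2) ^ M" .
    qed
    then have "B1 * (B0 * (\<epsilon> * Q)) * (\<psi> M + \<psi> (M + 1)) \<le> B1 * (B0 * (\<epsilon> * Q)) * (2 * (2 ^ N * (1 / 2) ^ M))"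
      using B1 B0 \<epsilon> Q0 by (intro mult_left_mono) auto
    also have "\<dots> = \<epsilon> * bd M" by (simp add: bd_def)
    also have "\<dots> \<le> \<epsilon> * (l * h / 4)" using M(2) \<epsilon> by (intro mult_left_mono) auto
    finally have 1: "B1 * (B0 * (\<epsilon> * Q)) * (\<psi> M + \<psi> (M + 1)) \<le> \<epsilon> * (l * h / 4)" .
    have "(\<Sum>n\<in>{1..M}. \<psi> n * (C n * (\<epsilon> * Q)\<^sup>2)) = \<epsilon> * (\<epsilon> * E)"
      by (simp add: E_def sum_distrib_left power_mult_distrib power2_eq_square mult_ac)
    also have "\<dots> \<le> \<epsilon> * (l * h / 4)" using \<epsilon>E \<epsilon> by (intro mult_left_mono) auto
    finally have 2: "(\<Sum>n\<in>{1..M}. \<psi> n * (C n * (\<epsilon> * Q)\<^sup>2)) \<le> \<epsilon> * (l * h / 4)" .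
    have "\<epsilon> * (l * h / 4) + \<epsilon> * (l * h / 4) = \<epsilon> * (l * h / 2)" by simp
    then show ?thesis using 1 2 unfolding \<rho>_def by linarith
  qed
  have "\<epsilon> * (h / 2 * exp (l * t)) \<le> (\<epsilon> * h - \<rho> / l) * exp (l * t)"
  proof -
    have "\<rho> / l \<le> \<epsilon> * h / 2" using \<rho>b l0 by (simp add: pos_divide_le_eq mult_ac)
    then have "\<epsilon> * (h / 2) \<le> \<epsilon> * h - \<rho> / l" by simp
    then have "\<epsilon> * (h / 2) * exp (l * t) \<le> (\<epsilon> * h - \<rho> / l) * exp (l * t)" by (rule mult_right_mono) simp
    then show ?thesis by (simp add: mult.assoc)
  qed
  also have "\<dots> \<le> (\<Sum>n\<in>{1..M}. \<psi> n * A n t)"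
    using grow \<rho>0 l0 unfolding init by (smt (verit) divide_nonneg_pos)
  also have "\<dots> \<le> (\<Sum>n\<in>{1..M}. 2 ^ N * (1 / 2) ^ n * (B0 * (\<epsilon> * Q)))"
  proof (rule sum_mono)
    fix n assume "n \<in> {1..M}"
    then have n: "1 \<le> n" by simp
    have "\<psi> n * A n t \<le> \<psi> n * (B0 * (\<epsilon> * Q))" using At[OF n] \<psi>p[OF n] by (intro mult_left_mono) auto
    also have "\<dots> \<le> 2 ^ N * (1 / 2) ^ n * (B0 * (\<epsilon> * Q))"
      using \<psi>b[OF n] B0 \<epsilon> Q0 by (intro mult_right_mono) auto
    finally show "\<psi> n * A n t \<le> 2 ^ N * (1 / 2) ^ n * (B0 * (\<epsilon> * Q))" .
  qed
  also have "\<dots> = 2 ^ N * (B0 * (\<epsilon> * Q)) * (\<Sum>n\<in>{1..M}. (1 / 2) ^ n)"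
    by (simp add: sum_distrib_left mult_ac)
  \<comment> \<open>The weights sum to at most 2^N for every cutoff. The upper bound must not depend
    on \<open>M\<close>, which was chosen after \<open>j\<close>.\<close>
  also have "\<dots> \<le> 2 ^ N * (B0 * (\<epsilon> * Q)) * 1"
  proof (rule mult_left_mono)
    have "(\<Sum>n\<in>{1..M}. (1 / 2) ^ n) = 1 - (1 / 2 :: real) ^ M" by (induction M) (auto simp: field_simps)
    then show "(\<Sum>n\<in>{1..M}. (1 / 2 :: real) ^ n) \<le> 1" by simp
  qed (use B0 \<epsilon> Q0 in auto)
  also have "\<dots> = \<epsilon> * (2 ^ N * B0 * Q)" by simp
  \<comment> \<open>Both sides are linear in \<epsilon>, and dividing by it removes the last
    quantity not controlled in terms of \<open>j\<close>.\<close>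
  finally have "h / 2 * exp (l * t) \<le> 2 ^ N * B0 * Q" using \<epsilon> by simp
  also have "\<dots> \<le> q * real j ^ (4 * p)"
  proof -
    have "2 ^ N * B0 * Q \<le> 2 ^ N * B0 * (CX * Km * (CY * (3 + real N ^ 2) ^ p * real j ^ (4 * p)))"
      unfolding Q_def using Wb B0 CX Km by (intro mult_left_mono) auto
    then show ?thesis by (simp add: q_def mult_ac)
  qed
  also have "\<dots> < h / 2 * exp (c * Tm / 2 * real j ^ 2)" by (rule jq)
  also have "\<dots> \<le> h / 2 * exp (l * t)"
  proof -
    have "(c * real j ^ 2) * (Tm / 2) \<le> l * t" using l t(1) Tm l0 by (intro mult_mono) auto
    then show ?thesis using h by (simp add: mult_ac)
  qed
  finally show False by simp
qed

end
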